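(* Let $\phi$ be a Ma-Minda function, $n\in\mathbb{N}$, and let $f=h+\overline{g}\in\mathcal{HC}_n(\phi)$, with $h(z)=z+\sum_{k=2}^\infty a_kz^k$, $g(z)=\sum_{k=1}^\infty b_kz^k$ and $g'(z)=\zeta z^nh'(z)$, $|\zeta|\le\frac1{2n-1}$. Then the majorant series of $f$ satisfies $$|z|+\sum_{k=2}^{\infty}(|a_k|+|b_k|)|z|^k\leq d(f(0),\partial f(\mathbb{D}))$$ for $|z|=r\le\min\{1/3,r_f\}$, where $r_f$ is the smallest positive root in $(0,1)$ of $$L(\zeta,n,1)=M_K(r)+|\zeta|\int_0^r t^nM_{K'}(t)\,dt,$$ with $$L(\zeta,n,1)=-K(-1)-|\zeta|\int_0^1t^nK'(-t)\,dt.$$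
   Context: $\mathbb{D}=\{z\in\mathbb{C}:|z|<1\}$; $d(\cdot,\cdot)$ is Euclidean distance; $\prec$ denotes subordination of analytic functions in $\mathbb{D}$. A Ma-Minda function is an analytic univalent function $\phi:\mathbb{D}\to\mathbb{C}$ such that $\phi(\mathbb{D})$ lies in the right half-plane (positive real part), is symmetric with respect to the real axis and starlike with respect to $\phi(0)=1$, and $\phi'(0)>0$. $\mathcal{S}$ is the class of univalent analytic functions $h$ in $\mathbb{D}$ with $h(0)=h'(0)-1=0$, and $\mathcal{C}(\phi)$ is the class of $h\in\mathcal{S}$ with $1+\frac{zh''(z)}{h'(z)}\prec\phi(z)$. The function $$K(z)=\int_0^z\exp\left(\int_0^{s}\frac{\phi(t)-1}{t}\,dt\right)ds\quad(z\in\mathbb{D})$$ satisfies $1+\frac{zK''(z)}{K'(z)}=\phi(z)$. The value $K(-1)$ is understood as the limit of $K(-r)$ as $r\to1^-$. $\mathcal{H}$ is the class of sense-preserving harmonic mappings $f=h+\overline{g}$ in $\mathbb{D}$ (i.e. $|h'|>|g'|$), where $h(z)=z+\sum_{k=2}^\infty a_kz^k$ and $g(z)=\sum_{k=1}^\infty b_kz^k$ are analytic in $\mathbb{D}$. For $n\in\mathbb{N}$, $\mathcal{HC}_n(\phi)$ is the class of $f=h+\overline{g}\in\mathcal{H}$ such that $h\in\mathcal{C}(\phi)$ and $g'(z)=\zeta z^nh'(z)$ with $\zeta\in\mathbb{C}$, $|\zeta|\le\frac1{2n-1}$. For an analytic function $F(z)=\sum_{k\ge0}c_kz^k$ in $\mathbb{D}$,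 $M_F(r)=\sum_{k\ge0}|c_k|r^k$ denotes its majorant series. *)

theory Defs
  imports "HOL-Complex_Analysis.Complex_Analysis"
begin

abbreviation unit_disc :: "complex set" where
  "unit_disc \<equiv> ball 0 1"

definition ma_minda :: "(complex \<Rightarrow> complex) \<Rightarrow> bool" where
  "ma_minda \<phi> \<longleftrightarrow>
     \<phi> holomorphic_on unit_disc \<and> inj_on \<phi> unit_disc \<and>
     (\<forall>z\<in>unit_disc. Re (\<phi> z) > 0) \<and>
     cnj ` (\<phi> ` unit_disc) = \<phi> ` unit_disc \<and>
     \<phi> 0 = 1 \<and> (\<forall>w\<in>\<phi> ` unit_disc. closed_segment 1 w \<subseteq> \<phi> ` unit_disc) \<and>
     deriv \<phi> 0 \<in> \<real> \<and> Re (deriv \<phi> 0) > 0"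

definition subordinate :: "(complex \<Rightarrow> complex) \<Rightarrow> (complex \<Rightarrow> complex) \<Rightarrow> bool" where
  "subordinate F G \<longleftrightarrow>
     F holomorphic_on unit_disc \<and> G holomorphic_on unit_disc \<and>
     (\<exists>w. w holomorphic_on unit_disc \<and> w 0 = 0 \<and> w ` unit_disc \<subseteq> unit_disc \<and>
          (\<forall>z\<in>unit_disc. F z = G (w z)))"

definition class_S :: "(complex \<Rightarrow> complex) set" where
  "class_S = {h. h holomorphic_on unit_disc \<and> inj_on h unit_disc \<and> h 0 = 0 \<and> deriv h 0 = 1}"

definition class_C :: "(complex \<Rightarrow> complex) \<Rightarrow> (complex \<Rightarrow> complex) set" where
  "class_C \<phi> = {h \<in> class_S. subordinate (\<lambda>z. 1 + z * deriv (deriv h) z / deriv h z) \<phi>}"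

text \<open>The integrals run along segments. The inner integrand has a removable singularity at
  \<open>t = 0\<close>; the value it takes there (\<open>x / 0 = 0\<close>) does not affect the integral.\<close>

definition K_fun :: "(complex \<Rightarrow> complex) \<Rightarrow> complex \<Rightarrow> complex" where
  "K_fun \<phi> z = contour_integral (linepath 0 z)
     (\<lambda>s. exp (contour_integral (linepath 0 s) (\<lambda>t. (\<phi> t - 1) / t)))"

text \<open>\<open>f = h + cnj g\<close> belongs to the class \<open>\<H>\<close>, with analytic part \<open>h\<close> and co-analytic part
  \<open>g\<close>; the values at 0 express that the power series are \<open>z + a\<^sub>2 z^2 + \<dots>\<close> and
  \<open>b\<^sub>1 z + b\<^sub>2 z^2 + \<dots>\<close>.\<close>

definition class_H_parts ::
  "(complex \<Rightarrow> complex) \<Rightarrow> (complex \<Rightarrow> complex) \<Rightarrow> (complex \<Rightarrow> complex) \<Rightarrow> bool" where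
  "class_H_parts f h g \<longleftrightarrow>
     h holomorphic_on unit_disc \<and> g holomorphic_on unit_disc \<and>
     h 0 = 0 \<and> deriv h 0 = 1 \<and> g 0 = 0 \<and>
     (\<forall>z\<in>unit_disc. f z = h z + cnj (g z)) \<and>
     (\<forall>z\<in>unit_disc. norm (deriv h z) > norm (deriv g z))"

definition class_HC :: "nat \<Rightarrow> (complex \<Rightarrow> complex) \<Rightarrow> (complex \<Rightarrow> complex) set" where
  "class_HC n \<phi> = {f. \<exists>h g \<zeta>. class_H_parts f h g \<and> h \<in> class_C \<phi> \<and>
     (\<forall>z\<in>unit_disc. deriv g z = \<zeta> * z ^ n * deriv h z) \<and> norm \<zeta> \<le> 1 / (2 * real n - 1)}"

definition majorant :: "(complex \<Rightarrow> complex) \<Rightarrow> real \<Rightarrow> real" where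
  "majorant F r = (\<Sum>k. norm (fps_nth (fps_expansion F 0) k) * r ^ k)"

text \<open>The quantity \<open>L(\<zeta>, n, 1)\<close>. It is a real number by the symmetry of \<open>\<phi>\<close>, but is kept in
  the complex numbers here, as \<open>K\<close> takes complex values. The limit stands for \<open>K(-1)\<close>.\<close>

definition L_one :: "(complex \<Rightarrow> complex) \<Rightarrow> complex \<Rightarrow> nat \<Rightarrow> complex" where
  "L_one \<phi> \<zeta> n =
     - Lim (at_left (1::real)) (\<lambda>r. K_fun \<phi> (- of_real r))
     - of_real (norm \<zeta>) * integral {0..1::real} (\<lambda>t. of_real t ^ n * deriv (K_fun \<phi>) (- of_real t))"

definition bohr_root :: "(complex \<Rightarrow> complex) \<Rightarrow> complex \<Rightarrow> nat \<Rightarrow> real \<Rightarrow> bool" where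
  "bohr_root \<phi> \<zeta> n r \<longleftrightarrow> 0 < r \<and> r < 1 \<and>
     L_one \<phi> \<zeta> n = of_real (majorant (K_fun \<phi>) r
       + norm \<zeta> * integral {0..r} (\<lambda>t. t ^ n * majorant (deriv (K_fun \<phi>)) t))"

end

theory Submission imports Defs begin

text \<open>
  Let \<open>Q = log K'\<close>, so that \<open>z * Q' = \<phi> - 1\<close>, and let \<open>P = log h'\<close>; the hypothesis on \<open>h\<close> says
  \<open>z * P' = \<phi> \<circ> w - 1\<close> for a Schwarz function \<open>w\<close>. Let \<open>L\<close> be the integral of
  \<open>(1 - \<bar>\<zeta>\<bar> * t ^ n) * K' (-t)\<close> over \<open>[0, 1]\<close>, which is the value \<open>L(\<zeta>, n, 1)\<close>. The theorem
  compares both sides of the inequality with \<open>L\<close>.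

  The left-hand side is at most \<open>L\<close>. Since \<open>\<phi> - 1\<close> is starlike, \<open>Q\<close> is univalent
  (\<open>log_dK_inj\<close>), and an argument of Jack type gives \<open>P = Q \<circ> \<omega>\<close> with \<open>\<bar>\<omega> z\<bar> \<le> \<bar>z\<bar>\<close>
  (\<open>subordinate_log_dK\<close>), that is, \<open>h' = K' \<circ> \<omega>\<close>. Bohr's inequality then bounds the majorant
  series of \<open>h'\<close> by that of \<open>K'\<close> for \<open>r \<le> 1 / 3\<close> (\<open>majorant_subordinate\<close>). Integrating this, and
  likewise \<open>g' = \<zeta> * z ^ n * h'\<close>, bounds the left-hand side by the function
  \<open>bohr_fun\<close> of \<open>r\<close>. This function is strictly increasing and takes the value \<open>L\<close> at exactly one
  point \<open>r\<^sub>f\<close> of \<open>(0, 1)\<close> (\<open>bohr_fun_root\<close>); the root does not escape to \<open>1\<close> because the second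
  coefficient of \<open>K'\<close> is \<open>\<phi>'(0) > 0\<close>.

  The distance from \<open>f 0 = 0\<close> to the boundary is at least \<open>L\<close>. The minimum principle gives
  \<open>\<bar>h' z\<bar> \<ge> K' (-\<bar>z\<bar>)\<close> (\<open>Re_log_dK_lower_bound\<close>), so \<open>f\<close> expands a line element at \<open>z\<close> by at least
  \<open>(1 - \<bar>\<zeta>\<bar> * \<bar>z\<bar> ^ n) * K' (-\<bar>z\<bar>)\<close>. Pulling back the segment from \<open>0\<close> to a boundary point \<open>p\<close> and
  integrating yields \<open>\<bar>p\<bar> \<ge> L\<close> (\<open>harmonic_distance_to_frontier\<close>).

  Two points need care. The pull-back uses that \<open>f\<close> is injective, and the boundary must be nonempty,
  since \<open>infdist\<close> to the empty set is \<open>0\<close>. Both follow from the convexity of the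
  image of \<open>h\<close> (\<open>convexity_imp_convex_image\<close>): as a function of \<open>h z\<close>, the part \<open>g\<close> is a strict
  contraction (\<open>harmonic_contraction\<close>, \<open>harmonic_image_neq_UNIV\<close>).
\<close>

section \<open>Extremal points, positive real part, univalence criteria\<close>

text \<open>The analytic core of Jack's lemma. If \<open>u\<close> attains its minimum over the closed disc
  \<open>\<bar>z\<bar> \<le> \<bar>z0\<bar>\<close> at \<open>z0\<close>, then its tangential derivative vanishes there and its outward
  radial derivative is not positive; for the differential \<open>v \<mapsto> Re (c * v)\<close> this says that
  \<open>c * z0\<close> is real and not positive.\<close>

lemma extremal_point_on_disc:
  fixes u :: "complex \<Rightarrow> real"
  assumes "z0 \<noteq> 0" and der: "(u has_derivative (\<lambda>v. Re (c * v))) (at z0)"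
    and min: "\<And>z. norm z \<le> norm z0 \<Longrightarrow> u z0 \<le> u z"
  shows "Im (c * z0) = 0" and "Re (c * z0) \<le> 0"
proof -
  \<comment> \<open>rotate: an interior minimum, so the derivative vanishes\<close>
  have "((\<lambda>t. u (z0 * cis t)) has_derivative (\<lambda>t. Re (c * (z0 * (t *\<^sub>R (\<i> * cis 0)))))) (at 0)"
  proof (rule has_derivative_compose[where g = u and g' = "\<lambda>v. Re (c * v)"])
    show "((\<lambda>t. z0 * cis t) has_derivative (\<lambda>t. z0 * (t *\<^sub>R (\<i> * cis 0)))) (at 0)"
      by (auto intro!: derivative_eq_intros)
  qed (use der in simp)
  hence "((\<lambda>t. u (z0 * cis t)) has_real_derivative (- Im (c * z0))) (at 0)"
    unfolding has_field_derivative_def by (rule has_derivative_eq_rhs) (auto simp: algebra_simps)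
  from DERIV_local_min[OF this, of 1] show "Im (c * z0) = 0"
    using min by (simp add: norm_mult)
  \<comment> \<open>move inwards: a one-sided minimum, so the derivative is not negative\<close>
  have "((\<lambda>t. u (z0 * of_real (1 - t))) has_derivative (\<lambda>t. Re (c * (z0 * of_real (- t))))) (at 0)"
  proof (rule has_derivative_compose[where g = u and g' = "\<lambda>v. Re (c * v)"])
    show "((\<lambda>t. z0 * of_real (1 - t)) has_derivative (\<lambda>t. z0 * of_real (- t))) (at 0)"
      by (auto intro!: derivative_eq_intros)
  qed (use der in simp)
  hence D: "((\<lambda>t. u (z0 * of_real (1 - t))) has_real_derivative (- Re (c * z0))) (at 0)"
    unfolding has_field_derivative_def by (rule has_derivative_eq_rhs) (auto simp: algebra_simps)
  show "Re (c * z0) \<le> 0"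
  proof (rule ccontr)
    assume "\<not> ?thesis"
    hence "- Re (c * z0) < 0" by simp
    from DERIV_neg_dec_right[OF D this] obtain d where "d > 0"
      and d: "\<And>h. 0 < h \<Longrightarrow> h < d \<Longrightarrow> u (z0 * of_real (1 - (0 + h))) < u (z0 * of_real (1 - 0))"
      by metis
    define h where "h = min (d / 2) 1"
    have "0 < h" "h < d" "h \<le> 1" using \<open>d > 0\<close> by (auto simp: h_def)
    have "norm (z0 * complex_of_real (1 - h)) = norm z0 * (1 - h)"
      using \<open>h \<le> 1\<close> by (simp only: norm_mult norm_of_real)
    hence "norm (z0 * complex_of_real (1 - h)) \<le> norm z0"
      using \<open>0 < h\<close> \<open>h \<le> 1\<close> by (simp add: mult_left_le)
    from min[OF this] d[OF \<open>0 < h\<close> \<open>h < d\<close>] show False by simp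
  qed
qed

text \<open>By the open mapping theorem a holomorphic function with \<open>Re F \<ge> 0\<close> cannot touch the
  imaginary axis unless it is constant.\<close>

lemma Re_pos_of_nonneg:
  assumes hol: "F holomorphic_on S" and S: "open S" "connected S"
    and nonneg: "\<And>z. z \<in> S \<Longrightarrow> 0 \<le> Re (F z)" and a: "a \<in> S" "0 < Re (F a)" and z: "z \<in> S"
  shows "0 < Re (F z)"
proof (cases "F constant_on S")
  case True
  thus ?thesis using a z by (metis constant_on_def)
next
  case False
  have op: "open (F ` S)" by (rule open_mapping_thm[OF hol S S(1) order_refl False])
  have "F ` S \<subseteq> interior {w. 0 \<le> Re w}"
    by (rule interior_maximal[OF _ op]) (use nonneg in auto)
  also have "\<dots> = {w. 0 < Re w}"
    using interior_halfspace_ge[of "1::complex" 0] by (simp add: inner_complex_def)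
  finally show ?thesis using z by auto
qed

text \<open>The Noshiro-Warschawski criterion.\<close>

lemma inj_on_convex_Re_deriv_pos:
  assumes "convex S" and der: "\<And>z. z \<in> S \<Longrightarrow> (F has_field_derivative F' z) (at z)"
    and pos: "\<And>z. z \<in> S \<Longrightarrow> 0 < Re (F' z)"
  shows "inj_on F S"
proof (rule inj_onI, rule ccontr)
  fix a b assume ab: "a \<in> S" "b \<in> S" "F a = F b" "a \<noteq> b"
  have sub: "closed_segment a b \<subseteq> S" using ab assms(1) by (simp add: closed_segment_subset)
  have "\<exists>u. u \<in> closed_segment a b \<and> Re (F b / (b - a)) - Re (F a / (b - a)) = Re (F' u / (b - a) * (b - a))"
    by (rule complex_mvt_line) (use der sub in \<open>auto intro!: DERIV_cdivide\<close>)
  then obtain u where "u \<in> closed_segment a b" "0 = Re (F' u / (b - a) * (b - a))"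
    using ab by auto
  thus False using pos[of u] sub ab by auto
qed

section \<open>Ma-Minda functions\<close>

lemma ma_mindaD:
  assumes "ma_minda \<phi>"
  shows "\<phi> holomorphic_on unit_disc" "inj_on \<phi> unit_disc" "\<phi> 0 = 1"
    "\<And>z. norm z < 1 \<Longrightarrow> 0 < Re (\<phi> z)" "deriv \<phi> 0 \<in> \<real>" "0 < Re (deriv \<phi> 0)"
    "cnj ` (\<phi> ` unit_disc) = \<phi> ` unit_disc"
    "\<And>z. norm z < 1 \<Longrightarrow> closed_segment 1 (\<phi> z) \<subseteq> \<phi> ` unit_disc"
  using assms unfolding ma_minda_def by auto

lemma ma_minda_inverse:
  assumes "ma_minda \<phi>"
  obtains \<eta> where "\<eta> holomorphic_on (\<phi> ` unit_disc)" "\<And>z. norm z < 1 \<Longrightarrow> \<eta> (\<phi> z) = z"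
    "\<And>z. norm z < 1 \<Longrightarrow> deriv \<phi> z * deriv \<eta> (\<phi> z) = 1"
  using holomorphic_has_inverse[OF ma_mindaD(1)[OF assms] open_ball ma_mindaD(2)[OF assms]] 
  by (metis dist_0_norm mem_ball)

lemma ma_minda_starlike_mem:
  assumes "ma_minda \<phi>" "norm z < 1" "0 \<le> \<tau>" "\<tau> \<le> 1"
  shows "1 + of_real \<tau> * (\<phi> z - 1) \<in> \<phi> ` unit_disc"
proof -
  have "1 + of_real \<tau> * (\<phi> z - 1) \<in> closed_segment 1 (\<phi> z)"
    unfolding in_segment using assms by (intro exI[of _ \<tau>]) (auto simp: scaleR_conv_of_real algebra_simps)
  thus ?thesis using ma_mindaD(8)[OF assms(1,2)] by blast
qed

text \<open>Starlikeness of the image in the form used below: moving a value \<open>\<phi> v\<close> straight towards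
  the centre \<open>1\<close> does not increase the modulus of its preimage. This is Schwarz's lemma for
  \<open>z \<mapsto> \<phi>\<^sup>-\<^sup>1(1 + \<tau> (\<phi> z - 1))\<close>.\<close>

lemma ma_minda_starlike:
  assumes mm: "ma_minda \<phi>" and u: "norm u < 1" and v: "norm v < 1" and \<tau>: "0 \<le> \<tau>" "\<tau> \<le> 1"
    and eq: "\<phi> u - 1 = of_real \<tau> * (\<phi> v - 1)"
  shows "norm u \<le> norm v"
proof -
  obtain \<eta> where \<eta>: "\<eta> holomorphic_on (\<phi> ` unit_disc)" "\<And>z. norm z < 1 \<Longrightarrow> \<eta> (\<phi> z) = z"
    using ma_minda_inverse[OF mm] by metis
  define \<omega> where "\<omega> = (\<lambda>z. \<eta> (1 + of_real \<tau> * (\<phi> z - 1)))"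
  have mem: "1 + of_real \<tau> * (\<phi> z - 1) \<in> \<phi> ` unit_disc" if "norm z < 1" for z
    by (rule ma_minda_starlike_mem[OF mm that \<tau>])
  have "\<omega> holomorphic_on unit_disc" unfolding \<omega>_def
    by (rule holomorphic_on_compose_gen[OF _ \<eta>(1), unfolded o_def])
      (use mem ma_mindaD(1)[OF mm] in \<open>auto intro!: holomorphic_intros\<close>)
  moreover have "\<omega> 0 = 0" using \<eta>(2)[of 0] ma_mindaD(3)[OF mm] by (simp add: \<omega>_def)
  moreover have "norm (\<omega> z) < 1" if "norm z < 1" for z
    using mem[OF that] \<eta>(2) by (auto simp: \<omega>_def)
  ultimately have "norm (\<omega> v) \<le> norm v" by (rule Schwarz_Lemma(1)) (use v in auto)
  moreover have "\<omega> v = u" using eq \<eta>(2)[OF u] by (simp add: \<omega>_def flip: eq)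
  ultimately show ?thesis by simp
qed

text \<open>The image of \<open>\<phi>\<close> is symmetric, so \<open>\<phi>\<close> and \<open>cnj \<circ> \<phi> \<circ> cnj\<close> are Riemann maps onto the same domain.
  They have the same value and the same positive derivative at \<open>0\<close>, hence agree by the equality
  case of Schwarz's lemma.\<close>

lemma ma_minda_cnj:
  assumes mm: "ma_minda \<phi>" and z: "norm z < 1"
  shows "\<phi> (cnj z) = cnj (\<phi> z)"
proof -
  obtain \<eta> where \<eta>: "\<eta> holomorphic_on (\<phi> ` unit_disc)" "\<And>z. norm z < 1 \<Longrightarrow> \<eta> (\<phi> z) = z"
    "\<And>z. norm z < 1 \<Longrightarrow> deriv \<phi> z * deriv \<eta> (\<phi> z) = 1"
    using ma_minda_inverse[OF mm] by metis
  define \<psi> where "\<psi> = cnj \<circ> \<phi> \<circ> cnj"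
  have im: "cnj ` unit_disc = unit_disc"
    unfolding image_cnj_conv_vimage_cnj by auto
  have hol: "\<psi> holomorphic_on unit_disc"
    unfolding \<psi>_def by (rule holomorphic_on_compose_cnj_cnj) (use im ma_mindaD(1)[OF mm] in auto)
  have mem: "\<psi> z \<in> \<phi> ` unit_disc" if "norm z < 1" for z
  proof -
    have "\<psi> z \<in> cnj ` (\<phi> ` unit_disc)" unfolding \<psi>_def o_def using that by (intro imageI) simp
    thus ?thesis by (simp only: ma_mindaD(7)[OF mm])
  qed
  have \<phi>d: "(\<phi> has_field_derivative deriv \<phi> 0) (at 0)"
    using holomorphic_derivI[OF ma_mindaD(1)[OF mm], of 0] by simp
  have "(\<psi> has_field_derivative cnj (deriv \<phi> 0)) (at 0)"
    unfolding \<psi>_def using has_field_derivative_cnj_cnj[of \<phi> "deriv \<phi> 0" 0] \<phi>d by simp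
  hence \<psi>d: "(\<psi> has_field_derivative deriv \<phi> 0) (at 0)"
    using ma_mindaD(5)[OF mm] by (simp add: Reals_cnj_iff)
  define \<omega> where "\<omega> = \<eta> \<circ> \<psi>"
  have h\<omega>: "\<omega> holomorphic_on unit_disc" unfolding \<omega>_def
    by (rule holomorphic_on_compose_gen[OF hol \<eta>(1)]) (use mem in auto)
  moreover have w0: "\<omega> 0 = 0" using \<eta>(2)[of 0] ma_mindaD(3)[OF mm] by (simp add: \<omega>_def \<psi>_def)
  moreover have b: "norm (\<omega> z) < 1" if "norm z < 1" for z
    using mem[OF that] \<eta>(2) by (auto simp: \<omega>_def)
  have op: "open (\<phi> ` unit_disc)" using mm ma_mindaD(1,2) open_mapping_thm3 by blast
  have m0: "\<psi> 0 \<in> \<phi> ` unit_disc" by (rule mem) simp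
  have "(\<omega> has_field_derivative (deriv \<eta> (\<psi> 0) * deriv \<phi> 0)) (at 0)"
    unfolding \<omega>_def o_def
    by (rule DERIV_chain2[OF _ \<psi>d]) (use holomorphic_derivI[OF \<eta>(1) op m0] in simp)
  moreover have "deriv \<eta> (\<psi> 0) * deriv \<phi> 0 = 1"
    using \<eta>(3)[of 0] ma_mindaD(3)[OF mm] by (simp add: \<psi>_def mult.commute)
  ultimately have d0: "(\<omega> has_field_derivative 1) (at 0)" by simp
  \<comment> \<open>equality in Schwarz's lemma: \<open>\<omega>\<close> is a rotation, and its derivative at \<open>0\<close> is \<open>1\<close>\<close>
  from Schwarz_Lemma(3)[OF h\<omega> w0 b, of 0] obtain \<alpha> where \<alpha>: "\<And>z. norm z < 1 \<Longrightarrow> \<omega> z = \<alpha> * z"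
    using DERIV_imp_deriv[OF d0] by auto
  have "(\<omega> has_field_derivative \<alpha>) (at 0)"
    by (rule has_field_derivative_transform_within_open[of "\<lambda>z. \<alpha> * z" _ _ unit_disc]) 
      (auto intro!: derivative_eq_intros simp: \<alpha>)
  hence "\<alpha> = 1" using d0 by (rule DERIV_unique)
  hence "\<omega> z = z" using \<alpha> z by simp
  moreover obtain x where "norm x < 1" "\<psi> z = \<phi> x" using mem[OF z] by auto
  ultimately have "\<psi> z = \<phi> z" using \<eta>(2)[of x] by (auto simp: \<omega>_def)
  thus ?thesis by (simp add: \<psi>_def) (metis complex_cnj_cnj)
qed

lemma ma_minda_Im_of_real:
  assumes "ma_minda \<phi>" "\<bar>x\<bar> < 1"
  shows "Im (\<phi> (of_real x)) = 0"
  using ma_minda_cnj[OF assms(1), of "of_real x"] assms(2) by (simp add: complex_eq_iff)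

lemma ma_minda_real_preimage:
  assumes mm: "ma_minda \<phi>" and z: "norm z < 1" and "Im (\<phi> z) = 0"
  shows "z = of_real (Re z)"
proof -
  have "\<phi> (cnj z) = \<phi> z" using ma_minda_cnj[OF mm z] assms(3) by (simp add: complex_eq_iff)
  hence "cnj z = z" using inj_onD[OF ma_mindaD(2)[OF mm]] z by simp
  thus ?thesis by (simp add: complex_eq_iff)
qed

lemma ma_minda_strict_mono:
  assumes mm: "ma_minda \<phi>" and xy: "-1 < x" "x < y" "y < 1"
  shows "Re (\<phi> (of_real x)) < Re (\<phi> (of_real y))"
proof -
  have reg: "deriv \<phi> (of_real t) \<noteq> 0" if "\<bar>t\<bar> < 1" for t
    using holomorphic_injective_imp_regular[OF ma_mindaD(1)[OF mm] open_ball ma_mindaD(2)[OF mm]] that by simp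
  have der: "((\<lambda>t. \<phi> (of_real t)) has_vector_derivative deriv \<phi> (of_real t)) (at t)" if "\<bar>t\<bar> < 1" for t
    using holomorphic_derivI[OF ma_mindaD(1)[OF mm] open_ball, of "of_real t"] that
    by (intro has_vector_derivative_real_field) auto
  have derR: "((\<lambda>t. Re (\<phi> (of_real t))) has_real_derivative Re (deriv \<phi> (of_real t))) (at t)" if "\<bar>t\<bar> < 1" for t
    using bounded_linear.has_vector_derivative[OF bounded_linear_Re der[OF that]] by (simp add: has_real_derivative_iff_has_vector_derivative)
  have real: "Im (deriv \<phi> (of_real t)) = 0" if t: "\<bar>t\<bar> < 1" for t
  proof -
    have "((\<lambda>t. Im (\<phi> (of_real t))) has_real_derivative Im (deriv \<phi> (of_real t))) (at t)"
      using bounded_linear.has_vector_derivative[OF bounded_linear_Im der[OF that]] by (simp add: has_real_derivative_iff_has_vector_derivative)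
    moreover have "((\<lambda>t. Im (\<phi> (of_real t))) has_real_derivative 0) (at t)"
      by (rule has_field_derivative_transform_within_open[of "\<lambda>_. 0" _ _ "{-1<..<1}"])
        (use t ma_minda_Im_of_real[OF mm] in auto)
    ultimately show ?thesis by (rule DERIV_unique)
  qed
  have cont: "continuous_on {-1<..<1} (\<lambda>t. Re (deriv \<phi> (of_real t)))"
    by (intro continuous_on_Re continuous_on_compose2[OF holomorphic_on_imp_continuous_on[OF holomorphic_deriv[OF ma_mindaD(1)[OF mm] open_ball]]])
      (auto intro!: continuous_intros)
  \<comment> \<open>\<open>\<phi>'\<close> is real and nonzero on the real interval and positive at \<open>0\<close>\<close>
  have pos: "0 < Re (deriv \<phi> (of_real t))" if t: "\<bar>t\<bar> < 1" for t
  proof (rule ccontr)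
    assume neg: "\<not> ?thesis"
    have "connected ((\<lambda>t. Re (deriv \<phi> (of_real t))) ` {-1<..<1})"
      by (rule connected_continuous_image[OF cont]) auto
    moreover have "Re (deriv \<phi> (of_real t)) \<in> (\<lambda>t. Re (deriv \<phi> (of_real t))) ` {-1<..<1}"
      by (rule imageI) (use t in auto)
    moreover have "Re (deriv \<phi> (of_real 0)) \<in> (\<lambda>t. Re (deriv \<phi> (of_real t))) ` {-1<..<1}"
      by (rule imageI) auto
    ultimately have "0 \<in> (\<lambda>t. Re (deriv \<phi> (of_real t))) ` {-1<..<1}"
      by (rule connectedD_interval) (use neg ma_mindaD(6)[OF mm] in auto)
    then obtain t' where t': "0 = Re (deriv \<phi> (of_real t'))" "t' \<in> {-1<..<1}" by (rule imageE)
    hence "\<bar>t'\<bar> < 1" by auto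
    thus False using reg[of t'] real[of t'] t'(1) by (auto simp: complex_eq_iff)
  qed
  show ?thesis
  proof (rule DERIV_pos_imp_increasing[OF xy(2)])
    fix t assume "x \<le> t" "t \<le> y"
    hence "\<bar>t\<bar> < 1" using xy by auto
    with derR pos show "\<exists>d. ((\<lambda>t. Re (\<phi> (of_real t))) has_real_derivative d) (at t) \<and> 0 < d" by blast
  qed
qed

section \<open>The logarithm of the derivative of K\<close>

lemma linepath_integral_has_derivative:
  assumes hol: "F holomorphic_on unit_disc" and z: "norm z < 1"
  shows "((\<lambda>z. contour_integral (linepath 0 z) F) has_field_derivative F z) (at z)"
proof -
  obtain G where G: "\<And>x. x \<in> unit_disc \<Longrightarrow> (G has_field_derivative F x) (at x within unit_disc)"
    using holomorphic_convex_primitive'[OF convex_ball open_ball hol] by metis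
  have eq: "contour_integral (linepath 0 x) F = G x - G 0" if "x \<in> unit_disc" for x
  proof -
    have "closed_segment 0 x \<subseteq> unit_disc" using that by (intro closed_segment_subset) auto
    hence "(F has_contour_integral (G (pathfinish (linepath 0 x)) - G (pathstart (linepath 0 x)))) (linepath 0 x)"
      by (intro contour_integral_primitive[OF G]) auto
    thus ?thesis by (simp add: contour_integral_unique)
  qed
  have "((\<lambda>x. G x - G 0) has_field_derivative F z) (at z)"
    using G[of z] z by (auto intro!: derivative_eq_intros simp: at_within_open[OF _ open_ball])
  thus ?thesis
    by (rule has_field_derivative_transform_within_open[where S = unit_disc]) (use z eq in auto)
qed

text \<open>\<open>(\<phi>(z) - 1) / z\<close> with its removable singularity filled in.\<close>

definition ma_quot :: "(complex \<Rightarrow> complex) \<Rightarrow> complex \<Rightarrow> complex" where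
  "ma_quot \<phi> z = (if z = 0 then deriv \<phi> 0 else (\<phi> z - 1) / z)"

text \<open>\<open>log K'\<close>, the inner integral of \<open>K_fun\<close>. Its integrand agrees with \<open>ma_quot \<phi>\<close> except at
  \<open>0\<close>, so it is a primitive of \<open>ma_quot \<phi>\<close>.\<close>

definition log_dK :: "(complex \<Rightarrow> complex) \<Rightarrow> complex \<Rightarrow> complex" where
  "log_dK \<phi> z = contour_integral (linepath 0 z) (\<lambda>t. (\<phi> t - 1) / t)"

lemma ma_quot_mult:
  assumes "ma_minda \<phi>"
  shows "z * ma_quot \<phi> z = \<phi> z - 1"
  using ma_mindaD(3)[OF assms] by (simp add: ma_quot_def)

lemma ma_quot_holomorphic:
  assumes "ma_minda \<phi>"
  shows "ma_quot \<phi> holomorphic_on unit_disc"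
proof -
  have "(\<lambda>z. if z = 0 then deriv \<phi> 0 else (\<phi> z - \<phi> 0) / (z - 0)) holomorphic_on unit_disc"
    by (rule pole_lemma[OF ma_mindaD(1)[OF assms]]) simp
  moreover have "ma_quot \<phi> = (\<lambda>z. if z = 0 then deriv \<phi> 0 else (\<phi> z - \<phi> 0) / (z - 0))"
    by (rule ext) (simp add: ma_quot_def ma_mindaD(3)[OF assms])
  ultimately show ?thesis by simp
qed

lemma ma_quot_nonzero:
  assumes mm: "ma_minda \<phi>" and z: "norm z < 1"
  shows "ma_quot \<phi> z \<noteq> 0"
proof (cases "z = 0")
  case True
  thus ?thesis using ma_mindaD(6)[OF mm] by (auto simp: ma_quot_def)
next
  case False
  hence "\<phi> z \<noteq> \<phi> 0" using inj_onD[OF ma_mindaD(2)[OF mm], of z 0] z by auto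
  thus ?thesis using False ma_mindaD(3)[OF mm] by (simp add: ma_quot_def)
qed

lemma log_dK_0 [simp]: "log_dK \<phi> 0 = 0"
  by (simp add: log_dK_def)

lemma log_dK_has_derivative:
  assumes mm: "ma_minda \<phi>" and z: "norm z < 1"
  shows "(log_dK \<phi> has_field_derivative ma_quot \<phi> z) (at z)"
proof -
  have "contour_integral (linepath 0 x) (ma_quot \<phi>) = log_dK \<phi> x" for x
  proof (cases "x = 0")
    case False
    show ?thesis unfolding log_dK_def
      by (rule contour_integral_spike_finite_simple_path[of "{0}"])
        (use False in \<open>auto simp: ma_quot_def intro: simple_path_linepath\<close>)
  qed simp
  thus ?thesis using linepath_integral_has_derivative[OF ma_quot_holomorphic[OF mm] z] by simp
qed

lemma log_dK_holomorphic:
  assumes mm: "ma_minda \<phi>"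
  shows "log_dK \<phi> holomorphic_on unit_disc"
  unfolding holomorphic_on_open[OF open_ball]
  by (rule ballI, rule exI, rule log_dK_has_derivative[OF mm]) simp

lemma K_fun_has_derivative:
  assumes mm: "ma_minda \<phi>" and z: "norm z < 1"
  shows "(K_fun \<phi> has_field_derivative exp (log_dK \<phi> z)) (at z)"
proof -
  have "(\<lambda>s. exp (log_dK \<phi> s)) holomorphic_on unit_disc"
    by (intro holomorphic_intros log_dK_holomorphic[OF mm])
  moreover have "K_fun \<phi> = (\<lambda>z. contour_integral (linepath 0 z) (\<lambda>s. exp (log_dK \<phi> s)))"
    by (simp add: K_fun_def log_dK_def fun_eq_iff)
  ultimately show ?thesis using linepath_integral_has_derivative[OF _ z] by simp
qed

lemma K_fun_0 [simp]: "K_fun \<phi> 0 = 0"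
  by (simp add: K_fun_def)

section \<open>Univalence of the logarithm of the derivative of K\<close>

text \<open>The infinitesimal form of \<open>ma_minda_starlike\<close>: differentiate
  \<open>\<bar>\<phi>\<^sup>-\<^sup>1(1 + \<tau> (\<phi> z - 1))\<bar> \<le> \<bar>z\<bar>\<close> at \<open>\<tau> = 1\<close>. With \<open>s = \<phi> - 1\<close> the conclusion reads
  \<open>Re (s / (z * s')) \<ge> 0\<close>.\<close>

lemma ma_minda_starlike_Re:
  assumes mm: "ma_minda \<phi>" and z: "norm z < 1" "z \<noteq> 0"
  shows "0 \<le> Re (ma_quot \<phi> z / deriv \<phi> z)"
proof -
  obtain \<eta> where \<eta>: "\<eta> holomorphic_on (\<phi> ` unit_disc)" "\<And>z. norm z < 1 \<Longrightarrow> \<eta> (\<phi> z) = z"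
    "\<And>z. norm z < 1 \<Longrightarrow> deriv \<phi> z * deriv \<eta> (\<phi> z) = 1"
    using ma_minda_inverse[OF mm] by metis
  have op: "open (\<phi> ` unit_disc)" using mm ma_mindaD(1,2) open_mapping_thm3 by blast
  have zm: "\<phi> z \<in> \<phi> ` unit_disc" using z by simp
  define N where "N = (\<lambda>\<tau>. Re (cnj z * \<eta> (1 + of_real \<tau> * (\<phi> z - 1))))"
  have "(\<eta> has_field_derivative deriv \<eta> (\<phi> z)) (at (1 + of_real 1 * (\<phi> z - 1)))"
    using holomorphic_derivI[OF \<eta>(1) op zm] by simp
  hence "((\<lambda>t. \<eta> (1 + t * (\<phi> z - 1))) has_field_derivative (deriv \<eta> (\<phi> z) * (\<phi> z - 1))) (at (of_real 1))"
    by (rule DERIV_chain2) (auto intro!: derivative_eq_intros)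
  hence "((\<lambda>t. cnj z * \<eta> (1 + t * (\<phi> z - 1))) has_field_derivative (cnj z * (deriv \<eta> (\<phi> z) * (\<phi> z - 1)))) (at (of_real 1))"
    by (rule DERIV_cmult)
  from bounded_linear.has_vector_derivative[OF bounded_linear_Re has_vector_derivative_real_field[OF this]]
  have D: "(N has_real_derivative Re (cnj z * (deriv \<eta> (\<phi> z) * (\<phi> z - 1)))) (at 1)"
    by (simp add: N_def has_real_derivative_iff_has_vector_derivative)
  have le: "N \<tau> \<le> N 1" if \<tau>: "0 \<le> \<tau>" "\<tau> \<le> 1" for \<tau>
  proof -
    obtain u where u: "norm u < 1" "\<phi> u = 1 + of_real \<tau> * (\<phi> z - 1)"
      using ma_minda_starlike_mem[OF mm z(1) \<tau>] by auto
    have "norm u \<le> norm z" by (rule ma_minda_starlike[OF mm u(1) z(1) \<tau>]) (simp add: u(2))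
    have "N \<tau> = Re (cnj z * u)" using \<eta>(2)[OF u(1)] by (simp add: N_def u(2))
    also have "\<dots> \<le> norm (cnj z * u)" by (rule complex_Re_le_cmod)
    also have "\<dots> = norm z * norm u" by (simp add: norm_mult)
    also have "\<dots> \<le> norm z * norm z" using \<open>norm u \<le> norm z\<close> by (intro mult_left_mono) auto
    also have "\<dots> = Re (complex_of_real ((norm z)\<^sup>2))" by (simp only: Re_complex_of_real power2_eq_square)
    also have "\<dots> = Re (cnj z * z)" by (simp only: complex_norm_square mult.commute)
    also have "\<dots> = N 1" using \<eta>(2)[OF z(1)] by (simp add: N_def)
    finally show ?thesis .
  qed
  have nonneg: "0 \<le> Re (cnj z * (deriv \<eta> (\<phi> z) * (\<phi> z - 1)))"
  proof (rule ccontr)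
    assume "\<not> ?thesis"
    hence "Re (cnj z * (deriv \<eta> (\<phi> z) * (\<phi> z - 1))) < 0" by simp
    from DERIV_neg_dec_left[OF D this] obtain d where "d > 0" and d: "\<And>h. 0 < h \<Longrightarrow> h < d \<Longrightarrow> N 1 < N (1 - h)"
      by blast
    define h where "h = min (d / 2) 1"
    have "0 < h" "h < d" "h \<le> 1" using \<open>d > 0\<close> by (auto simp: h_def)
    thus False using d[of h] le[of "1 - h"] by auto
  qed
  have nz: "deriv \<phi> z \<noteq> 0" using \<eta>(3)[OF z(1)] by auto
  have "deriv \<eta> (\<phi> z) = 1 / deriv \<phi> z"
    using \<eta>(3)[OF z(1)] nz by (simp add: eq_divide_eq mult.commute)
  hence "cnj z * (deriv \<eta> (\<phi> z) * (\<phi> z - 1)) = (z * cnj z) * (ma_quot \<phi> z / deriv \<phi> z)"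
    by (simp add: ma_quot_mult[OF mm, symmetric] field_simps)
  also have "\<dots> = of_real ((norm z)\<^sup>2) * (ma_quot \<phi> z / deriv \<phi> z)"
    by (simp only: complex_norm_square)
  finally have e: "cnj z * (deriv \<eta> (\<phi> z) * (\<phi> z - 1)) = of_real ((norm z)\<^sup>2) * (ma_quot \<phi> z / deriv \<phi> z)" .
  have "Re (cnj z * (deriv \<eta> (\<phi> z) * (\<phi> z - 1))) = (norm z)\<^sup>2 * Re (ma_quot \<phi> z / deriv \<phi> z)"
    unfolding e by (simp only: times_complex.simps(1) Re_complex_of_real Im_complex_of_real mult_zero_left diff_zero)
  with nonneg show ?thesis using z(2) by (simp add: zero_le_mult_iff)
qed

text \<open>Libera's argument. With \<open>s = \<phi> - 1\<close> and \<open>Q = log_dK \<phi>\<close>, the quotient \<open>\<psi> = Q / s\<close> satisfies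
  \<open>\<psi> = p * (1 - z * \<psi>')\<close> where \<open>p = s / (z * s')\<close> has non-negative real part. At a minimum of
  \<open>Re \<psi>\<close> over a disc, \<open>z * \<psi>'\<close> is real and not positive, so the minimum is not negative. As
  \<open>z * Q' = s\<close>, this means that \<open>Q\<close> is starlike.\<close>

lemma log_dK_quot_Re_pos:
  assumes mm: "ma_minda \<phi>"
  obtains q where "q holomorphic_on unit_disc" "\<And>z. norm z < 1 \<Longrightarrow> log_dK \<phi> z = z * q z"
    "\<And>z. norm z < 1 \<Longrightarrow> 0 < Re (q z / ma_quot \<phi> z)"
proof -
  obtain q where q: "q holomorphic_on unit_disc" "\<And>z. norm z < 1 \<Longrightarrow> log_dK \<phi> z = z * q z"
    "deriv (log_dK \<phi>) 0 = q 0"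
    using Schwarz3[OF log_dK_holomorphic[OF mm]] by auto
  define \<psi> where "\<psi> z = q z / ma_quot \<phi> z" for z
  have hol: "\<psi> holomorphic_on unit_disc" unfolding \<psi>_def
    by (intro holomorphic_intros q(1) ma_quot_holomorphic[OF mm]) (use ma_quot_nonzero[OF mm] in auto)
  have "q 0 = ma_quot \<phi> 0" using DERIV_imp_deriv[OF log_dK_has_derivative[OF mm, of 0]] q(3) by simp
  hence \<psi>0: "\<psi> 0 = 1" using ma_quot_nonzero[OF mm, of 0] by (simp add: \<psi>_def)
  have eq: "\<psi> z = ma_quot \<phi> z / deriv \<phi> z * (1 - deriv \<psi> z * z)" if z: "norm z < 1" for z
  proof -
    have "((\<lambda>z. (\<phi> z - 1) * \<psi> z) has_field_derivative (deriv \<phi> z * \<psi> z + (\<phi> z - 1) * deriv \<psi> z)) (at z)"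
      using z holomorphic_derivI[OF ma_mindaD(1)[OF mm] open_ball, of z] holomorphic_derivI[OF hol open_ball, of z]
      by (auto intro!: derivative_eq_intros)
    moreover have "((\<lambda>z. (\<phi> z - 1) * \<psi> z) has_field_derivative ma_quot \<phi> z) (at z)"
    proof (rule has_field_derivative_transform_within_open[OF log_dK_has_derivative[OF mm z], of unit_disc])
      fix x :: complex assume "x \<in> unit_disc"
      thus "log_dK \<phi> x = (\<phi> x - 1) * \<psi> x"
        using q(2)[of x] ma_quot_nonzero[OF mm, of x] 
        by (simp add: \<psi>_def flip: ma_quot_mult[OF mm])
    qed (use z in auto)
    ultimately have "ma_quot \<phi> z = deriv \<phi> z * \<psi> z + (\<phi> z - 1) * deriv \<psi> z" by (metis DERIV_unique)
    moreover have "deriv \<phi> z \<noteq> 0"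
      using holomorphic_injective_imp_regular[OF ma_mindaD(1)[OF mm] open_ball ma_mindaD(2)[OF mm]] z by simp
    ultimately show ?thesis by (simp add: field_simps flip: ma_quot_mult[OF mm])
  qed
  have nonneg: "0 \<le> Re (\<psi> z)" if z: "norm z < 1" for z
  proof -
    have "continuous_on (cball 0 (norm z)) (\<lambda>x. Re (\<psi> x))"
      by (intro continuous_on_Re holomorphic_on_imp_continuous_on holomorphic_on_subset[OF hol]) (use z in auto)
    then obtain z0 where z0: "norm z0 \<le> norm z" "\<And>x. norm x \<le> norm z \<Longrightarrow> Re (\<psi> z0) \<le> Re (\<psi> x)"
      using continuous_attains_inf[of "cball 0 (norm z)" "\<lambda>x. Re (\<psi> x)"] by auto
    have "0 \<le> Re (\<psi> z0)"
    proof (cases "z0 = 0")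
      case False
      have z01: "norm z0 < 1" using z0 z by simp
      have "(\<psi> has_field_derivative deriv \<psi> z0) (at z0)"
        using holomorphic_derivI[OF hol open_ball, of z0] z01 by simp
      hence "((\<lambda>x. Re (\<psi> x)) has_derivative (\<lambda>v. Re (deriv \<psi> z0 * v))) (at z0)"
        unfolding has_field_derivative_def by (rule bounded_linear.has_derivative[OF bounded_linear_Re])
      from extremal_point_on_disc[OF False this] z0
      have c: "Im (deriv \<psi> z0 * z0) = 0" "Re (deriv \<psi> z0 * z0) \<le> 0" by (meson order_trans)+
      have "Re (\<psi> z0) = Re (ma_quot \<phi> z0 / deriv \<phi> z0 * (1 - deriv \<psi> z0 * z0))"
        using eq[OF z01] by simp
      also have "\<dots> = Re (ma_quot \<phi> z0 / deriv \<phi> z0) * (1 - Re (deriv \<psi> z0 * z0))"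
        using c(1) by (simp only: times_complex.simps(1)) simp
      also have "\<dots> \<ge> 0" using ma_minda_starlike_Re[OF mm z01 False] c(2) by (intro mult_nonneg_nonneg) auto
      finally show ?thesis .
    qed (use \<psi>0 in simp)
    thus ?thesis using z0(2)[of z] by simp
  qed
  have "0 < Re (\<psi> z)" if "norm z < 1" for z
    by (rule Re_pos_of_nonneg[OF hol open_ball connected_ball, of 0]) (use nonneg \<psi>0 that in auto)
  thus ?thesis using that q(1,2) unfolding \<psi>_def by blast
qed

lemma Re_inverse_pos: "0 < Re x \<Longrightarrow> 0 < Re (inverse x)"
  by (simp add: divide_pos_pos add_pos_nonneg)

text \<open>In the logarithmic coordinate \<open>z = exp x\<close>, which runs through the left half-plane, \<open>log (Q z)\<close>
  becomes \<open>U x = x + log (Q z / z)\<close>. Its derivative \<open>z * Q' / Q\<close> has positive real part, so \<open>U\<close> is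
  injective on the (convex) half-plane; \<open>2 * pi * \<i>\<close>-equivariance of \<open>U\<close> makes \<open>Q\<close> injective on the
  disc.\<close>

lemma log_dK_inj:
  assumes mm: "ma_minda \<phi>"
  shows "inj_on (log_dK \<phi>) unit_disc"
proof -
  obtain q where q: "q holomorphic_on unit_disc" "\<And>z. norm z < 1 \<Longrightarrow> log_dK \<phi> z = z * q z"
    and pos: "\<And>z. norm z < 1 \<Longrightarrow> 0 < Re (q z / ma_quot \<phi> z)"
    using log_dK_quot_Re_pos[OF mm] by blast
  have qnz: "q z \<noteq> 0" if "norm z < 1" for z using pos[OF that] by auto
  obtain G where G: "G holomorphic_on unit_disc" "\<And>z. z \<in> unit_disc \<Longrightarrow> q z = exp (G z)"
    using contractible_imp_holomorphic_log[OF q(1) convex_imp_contractible[OF convex_ball]] qnz by auto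
  define U where "U x = x + G (exp x)" for x
  define H where "H = {x. Re x < 0}"
  have "inj_on U H"
  proof (rule inj_on_convex_Re_deriv_pos)
    show "convex H" unfolding H_def using convex_halfspace_Re_lt by blast
    fix x assume "x \<in> H"
    hence x: "norm (exp x) < 1" by (simp add: H_def)
    define z where "z = exp x"
    have "(G has_field_derivative deriv G z) (at z)"
      using holomorphic_derivI[OF G(1) open_ball, of z] x by (simp add: z_def)
    thus "(U has_field_derivative (1 + deriv G (exp x) * exp x)) (at x)"
      unfolding U_def z_def by (auto intro!: derivative_eq_intros DERIV_chain2[of G])
    have Gd: "(G has_field_derivative deriv G z) (at z)" by fact
    have "((\<lambda>z. z * exp (G z)) has_field_derivative (exp (G z) + z * (exp (G z) * deriv G z))) (at z)"
      using Gd by (auto intro!: derivative_eq_intros)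
    moreover have "((\<lambda>z. z * exp (G z)) has_field_derivative ma_quot \<phi> z) (at z)"
      by (rule has_field_derivative_transform_within_open[OF log_dK_has_derivative[OF mm], of z unit_disc])
        (use x q(2) G(2) in \<open>auto simp: z_def\<close>)
    ultimately have "ma_quot \<phi> z = exp (G z) + z * (exp (G z) * deriv G z)" by (metis DERIV_unique)
    hence "1 + deriv G z * z = ma_quot \<phi> z / q z"
      using G(2)[of z] x by (simp add: z_def field_simps)
    also have "\<dots> = inverse (q z / ma_quot \<phi> z)" by simp
    finally have e: "1 + deriv G (exp x) * exp x = inverse (q z / ma_quot \<phi> z)" by (simp add: z_def)
    show "0 < Re (1 + deriv G (exp x) * exp x)"
      unfolding e by (rule Re_inverse_pos, rule pos) (use x z_def in simp)
  qed
  show ?thesis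
  proof (rule inj_onI)
    fix a b assume ab: "a \<in> unit_disc" "b \<in> unit_disc" "log_dK \<phi> a = log_dK \<phi> b"
    show "a = b"
    proof (cases "a = 0 \<or> b = 0")
      case True
      thus ?thesis using ab q(2)[of a] q(2)[of b] qnz by auto
    next
      case False
      define \<alpha> \<beta> where "\<alpha> = Ln a" and "\<beta> = Ln b"
      have e: "exp \<alpha> = a" "exp \<beta> = b" using False by (auto simp: \<alpha>_def \<beta>_def)
      have "exp (U \<alpha>) = exp (U \<beta>)"
        using ab q(2)[of a] q(2)[of b] G(2)[of a] G(2)[of b] by (simp add: U_def exp_add e)
      then obtain n :: int where n: "U \<alpha> = U \<beta> + of_int (2 * n) * pi * \<i>" by (auto simp: exp_eq)
      define \<gamma> where "\<gamma> = \<beta> + of_int (2 * n) * pi * \<i>"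
      have g: "exp \<gamma> = exp \<beta>" unfolding \<gamma>_def exp_eq by blast
      hence "U \<alpha> = U \<gamma>" using n by (simp add: U_def \<gamma>_def)
      moreover have "\<alpha> \<in> H" "\<gamma> \<in> H"
        using ab False by (auto simp: H_def \<gamma>_def \<alpha>_def \<beta>_def Re_Ln)
      ultimately have "\<alpha> = \<gamma>" using \<open>inj_on U H\<close> by (simp add: inj_on_def)
      thus ?thesis using e g by simp
    qed
  qed
qed

section \<open>Subordination and distortion\<close>

text \<open>The bound \<open>\<bar>\<omega> z\<bar> \<le> \<bar>z\<bar>\<close> for \<open>\<omega> = Q\<^sup>-\<^sup>1 \<circ> P\<close>, as long as \<open>P\<close> maps the closed disc of radius
  \<open>\<bar>z\<bar>\<close> into the image of \<open>Q = log_dK \<phi>\<close>. If \<open>F = \<omega> / z\<close> had a maximum \<open>\<bar>F z0\<bar> > 1\<close> on a circle, then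
  \<open>z0 * \<omega>' z0 = (1 + m) * \<omega> z0\<close> with \<open>m \<ge> 0\<close> (Jack's lemma), hence
  \<open>\<phi> (w z0) - 1 = z0 * P' z0 = (1 + m) * (\<phi> (\<omega> z0) - 1)\<close>, and starlikeness would give
  \<open>\<bar>\<omega> z0\<bar> \<le> \<bar>w z0\<bar> \<le> \<bar>z0\<bar>\<close>.\<close>

lemma subordinate_log_dK_aux:
  assumes mm: "ma_minda \<phi>"
    and P: "P holomorphic_on unit_disc" "P 0 = 0"
    and w: "w holomorphic_on unit_disc" "w 0 = 0" "\<And>z. norm z < 1 \<Longrightarrow> norm (w z) < 1"
    and ode: "\<And>z. norm z < 1 \<Longrightarrow> z * deriv P z = \<phi> (w z) - 1"
    and \<theta>: "\<theta> holomorphic_on (log_dK \<phi> ` unit_disc)" "\<And>z. norm z < 1 \<Longrightarrow> \<theta> (log_dK \<phi> z) = z"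
    and z1: "norm z1 < 1" and sub: "\<And>z. norm z \<le> norm z1 \<Longrightarrow> P z \<in> log_dK \<phi> ` unit_disc"
  shows "norm (\<theta> (P z1)) \<le> norm z1"
proof (rule ccontr)
  assume contra: "\<not> ?thesis"
  define V where "V = log_dK \<phi> ` unit_disc"
  have opV: "open V" unfolding V_def
    by (rule open_mapping_thm3[OF log_dK_holomorphic[OF mm] open_ball log_dK_inj[OF mm]])
  define W where "W = {z \<in> unit_disc. P z \<in> V}"
  have opW: "open W"
    using continuous_open_preimage[OF holomorphic_on_imp_continuous_on[OF P(1)] open_ball opV]
    by (simp add: W_def vimage_def Int_def)
  define \<omega> where "\<omega> = (\<lambda>z. \<theta> (P z))"
  have PW: "P holomorphic_on W" by (rule holomorphic_on_subset[OF P(1)]) (auto simp: W_def)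
  have h\<omega>: "\<omega> holomorphic_on W" unfolding \<omega>_def
    by (rule holomorphic_on_compose_gen[OF PW \<theta>(1), unfolded o_def]) (auto simp: W_def V_def)
  have \<omega>: "norm (\<omega> z) < 1" "log_dK \<phi> (\<omega> z) = P z" if "z \<in> W" for z
    using that \<theta>(2) by (auto simp: W_def V_def \<omega>_def)
  have \<omega>0: "\<omega> 0 = 0" using \<theta>(2)[of 0] P(2) by (simp add: \<omega>_def)
  define t where "t = norm z1"
  have t: "0 < t" "t < 1" using contra z1 \<omega>0 by (auto simp: t_def \<omega>_def)
  have cbW: "cball 0 t \<subseteq> W" using sub t by (auto simp: W_def V_def t_def)
  hence zW: "0 \<in> W" using t by auto
  define F where "F = (\<lambda>z. if z = 0 then deriv \<omega> 0 else \<omega> z / z)"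
  have hF: "F holomorphic_on W"
    unfolding F_def using pole_lemma[OF h\<omega>, of 0] zW opW by (simp only: \<omega>0 interior_open diff_zero simp_thms)
  have \<omega>F: "\<omega> z = z * F z" for z using \<omega>0 by (simp add: F_def)
  have contF: "continuous_on (cball 0 t) F"
    by (rule holomorphic_on_imp_continuous_on[OF holomorphic_on_subset[OF hF cbW]])
  have "\<exists>z0\<in>sphere 0 t. \<forall>z\<in>sphere 0 t. norm (F z) \<le> norm (F z0)"
    by (rule continuous_attains_sup)
      (use t z1 in \<open>auto simp: t_def intro!: continuous_on_norm continuous_on_subset[OF contF[unfolded t_def]]\<close>)
  then obtain z0 where z0: "norm z0 = t" "\<And>z. norm z = t \<Longrightarrow> norm (F z) \<le> norm (F z0)" by auto
  have Fmax: "norm (F z) \<le> norm (F z0)" if "norm z \<le> norm z0" for z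
  proof (rule maximum_modulus_frontier[of F "cball 0 t"])
    show "F holomorphic_on interior (cball 0 t)"
      by (rule holomorphic_on_subset[OF hF]) (use cbW interior_subset in blast)
  qed (use contF z0 that in auto)
  have z0W: "z0 \<in> W" using cbW z0 by auto
  have z0': "z0 \<noteq> 0" "norm z0 < 1" using t z0 by auto
  have "1 < norm (F z1)" using contra t by (simp add: F_def \<omega>_def t_def norm_divide)
  hence F1: "1 < norm (F z0)" using z0(2)[of z1] by (simp add: t_def)
  define F' where "F' = deriv F z0"
  have dF: "(F has_field_derivative F') (at z0)"
    unfolding F'_def by (rule holomorphic_derivI[OF hF opW z0W])
  have "((\<lambda>z. - (F z \<bullet> F z)) has_derivative (\<lambda>v. - (F z0 \<bullet> (F' * v) + (F' * v) \<bullet> F z0))) (at z0)"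
    using dF unfolding has_field_derivative_def by (intro has_derivative_minus has_derivative_inner)
  hence "((\<lambda>z. - (F z \<bullet> F z)) has_derivative (\<lambda>v. Re ((- 2 * cnj (F z0) * F') * v))) (at z0)"
    by (rule has_derivative_eq_rhs) (auto simp: inner_complex_def algebra_simps)
  note ex = extremal_point_on_disc[OF z0'(1) this]
  have "- (F z0 \<bullet> F z0) \<le> - (F z \<bullet> F z)" if "norm z \<le> norm z0" for z
    using Fmax[OF that] by (simp add: norm_le)
  note ex = ex[OF this]
  define m where "m = Re (cnj (F z0) * F' * z0) / (norm (F z0))\<^sup>2"
  have m: "0 \<le> m" using ex(2) by (simp add: m_def divide_nonneg_nonneg mult.assoc)
  have "cnj (F z0) * F' * z0 = of_real (Re (cnj (F z0) * F' * z0))"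
    using ex(1) by (simp add: complex_eq_iff mult.assoc)
  also have "\<dots> = of_real (m * (norm (F z0))\<^sup>2)" using F1 by (simp add: m_def)
  also have "\<dots> = of_real m * F z0 * cnj (F z0)" by (simp only: of_real_mult complex_norm_square mult.assoc)
  finally have "cnj (F z0) * (F' * z0 - of_real m * F z0) = 0" by (simp add: algebra_simps)
  hence Fm: "F' * z0 = of_real m * F z0" using F1 by auto
  have "(\<omega> has_field_derivative (F z0 + z0 * F')) (at z0)"
  proof -
    have "((\<lambda>z. z * F z) has_field_derivative (F z0 + z0 * F')) (at z0)"
      using dF by (auto intro!: derivative_eq_intros)
    moreover have "\<omega> = (\<lambda>z. z * F z)" by (rule ext) (rule \<omega>F)
    ultimately show ?thesis by (simp only:)
  qed
  hence "((\<lambda>z. log_dK \<phi> (\<omega> z)) has_field_derivative (ma_quot \<phi> (\<omega> z0) * (F z0 + z0 * F'))) (at z0)"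
    by (rule DERIV_chain2[where f = "log_dK \<phi>" and g = \<omega>, OF log_dK_has_derivative[OF mm \<omega>(1)[OF z0W]]])
  hence "(P has_field_derivative (ma_quot \<phi> (\<omega> z0) * (F z0 + z0 * F'))) (at z0)"
    by (rule has_field_derivative_transform_within_open[OF _ opW z0W]) (use \<omega>(2) in auto)
  hence "z0 * deriv P z0 = z0 * (ma_quot \<phi> (\<omega> z0) * (F z0 + z0 * F'))"
    by (simp add: DERIV_imp_deriv)
  also have "\<dots> = ma_quot \<phi> (\<omega> z0) * (z0 * F z0 + z0 * (F' * z0))" by (simp add: algebra_simps)
  also have "\<dots> = (1 + of_real m) * (\<omega> z0 * ma_quot \<phi> (\<omega> z0))" unfolding Fm \<omega>F[of z0] by (simp add: algebra_simps)
  also have "\<dots> = (1 + of_real m) * (\<phi> (\<omega> z0) - 1)" by (simp only: ma_quot_mult[OF mm])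
  finally have "\<phi> (w z0) - 1 = (1 + of_real m) * (\<phi> (\<omega> z0) - 1)" using ode[OF z0'(2)] by simp
  moreover have "1 + complex_of_real m \<noteq> 0" using m by (metis add_nonneg_pos of_real_1 of_real_add of_real_eq_0_iff less_irrefl zero_less_one add.commute)
  ultimately have "\<phi> (\<omega> z0) - 1 = of_real (1 / (1 + m)) * (\<phi> (w z0) - 1)" by simp
  from ma_minda_starlike[OF mm \<omega>(1)[OF z0W] w(3)[OF z0'(2)] _ _ this]
  have "norm (\<omega> z0) \<le> norm (w z0)" using m by simp
  also have "\<dots> \<le> norm z0" by (rule Schwarz_Lemma(1)[OF w(1,2) w(3) z0'(2)])
  also have "\<dots> < norm (\<omega> z0)" using F1 z0' by (simp add: \<omega>F norm_mult)
  finally show False by simp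
qed

text \<open>The Ma-Minda subordination \<open>log h' \<prec> log K'\<close>: the image of \<open>P\<close> cannot leave the image of \<open>log_dK \<phi>\<close>,
  because up to the first radius where it would do so it stays in the image of a compact subdisc.\<close>

lemma subordinate_log_dK:
  assumes mm: "ma_minda \<phi>"
    and P: "P holomorphic_on unit_disc" "P 0 = 0"
    and w: "w holomorphic_on unit_disc" "w 0 = 0" "\<And>z. norm z < 1 \<Longrightarrow> norm (w z) < 1"
    and ode: "\<And>z. norm z < 1 \<Longrightarrow> z * deriv P z = \<phi> (w z) - 1"
  obtains \<omega> where "\<omega> holomorphic_on unit_disc" "\<And>z. norm z < 1 \<Longrightarrow> norm (\<omega> z) \<le> norm z"
    "\<And>z. norm z < 1 \<Longrightarrow> P z = log_dK \<phi> (\<omega> z)"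
proof -
  obtain \<theta> where \<theta>: "\<theta> holomorphic_on (log_dK \<phi> ` unit_disc)" "\<And>z. z \<in> unit_disc \<Longrightarrow> \<theta> (log_dK \<phi> z) = z"
    using holomorphic_has_inverse[OF log_dK_holomorphic[OF mm] open_ball log_dK_inj[OF mm]] by metis
  define V where "V = log_dK \<phi> ` unit_disc"
  have opV: "open V" unfolding V_def
    by (rule open_mapping_thm3[OF log_dK_holomorphic[OF mm] open_ball log_dK_inj[OF mm]])
  have bound: "norm (\<theta> (P z)) \<le> norm z" if "norm z < 1" "\<And>x. norm x \<le> norm z \<Longrightarrow> P x \<in> V" for z
    by (rule subordinate_log_dK_aux[OF mm P w ode \<theta>(1)]) (use \<theta>(2) that V_def in auto)
  have mem: "P z \<in> V" if z: "norm z < 1" for z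
  proof (rule ccontr)
    assume "P z \<notin> V"
    \<comment> \<open>take a point of smallest modulus whose value lies outside the image\<close>
    define B where "B = cball 0 (norm z) \<inter> P -` (- V)"
    have cont: "continuous_on (cball 0 (norm z)) P"
      by (rule holomorphic_on_imp_continuous_on[OF holomorphic_on_subset[OF P(1)]]) (use z in auto)
    have "closed B" unfolding B_def using continuous_closed_preimage[OF cont, of "- V"] opV by (simp add: closed_Compl)
    hence "compact B" unfolding B_def using compact_Int_closed[OF compact_cball, of B 0 "norm z"] by (simp add: B_def Int_assoc[symmetric])
    moreover have "B \<noteq> {}" using \<open>P z \<notin> V\<close> by (auto simp: B_def)
    ultimately obtain b where b: "b \<in> B" "\<And>x. x \<in> B \<Longrightarrow> norm b \<le> norm x"
      using continuous_attains_inf[of B norm] continuous_on_norm_id by blast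
    have inV: "P x \<in> V" if "norm x < norm b" for x
      using b(2)[of x] that b(1) by (force simp: B_def)
    have b': "norm b < 1" "b \<noteq> 0" 
      using b(1) z P(2) by (auto simp: B_def V_def intro: rev_image_eqI[of 0])
    have "P ` closure (ball 0 (norm b)) \<subseteq> log_dK \<phi> ` cball 0 (norm b)"
    proof (rule image_closure_subset)
      show "continuous_on (closure (ball 0 (norm b))) P"
        by (rule continuous_on_subset[OF cont]) (use b(1) b' in \<open>auto simp: B_def closure_ball\<close>)
      have "continuous_on (cball 0 (norm b)) (log_dK \<phi>)"
        by (rule holomorphic_on_imp_continuous_on[OF holomorphic_on_subset[OF log_dK_holomorphic[OF mm]]]) (use b' in auto)
      thus "closed (log_dK \<phi> ` cball 0 (norm b))"
        by (intro compact_imp_closed compact_continuous_image) auto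
      show "P ` ball 0 (norm b) \<subseteq> log_dK \<phi> ` cball 0 (norm b)"
      proof (rule image_subsetI)
        fix x :: complex assume "x \<in> ball 0 (norm b)"
        hence x: "norm x < norm b" by simp
        have "norm (\<theta> (P x)) \<le> norm x" by (rule bound) (use x b' inV in auto)
        moreover have "P x = log_dK \<phi> (\<theta> (P x))" using inV[OF x] \<theta>(2) by (auto simp: V_def)
        ultimately show "P x \<in> log_dK \<phi> ` cball 0 (norm b)" using x by (intro image_eqI[of _ _ "\<theta> (P x)"]) auto
      qed
    qed
    hence "P b \<in> log_dK \<phi> ` cball 0 (norm b)" using b' by (auto simp: closure_ball)
    hence "P b \<in> V" using b' by (auto simp: V_def)
    thus False using b(1) by (simp add: B_def)
  qed
  show ?thesis
  proof
    show "(\<lambda>z. \<theta> (P z)) holomorphic_on unit_disc"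
      by (rule holomorphic_on_compose_gen[OF P(1) \<theta>(1), unfolded o_def]) (use mem V_def in auto)
    show "norm (\<theta> (P z)) \<le> norm z" if "norm z < 1" for z
      by (rule bound[OF that]) (use mem that in auto)
    show "P z = log_dK \<phi> (\<theta> (P z))" if "norm z < 1" for z
      using mem[OF that] \<theta>(2) by (auto simp: V_def)
  qed
qed

text \<open>The lower half of the Ma-Minda distortion theorem. It needs no convexity of \<open>log_dK \<phi>\<close>: where
  \<open>Re P z - Re (log_dK \<phi> (-\<bar>z\<bar>)) + \<epsilon> * \<bar>z\<bar>\<close> is minimal over a disc, \<open>z * P' z\<close> is real. Therefore
  \<open>\<phi> (w z)\<close> is real, \<open>w z\<close> is a real number of modulus at most \<open>\<bar>z\<bar>\<close>, and monotonicity of \<open>\<phi>\<close> on the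
  real axis makes the outward derivative positive, which is impossible at a minimum.\<close>

lemma Re_log_dK_lower_bound:
  assumes mm: "ma_minda \<phi>"
    and P: "P holomorphic_on unit_disc" "P 0 = 0"
    and w: "w holomorphic_on unit_disc" "w 0 = 0" "\<And>z. norm z < 1 \<Longrightarrow> norm (w z) < 1"
    and ode: "\<And>z. norm z < 1 \<Longrightarrow> z * deriv P z = \<phi> (w z) - 1"
    and z: "norm z < 1"
  shows "Re (log_dK \<phi> (- of_real (norm z))) \<le> Re (P z)"
proof -
  have main: "0 \<le> Re (P z) - Re (log_dK \<phi> (- of_real (norm z))) + \<epsilon> * norm z" if \<epsilon>: "\<epsilon> > 0" for \<epsilon>
  proof -
    define u where "u = (\<lambda>x. Re (P x) - Re (log_dK \<phi> (- of_real (norm x))) + \<epsilon> * norm x)"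
    have "continuous_on (cball 0 (norm z)) u" unfolding u_def
      by (intro continuous_intros continuous_on_Re holomorphic_on_imp_continuous_on[OF holomorphic_on_subset[OF P(1)]]
        continuous_on_compose2[OF holomorphic_on_imp_continuous_on[OF log_dK_holomorphic[OF mm]]])
       (use z in auto)
    then obtain z0 where z0: "norm z0 \<le> norm z" "\<And>x. norm x \<le> norm z \<Longrightarrow> u z0 \<le> u x"
      using continuous_attains_inf[of "cball 0 (norm z)" u] by auto
    have "0 \<le> u z0"
    proof (cases "z0 = 0")
      case True
      thus ?thesis by (simp add: u_def P(2))
    next
      case False
      define r where "r = norm z0"
      have r: "0 < r" "r < 1" "norm z0 < 1" using z0 z False by (auto simp: r_def)
      define c where "c = deriv P z0 + (of_real \<epsilon> + ma_quot \<phi> (- of_real r)) * (cnj z0 / of_real r)"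
      have Imq: "Im (ma_quot \<phi> (- of_real r)) = 0"
        using ma_minda_Im_of_real[OF mm, of "- r"] r by (simp add: ma_quot_def)
      have "((\<lambda>s. log_dK \<phi> (- of_real s)) has_vector_derivative (- ma_quot \<phi> (- of_real r))) (at r)"
      proof (rule has_vector_derivative_real_field)
        have "(log_dK \<phi> has_field_derivative ma_quot \<phi> (- of_real r)) (at (- of_real r))"
          by (rule log_dK_has_derivative[OF mm]) (use r in auto)
        thus "((\<lambda>s. log_dK \<phi> (- s)) has_field_derivative (- ma_quot \<phi> (- of_real r))) (at (of_real r))"
          by (rule DERIV_chain2[THEN DERIV_cong]) (auto intro!: derivative_eq_intros)
      qed
      from bounded_linear.has_vector_derivative[OF bounded_linear_Re this]
      have D1: "((\<lambda>s. Re (log_dK \<phi> (- of_real s))) has_derivative (\<lambda>s. s * - Re (ma_quot \<phi> (- of_real r)))) (at (norm z0))"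
        by (simp add: has_vector_derivative_def r_def)
      have D2: "(norm has_derivative (\<lambda>v. v \<bullet> sgn z0)) (at z0)" by (rule has_derivative_norm[OF False])
      have D3: "((\<lambda>x. Re (log_dK \<phi> (- of_real (norm x)))) has_derivative (\<lambda>v. (v \<bullet> sgn z0) * - Re (ma_quot \<phi> (- of_real r)))) (at z0)"
        using has_derivative_compose[OF D2 D1] .
      have "(P has_field_derivative deriv P z0) (at z0)"
        using holomorphic_derivI[OF P(1) open_ball, of z0] r by simp
      hence D4: "((\<lambda>x. Re (P x)) has_derivative (\<lambda>v. Re (deriv P z0 * v))) (at z0)"
        unfolding has_field_derivative_def by (rule bounded_linear.has_derivative[OF bounded_linear_Re])
      have inner: "v \<bullet> sgn z0 = Re ((cnj z0 / of_real r) * v)" for v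
        by (simp add: sgn_eq r_def inner_complex_def algebra_simps divide_simps)
      have "(u has_derivative (\<lambda>v. Re (deriv P z0 * v) - (v \<bullet> sgn z0) * - Re (ma_quot \<phi> (- of_real r)) + \<epsilon> * (v \<bullet> sgn z0))) (at z0)"
        unfolding u_def by (intro has_derivative_add has_derivative_diff D3 D4 has_derivative_mult_right D2)
      hence "(u has_derivative (\<lambda>v. Re (c * v))) (at z0)"
      proof (rule has_derivative_eq_rhs, intro ext)
        fix v
        have "Re (c * v) = Re (deriv P z0 * v) + Re ((of_real \<epsilon> + ma_quot \<phi> (- of_real r)) * ((cnj z0 / of_real r) * v))"
          unfolding c_def by (simp only: distrib_right plus_complex.simps mult.assoc)
        also have "Re ((of_real \<epsilon> + ma_quot \<phi> (- of_real r)) * ((cnj z0 / of_real r) * v)) 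
           = (\<epsilon> + Re (ma_quot \<phi> (- of_real r))) * Re ((cnj z0 / of_real r) * v)"
          using Imq by (simp only: times_complex.simps(1)[of "of_real \<epsilon> + ma_quot \<phi> (- of_real r)"]) simp
        finally have "Re (c * v) = Re (deriv P z0 * v) + (\<epsilon> + Re (ma_quot \<phi> (- of_real r))) * (v \<bullet> sgn z0)"
          by (simp only: inner)
        thus "Re (deriv P z0 * v) - (v \<bullet> sgn z0) * - Re (ma_quot \<phi> (- of_real r)) + \<epsilon> * (v \<bullet> sgn z0) = Re (c * v)"
          by algebra
      qed
      note ex = extremal_point_on_disc[OF False this]
      have min: "u z0 \<le> u x" if "norm x \<le> norm z0" for x using z0 that by simp
      note ex = ex[OF min]
      have "cnj z0 * z0 = of_real (r\<^sup>2)" unfolding r_def by (simp only: complex_norm_square mult.commute)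
      hence e: "(cnj z0 / of_real r) * z0 = of_real r" using r by (simp add: power2_eq_square)
      have "c * z0 = deriv P z0 * z0 + (of_real \<epsilon> + ma_quot \<phi> (- of_real r)) * ((cnj z0 / of_real r) * z0)"
        unfolding c_def by (simp only: distrib_right mult.assoc)
      also have "\<dots> = z0 * deriv P z0 + (of_real \<epsilon> + ma_quot \<phi> (- of_real r)) * of_real r"
        by (simp only: e mult.commute[of "deriv P z0"])
      also have "\<dots> = \<phi> (w z0) - 1 + of_real (\<epsilon> * r) - (\<phi> (- of_real r) - 1)"
        unfolding ode[OF r(3)] ma_quot_mult[OF mm, of "- of_real r", symmetric] by (simp add: algebra_simps)
      finally have cz: "c * z0 = \<phi> (w z0) + of_real (\<epsilon> * r) - \<phi> (- of_real r)" by simp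
      have "Im (\<phi> (w z0)) = 0" using ex(1) ma_minda_Im_of_real[OF mm, of "- r"] r unfolding cz by simp
      define x where "x = Re (w z0)"
      have wx: "w z0 = of_real x" unfolding x_def
        by (rule ma_minda_real_preimage[OF mm w(3)[OF r(3)]]) fact
      have "norm (w z0) \<le> r" unfolding r_def by (rule Schwarz_Lemma(1)[OF w(1,2) w(3) r(3)])
      hence "\<bar>x\<bar> \<le> r" by (simp add: wx)
      have "Re (\<phi> (of_real (- r))) \<le> Re (\<phi> (of_real x))"
      proof (cases "x = - r")
        case False
        hence "- r < x" "x < 1" "- 1 < - r" using \<open>\<bar>x\<bar> \<le> r\<close> r by auto
        thus ?thesis using ma_minda_strict_mono[OF mm, of "- r" x] by simp
      qed simp
      hence "0 < Re (c * z0)" unfolding cz wx using \<epsilon> r by simp (smt (verit) mult_pos_pos)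
      thus ?thesis using ex(2) by simp
    qed
    thus ?thesis using z0(2)[of z] by (simp add: u_def)
  qed
  show ?thesis
  proof (rule field_le_epsilon)
    fix e :: real assume "e > 0"
    have "e * norm z \<le> e" using \<open>e > 0\<close> z by (simp add: mult_left_le)
    thus "Re (log_dK \<phi> (- of_real (norm z))) \<le> Re (P z) + e" using main[OF \<open>e > 0\<close>] by simp
  qed
qed

section \<open>Convex univalent functions\<close>

lemma has_real_derivative_Re_cnj_mult:
  assumes "(\<sigma> has_vector_derivative \<sigma>') (at u)" "(\<tau> has_vector_derivative \<tau>') (at u)"
  shows "((\<lambda>u. Re (cnj (\<sigma> u) * \<tau> u)) has_real_derivative Re (cnj (\<sigma> u) * \<tau>' + cnj \<sigma>' * \<tau> u)) (at u)"
  using bounded_linear.has_vector_derivative[OF bounded_linear_Re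
      has_vector_derivative_mult[OF has_vector_derivative_cnj[OF assms(1)] assms(2)]]
  by (simp only: has_real_derivative_iff_has_vector_derivative)

text \<open>Along a segment contained in the image of \<open>h\<close>, the modulus of the inverse function \<open>q\<close> has no
  interior maximum. At a critical point with \<open>z = q w\<close> one has \<open>cnj z * q' * b = \<i> * y\<close> with
  \<open>y \<noteq> 0\<close>, and half the second derivative of \<open>\<bar>q\<bar>\<^sup>2\<close> equals
  \<open>(y\<^sup>2 / \<bar>z\<bar>\<^sup>2) * Re (1 + z * h'' / h') > 0\<close>.\<close>

lemma convexity_quasiconvex:
  assumes hol: "h holomorphic_on unit_disc"
    and pos: "\<And>z. norm z < 1 \<Longrightarrow> 0 < Re (1 + z * deriv (deriv h) z / deriv h z)"
    and q: "q holomorphic_on (h ` unit_disc)" "\<And>z. norm z < 1 \<Longrightarrow> q (h z) = z"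
    and op: "open (h ` unit_disc)"
    and dq: "\<And>z. norm z < 1 \<Longrightarrow> deriv h z * deriv q (h z) = 1"
    and seg: "closed_segment w1 w2 \<subseteq> h ` unit_disc" and w: "w \<in> closed_segment w1 w2"
  shows "norm (q w) \<le> max (norm (q w1)) (norm (q w2))"
proof -
  define \<Omega> where "\<Omega> = h ` unit_disc"
  define b where "b = w2 - w1"
  define \<sigma> where "\<sigma> = (\<lambda>u::real. q (w1 + of_real u * b))"
  define \<tau> where "\<tau> = (\<lambda>u::real. deriv q (w1 + of_real u * b) * b)"
  define N where "N = (\<lambda>u. Re (cnj (\<sigma> u) * \<sigma> u))"
  define M where "M = (\<lambda>u. Re (cnj (\<sigma> u) * \<tau> u))"
  have N: "N u = (norm (\<sigma> u))\<^sup>2" for u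
    unfolding N_def by (simp only: mult.commute[of "cnj _"] complex_norm_square[symmetric] Re_complex_of_real)
  have pt: "w1 + of_real u * b \<in> \<Omega>" if "0 \<le> u" "u \<le> 1" for u
  proof -
    have "w1 + of_real u * b \<in> closed_segment w1 w2"
      unfolding in_segment b_def using that
      by (intro exI[of _ u]) (auto simp: scaleR_conv_of_real algebra_simps)
    thus ?thesis using seg \<Omega>_def by blast
  qed
  have hdq: "deriv q holomorphic_on \<Omega>" unfolding \<Omega>_def by (rule holomorphic_deriv[OF q(1) op])
  have line: "((\<lambda>t. w1 + t * b) has_field_derivative b) (at x)" for x
    by (auto intro!: derivative_eq_intros)
  have d\<sigma>: "(\<sigma> has_vector_derivative \<tau> u) (at u)" if "0 \<le> u" "u \<le> 1" for u
    unfolding \<sigma>_def \<tau>_def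
    by (rule has_vector_derivative_real_field, rule DERIV_chain2[OF holomorphic_derivI[OF q(1) op] line])
      (use pt[OF that] \<Omega>_def in simp)
  have d\<tau>: "(\<tau> has_vector_derivative (deriv (deriv q) (w1 + of_real u * b) * b * b)) (at u)" if "0 \<le> u" "u \<le> 1" for u
    unfolding \<tau>_def
    by (rule has_vector_derivative_real_field, rule DERIV_cmult_right,
        rule DERIV_chain2[OF holomorphic_derivI[OF hdq] line])
      (use pt[OF that] op \<Omega>_def in auto)
  have dN: "(N has_real_derivative 2 * M u) (at u)" if "0 \<le> u" "u \<le> 1" for u
    using has_real_derivative_Re_cnj_mult[OF d\<sigma>[OF that] d\<sigma>[OF that]]
    unfolding N_def M_def by (rule DERIV_cong) (simp add: algebra_simps)
  have contN: "continuous_on {0..1} N"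
    by (rule DERIV_continuous_on) (use dN in \<open>auto intro: has_field_derivative_at_within\<close>)
  then obtain u0 where u0: "0 \<le> u0" "u0 \<le> 1" and max: "\<And>u. 0 \<le> u \<Longrightarrow> u \<le> 1 \<Longrightarrow> N u \<le> N u0"
    using continuous_attains_sup[OF _ _ contN] by auto
  have "N u0 \<le> max (N 0) (N 1)"
  proof (rule ccontr)
    assume neg: "\<not> ?thesis"
    hence u01: "0 < u0" "u0 < 1" using u0 by (metis less_eq_real_def max.cobounded1 max.cobounded2)+
    define z where "z = \<sigma> u0"
    obtain x where x: "norm x < 1" "w1 + of_real u0 * b = h x"
      using pt[OF u0] by (auto simp: \<Omega>_def)
    have z: "norm z < 1" "w1 + of_real u0 * b = h z" using q(2)[OF x(1)] x by (simp_all add: z_def \<sigma>_def)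
    have z0: "z \<noteq> 0"
    proof
      assume "z = 0"
      hence "N u0 = 0" by (simp add: N z_def)
      moreover have "0 \<le> N 0" "N 0 \<le> max (N 0) (N 1)" by (simp_all add: N)
      ultimately show False using neg by linarith
    qed
    have b0: "b \<noteq> 0" using neg by (auto simp: N \<sigma>_def)
    have "2 * M u0 = 0"
      by (rule DERIV_local_max[OF dN[OF u0], of "min u0 (1 - u0)"]) (use u01 max in auto)
    hence M0: "Re (cnj z * \<tau> u0) = 0" by (simp add: M_def z_def)
    define y where "y = Im (cnj z * \<tau> u0)"
    have h'z: "deriv h z \<noteq> 0" "deriv q (h z) \<noteq> 0" using dq[OF z(1)] by auto
    have \<tau>z: "\<tau> u0 = deriv q (h z) * b" by (simp add: \<tau>_def z(2))
    have "\<tau> u0 \<noteq> 0" using h'z b0 by (simp add: \<tau>z)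
    have cz: "cnj z * \<tau> u0 = \<i> * of_real y" using M0 by (simp add: complex_eq_iff y_def)
    have cz2: "(\<i> * complex_of_real y)\<^sup>2 = - of_real (y\<^sup>2)" by (simp add: power_mult_distrib)
    have y0: "y \<noteq> 0" using cz z0 \<open>\<tau> u0 \<noteq> 0\<close> by auto
    \<comment> \<open>differentiate \<open>h' * (q' \<circ> h) = 1\<close>\<close>
    have q'': "deriv (deriv q) (h z) = - (deriv (deriv h) z / deriv h z) * (deriv q (h z))\<^sup>2"
    proof -
      have d1: "(deriv h has_field_derivative deriv (deriv h) z) (at z)"
        using holomorphic_derivI[OF holomorphic_deriv[OF hol open_ball] open_ball, of z] z by simp
      have d0: "(h has_field_derivative deriv h z) (at z)"
        using holomorphic_derivI[OF hol open_ball, of z] z by simp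
      have "(deriv q has_field_derivative deriv (deriv q) (h z)) (at (h z))"
        using holomorphic_derivI[OF hdq, of "h z"] op z by (simp add: \<Omega>_def)
      hence "((\<lambda>x. deriv q (h x)) has_field_derivative (deriv (deriv q) (h z) * deriv h z)) (at z)"
        by (rule DERIV_chain2[OF _ d0])
      from DERIV_mult[OF d1 this]
      have "((\<lambda>x. deriv h x * deriv q (h x)) has_field_derivative
         (deriv (deriv h) z * deriv q (h z) + deriv (deriv q) (h z) * deriv h z * deriv h z)) (at z)"
        by (rule DERIV_cong) (simp add: algebra_simps)
      moreover have "((\<lambda>x. deriv h x * deriv q (h x)) has_field_derivative 0) (at z)"
        by (rule has_field_derivative_transform_within_open[of "\<lambda>_. 1" _ _ unit_disc]) (use dq z in auto)
      ultimately have e: "deriv (deriv h) z * deriv q (h z) + deriv (deriv q) (h z) * deriv h z * deriv h z = 0"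
        by (rule DERIV_unique)
      have qh: "deriv q (h z) = 1 / deriv h z" using dq[OF z(1)] h'z by (simp add: eq_divide_eq mult.commute)
      show ?thesis using e h'z(1) unfolding qh by (simp add: field_simps power2_eq_square) algebra
    qed
    define X where "X = z * deriv (deriv h) z / deriv h z"
    define n where "n = (norm z)\<^sup>2"
    have n: "n > 0" "cnj z * z = of_real n"
      using z0 by (simp add: n_def) (simp only: n_def complex_norm_square mult.commute)
    have "of_real n * (cnj z * (deriv (deriv q) (h z) * b * b)) = - (cnj z * z * (deriv (deriv h) z / deriv h z)) * (cnj z * \<tau> u0)\<^sup>2 / cnj z * (z * cnj z / (cnj z * z))"
      unfolding q'' \<tau>z n(2)[symmetric] using z0 by (simp add: field_simps power2_eq_square)
    also have "\<dots> = of_real (y\<^sup>2) * X"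
      unfolding cz cz2 X_def using z0 by (simp add: field_simps)
    finally have E1: "of_real n * (cnj z * (deriv (deriv q) (h z) * b * b)) = of_real (y\<^sup>2) * X" .
    have "of_real n * (cnj (\<tau> u0) * \<tau> u0) = cnj (cnj z * \<tau> u0) * (cnj z * \<tau> u0)"
      unfolding n(2)[symmetric] by simp
    also have "\<dots> = of_real (y\<^sup>2)" unfolding cz using cz2 by (simp add: power2_eq_square algebra_simps)
    finally have E2: "of_real n * (cnj (\<tau> u0) * \<tau> u0) = of_real (y\<^sup>2)" .
    define D where "D = Re (cnj z * (deriv (deriv q) (h z) * b * b) + cnj (\<tau> u0) * \<tau> u0)"
    have dM: "(M has_real_derivative D) (at u0)"
      using has_real_derivative_Re_cnj_mult[OF d\<sigma>[OF u0] d\<tau>[OF u0]]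
      unfolding M_def D_def z_def z(2)[unfolded z_def] .
    have "n * D = Re (of_real n * (cnj z * (deriv (deriv q) (h z) * b * b) + cnj (\<tau> u0) * \<tau> u0))"
      unfolding D_def by (simp only: times_complex.simps(1) Re_complex_of_real Im_complex_of_real mult_zero_left diff_zero)
    also have "\<dots> = Re (of_real (y\<^sup>2) * (1 + X))"
      unfolding distrib_left E1 E2 by (simp add: add.commute)
    also have "\<dots> = y\<^sup>2 * Re (1 + X)"
      by (simp only: times_complex.simps(1) Re_complex_of_real Im_complex_of_real mult_zero_left diff_zero)
    also have "\<dots> > 0" using pos[OF z(1)] y0 by (simp add: X_def)
    finally have "D > 0" using n(1) by (simp add: zero_less_mult_iff)
    from DERIV_pos_inc_right[OF dM this] obtain d where d: "d > 0" "\<And>t. 0 < t \<Longrightarrow> t < d \<Longrightarrow> M u0 < M (u0 + t)"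
      by blast
    define e where "e = min (d / 2) (1 - u0)"
    have e: "0 < e" "e < d" "u0 + e \<le> 1" using d(1) u01 by (auto simp: e_def)
    have "N u0 < N (u0 + e)"
    proof (rule DERIV_pos_imp_increasing_open[of u0])
      fix t assume t: "u0 < t" "t < u0 + e"
      hence "0 < 2 * M t" using d(2)[of "t - u0"] e \<open>2 * M u0 = 0\<close> by auto
      moreover have "(N has_real_derivative 2 * M t) (at t)" by (rule dN) (use t e u01 in auto)
      ultimately show "\<exists>y. (N has_real_derivative y) (at t) \<and> 0 < y" by blast
    next
      show "continuous_on {u0..u0 + e} N"
        by (rule continuous_on_subset[OF contN]) (use e u01 in auto)
    qed (use e in auto)
    thus False using max[of "u0 + e"] e u01 by simp
  qed
  moreover obtain u where u: "0 \<le> u" "u \<le> 1" "w = w1 + of_real u * b"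
    using w unfolding in_segment b_def by (auto simp: scaleR_conv_of_real algebra_simps)
  ultimately have "N u \<le> max (N 0) (N 1)" using max[OF u(1,2)] by linarith
  hence "(norm (q w))\<^sup>2 \<le> max ((norm (q w1))\<^sup>2) ((norm (q w2))\<^sup>2)"
    unfolding N \<sigma>_def u(3) by (simp add: b_def)
  hence "(norm (q w))\<^sup>2 \<le> (norm (q w1))\<^sup>2 \<or> (norm (q w))\<^sup>2 \<le> (norm (q w2))\<^sup>2" by linarith
  hence "norm (q w) \<le> norm (q w1) \<or> norm (q w) \<le> norm (q w2)" by (auto intro: power2_le_imp_le)
  thus ?thesis by linarith
qed

text \<open>Shrinking both preimages by the factor \<open>t\<close>, the set of \<open>t\<close> for which the segment between
  \<open>h (t * z1)\<close> and \<open>h (t * z2)\<close> lies in the image is open; it is also closed, since by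
  \<open>convexity_quasiconvex\<close> such segments lie in the image of a fixed compact disc.\<close>

lemma convexity_imp_convex_image:
  assumes hol: "h holomorphic_on unit_disc" and inj: "inj_on h unit_disc"
    and pos: "\<And>z. norm z < 1 \<Longrightarrow> 0 < Re (1 + z * deriv (deriv h) z / deriv h z)"
  shows "convex (h ` unit_disc)"
proof -
  obtain q where q: "q holomorphic_on (h ` unit_disc)" "\<And>z. z \<in> unit_disc \<Longrightarrow> deriv h z * deriv q (h z) = 1"
     "\<And>z. z \<in> unit_disc \<Longrightarrow> q (h z) = z"
    using holomorphic_has_inverse[OF hol open_ball inj] by metis
  have op: "open (h ` unit_disc)" by (rule open_mapping_thm3[OF hol open_ball inj])
  have cont: "continuous_on unit_disc h" by (rule holomorphic_on_imp_continuous_on[OF hol])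
  have "closed_segment (h z1) (h z2) \<subseteq> h ` unit_disc" if z: "norm z1 < 1" "norm z2 < 1" for z1 z2
  proof -
    define r where "r = max (norm z1) (norm z2)"
    have r: "r < 1" "norm z1 \<le> r" "norm z2 \<le> r" using z by (auto simp: r_def)
    define \<Phi> where "\<Phi> = (\<lambda>p::real \<times> real. (1 - snd p) *\<^sub>R h (of_real (fst p) * z1) + snd p *\<^sub>R h (of_real (fst p) * z2))"
    define I where "I = {0..1::real} \<times> {0..1::real}"
    have nt: "norm (of_real t * z') \<le> r" if "0 \<le> t" "t \<le> 1" "norm z' \<le> r" for t and z' :: complex
    proof -
      have "norm (of_real t * z') = t * norm z'" using that(1) by (simp add: norm_mult)
      also have "\<dots> \<le> norm z'" using that by (simp add: mult_left_le_one_le)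
      finally show ?thesis using that(3) by simp
    qed
    have nt1: "norm (complex_of_real t) * norm z' < 1" if "0 \<le> t" "t \<le> 1" "norm z' \<le> r" for t and z' :: complex
      using nt[OF that] r(1) by (simp add: norm_mult)
    have cont\<Phi>: "continuous_on I \<Phi>" unfolding \<Phi>_def I_def
      by (intro continuous_intros continuous_on_compose2[OF cont])
        (use nt1 r in \<open>auto simp: norm_mult\<close>)
    have seg: "closed_segment (h (of_real t * z1)) (h (of_real t * z2)) = (\<lambda>s. \<Phi> (t, s)) ` {0..1}" for t
      by (auto simp: \<Phi>_def closed_segment_image_interval)
    have cpt: "compact (h ` cball 0 r)"
      by (intro compact_continuous_image continuous_on_subset[OF cont]) (use r in auto)
    \<comment> \<open>\<open>A\<close> and \<open>B\<close> are complementary in \<open>{0..1}\<close>, and both are closed\<close>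
    define A where "A = {t \<in> {0..1}. \<forall>s\<in>{0..1}. \<Phi> (t, s) \<in> h ` cball 0 r}"
    define B where "B = fst ` {p \<in> I. \<Phi> p \<notin> h ` unit_disc}"
    have AB: "t \<in> A \<longleftrightarrow> t \<notin> B" if t: "t \<in> {0..1}" for t
    proof
      assume "t \<in> A"
      moreover have "h ` cball 0 r \<subseteq> h ` unit_disc" using r by (intro image_mono) auto
      ultimately have "\<forall>s\<in>{0..1}. \<Phi> (t, s) \<in> h ` unit_disc" unfolding A_def by blast
      thus "t \<notin> B" unfolding B_def I_def by auto
    next
      assume tB: "t \<notin> B"
      hence mem: "\<Phi> (t, s) \<in> h ` unit_disc" if "s \<in> {0..1}" for s
        using that t by (force simp: B_def I_def)
      have sub: "closed_segment (h (of_real t * z1)) (h (of_real t * z2)) \<subseteq> h ` unit_disc"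
        unfolding seg using mem by auto
      have tz: "norm (of_real t * z1) \<le> r" "norm (of_real t * z2) \<le> r" using nt t r by auto
      have "\<Phi> (t, s) \<in> h ` cball 0 r" if s: "s \<in> {0..1}" for s
      proof -
        have "\<Phi> (t, s) \<in> closed_segment (h (of_real t * z1)) (h (of_real t * z2))" unfolding seg using s by blast
        hence "norm (q (\<Phi> (t, s))) \<le> max (norm (q (h (of_real t * z1)))) (norm (q (h (of_real t * z2))))"
          by (intro convexity_quasiconvex[OF hol pos q(1) _ op _ sub]) (use q in auto)
        hence "norm (q (\<Phi> (t, s))) \<le> r" using tz r q(3) by auto
        moreover have "\<Phi> (t, s) = h (q (\<Phi> (t, s)))" using mem[OF s] q(3) by auto
        ultimately show ?thesis by (intro image_eqI[of _ _ "q (\<Phi> (t, s))"]) auto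
      qed
      thus "t \<in> A" using t by (auto simp: A_def)
    qed
    have "closed A"
    proof -
      have Aeq: "A = {0..1} \<inter> (\<Inter>s\<in>{0..1}. {t \<in> {0..1}. \<Phi> (t, s) \<in> h ` cball 0 r})" by (auto simp: A_def)
      have "closed {t \<in> {0..1}. \<Phi> (t, s) \<in> h ` cball 0 r}" if "s \<in> {0..1}" for s
      proof -
        have "continuous_on {0..1} (\<lambda>t. \<Phi> (t, s))"
          by (intro continuous_on_compose2[OF cont\<Phi>] continuous_intros) (use that in \<open>auto simp: I_def\<close>)
        from continuous_closed_preimage[OF this _ compact_imp_closed[OF cpt]]
        show ?thesis by (simp add: Int_def vimage_def)
      qed
      thus ?thesis unfolding Aeq by (intro closed_Int closed_INT ballI) auto
    qed
    moreover have "closed B"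
    proof -
      have "compact I" unfolding I_def by (intro compact_Times) auto
      have "closed (I \<inter> \<Phi> -` (- h ` unit_disc))"
        by (rule continuous_closed_preimage[OF cont\<Phi>]) (use \<open>compact I\<close> op in \<open>auto simp: compact_imp_closed closed_Compl\<close>)
      hence "compact (I \<inter> (I \<inter> \<Phi> -` (- h ` unit_disc)))" by (rule compact_Int_closed[OF \<open>compact I\<close>])
      moreover have "I \<inter> (I \<inter> \<Phi> -` (- h ` unit_disc)) = {p \<in> I. \<Phi> p \<notin> h ` unit_disc}" by auto
      ultimately have "compact {p \<in> I. \<Phi> p \<notin> h ` unit_disc}" by simp
      thus ?thesis unfolding B_def by (intro compact_imp_closed compact_continuous_image continuous_intros) auto
    qed
    moreover have "0 \<in> A"
    proof -
      have "0 \<le> r" using r(2) norm_ge_zero[of z1] by linarith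
      thus ?thesis by (auto simp: A_def \<Phi>_def simp flip: scaleR_add_left)
    qed
    moreover have "connected {0..1::real}" by simp
    ultimately have "B \<inter> {0..1} = {}"
      unfolding connected_closed using AB by (metis (no_types, lifting) Int_iff UnCI atLeastAtMost_iff disjoint_iff emptyE order_refl subsetI zero_le_one)
    hence "1 \<notin> B" by auto
    hence "\<Phi> (1, s) \<in> h ` unit_disc" if "s \<in> {0..1}" for s using that by (force simp: B_def I_def)
    thus ?thesis using seg[of 1] by auto
  qed
  thus ?thesis unfolding convex_contains_segment by auto
qed

text \<open>By Liouville's theorem, applied to the inverse.\<close>

lemma univalent_image_neq_UNIV:
  assumes hol: "h holomorphic_on unit_disc" and inj: "inj_on h unit_disc"
  shows "h ` unit_disc \<noteq> UNIV"
proof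
  assume U: "h ` unit_disc = UNIV"
  obtain q where q: "q holomorphic_on (h ` unit_disc)" "\<And>z. z \<in> unit_disc \<Longrightarrow> q (h z) = z"
    using holomorphic_has_inverse[OF hol open_ball inj] by metis
  have "range q \<subseteq> unit_disc"
  proof
    fix y assume "y \<in> range q"
    then obtain x where "y = q x" by blast
    moreover obtain z where "z \<in> unit_disc" "x = h z" using U by (metis UNIV_I imageE)
    ultimately show "y \<in> unit_disc" using q(2) by simp
  qed
  hence "bounded (range q)" using bounded_ball bounded_subset by blast
  hence "q constant_on UNIV" using Liouville_theorem q(1) U by simp
  hence "q (h 0) = q (h (1/2))" by (metis UNIV_I constant_on_def)
  moreover have "q (h 0) = 0" "q (h (1/2)) = 1/2" by (rule q(2), simp)+
  ultimately show False by simp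
qed

section \<open>Harmonic maps with convex analytic part\<close>

text \<open>In the coordinate \<open>w = h z\<close> of the convex domain \<open>h ` unit_disc\<close> the co-analytic part has
  derivative of modulus less than \<open>1\<close>, hence is a strict contraction. This makes \<open>h + cnj g\<close> injective.\<close>

lemma harmonic_contraction:
  assumes h: "h holomorphic_on unit_disc" "inj_on h unit_disc"
    and pos: "\<And>z. norm z < 1 \<Longrightarrow> 0 < Re (1 + z * deriv (deriv h) z / deriv h z)"
    and g: "g holomorphic_on unit_disc" 
    and dil: "\<And>z. norm z < 1 \<Longrightarrow> norm (deriv g z) \<le> norm z * norm (deriv h z)"
    and z: "norm z1 < 1" "norm z2 < 1" "z1 \<noteq> z2"
  shows "norm (g z1 - g z2) < norm (h z1 - h z2)"
proof -
  obtain q where q: "q holomorphic_on (h ` unit_disc)" "\<And>z. z \<in> unit_disc \<Longrightarrow> deriv h z * deriv q (h z) = 1"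
     "\<And>z. z \<in> unit_disc \<Longrightarrow> q (h z) = z"
    using holomorphic_has_inverse[OF h(1) open_ball h(2)] by metis
  have op: "open (h ` unit_disc)" by (rule open_mapping_thm3[OF h(1) open_ball h(2)])
  define \<rho> where "\<rho> = max (norm z1) (norm z2)"
  have sub: "closed_segment (h z1) (h z2) \<subseteq> h ` unit_disc"
    by (rule closed_segment_subset) (use z convexity_imp_convex_image[OF h pos] in auto)
  have "norm ((\<lambda>w. g (q w)) (h z1) - (\<lambda>w. g (q w)) (h z2)) \<le> \<rho> * norm (h z1 - h z2)"
  proof (rule field_differentiable_bound[of "closed_segment (h z1) (h z2)"])
    fix w assume w: "w \<in> closed_segment (h z1) (h z2)"
    then obtain x where x: "norm x < 1" "w = h x" using sub by auto
    have qw: "q w = x" using q(3)[of x] x by simp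
    have "(q has_field_derivative deriv q w) (at w)" by (rule holomorphic_derivI[OF q(1) op]) (use w sub in auto)
    moreover have "(g has_field_derivative deriv g (q w)) (at (q w))"
      using holomorphic_derivI[OF g open_ball, of x] x(1) by (simp add: qw)
    ultimately have "((\<lambda>w. g (q w)) has_field_derivative (deriv g (q w) * deriv q w)) (at w)"
      by (intro DERIV_chain2)
    thus "((\<lambda>w. g (q w)) has_field_derivative (deriv g (q w) * deriv q w)) (at w within closed_segment (h z1) (h z2))"
      by (rule has_field_derivative_at_within)
    have "norm (q w) \<le> max (norm (q (h z1))) (norm (q (h z2)))"
      by (rule convexity_quasiconvex[OF h(1) pos q(1) _ op _ sub w]) (use q in auto)
    hence x\<rho>: "norm x \<le> \<rho>" using q(3) z unfolding qw \<rho>_def by simp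
    have "norm (deriv g (q w) * deriv q w) \<le> norm x * norm (deriv h x) * norm (deriv q w)"
      unfolding norm_mult qw by (intro mult_right_mono dil x) auto
    also have "\<dots> = norm x * norm (deriv h x * deriv q (h x))" by (simp add: norm_mult x(2))
    also have "\<dots> = norm x" using q(2)[of x] x(1) by simp
    finally show "norm (deriv g (q w) * deriv q w) \<le> \<rho>" using x\<rho> by simp
  qed auto
  moreover have "(\<lambda>w. g (q w)) (h z1) = g z1" "(\<lambda>w. g (q w)) (h z2) = g z2" using q(3) z by simp_all
  moreover have "h z1 \<noteq> h z2" using inj_onD[OF h(2), of z1 z2] z by auto
  moreover have "\<rho> < 1" using z by (auto simp: \<rho>_def)
  ultimately show ?thesis
    by (smt (verit, best) mult_less_cancel_right2 right_minus_eq zero_less_norm_iff)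
qed

text \<open>Let \<open>p\<close> be a boundary point of the convex domain \<open>h ` unit_disc\<close>. Being a contraction, the
  co-analytic part extends to \<open>p\<close> with a value \<open>l\<close>, and strict contraction on the segment from an
  interior point to \<open>p\<close> shows that \<open>p + cnj l\<close> is not a value of \<open>h + cnj g\<close>.\<close>

lemma harmonic_image_neq_UNIV:
  assumes h: "h holomorphic_on unit_disc" "inj_on h unit_disc" "convex (h ` unit_disc)"
    and contr: "\<And>z1 z2. norm z1 < 1 \<Longrightarrow> norm z2 < 1 \<Longrightarrow> z1 \<noteq> z2 \<Longrightarrow> norm (g z1 - g z2) < norm (h z1 - h z2)"
  shows "(\<lambda>z. h z + cnj (g z)) ` unit_disc \<noteq> UNIV"
proof -
  have contr': "norm (g z1 - g z2) \<le> norm (h z1 - h z2)" if "norm z1 < 1" "norm z2 < 1" for z1 z2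
    using contr[OF that] by (cases "z1 = z2") auto
  define \<Omega> where "\<Omega> = h ` unit_disc"
  have op: "open \<Omega>" unfolding \<Omega>_def by (rule open_mapping_thm3[OF h(1) open_ball h(2)])
  have "frontier \<Omega> \<noteq> {}" unfolding frontier_eq_empty \<Omega>_def
    using univalent_image_neq_UNIV[OF h(1,2)] by auto
  then obtain p where p: "p \<in> closure \<Omega>" "p \<notin> \<Omega>" using op by (auto simp: frontier_def interior_open)
  obtain W where W: "\<And>n::nat. W n \<in> \<Omega>" "W \<longlonglongrightarrow> p" using p(1) unfolding closure_sequential by blast
  have "\<exists>x. norm x < 1 \<and> h x = W n" for n using W(1)[of n] by (auto simp: \<Omega>_def)
  then obtain X where X: "\<And>n. norm (X n) < 1" "\<And>n. h (X n) = W n" by metis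
  have "Cauchy (\<lambda>n. g (X n))"
  proof (rule metric_CauchyI)
    fix e :: real assume "e > 0"
    obtain M where M: "\<And>m n. m \<ge> M \<Longrightarrow> n \<ge> M \<Longrightarrow> dist (W m) (W n) < e"
      using metric_CauchyD[OF LIMSEQ_imp_Cauchy[OF W(2)] \<open>e > 0\<close>] by blast
    have "dist (g (X m)) (g (X n)) < e" if "m \<ge> M" "n \<ge> M" for m n
      using M[OF that] contr'[OF X(1)[of m] X(1)[of n]] by (simp add: X(2) dist_norm)
    thus "\<exists>M. \<forall>m\<ge>M. \<forall>n\<ge>M. dist (g (X m)) (g (X n)) < e" by blast
  qed
  then obtain l where l: "(\<lambda>n. g (X n)) \<longlonglongrightarrow> l" using Cauchy_convergent_iff convergent_def by blast
  have lim: "norm (g x - l) \<le> norm (h x - p)" if "norm x < 1" for x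
  proof (rule LIMSEQ_le)
    show "(\<lambda>n. norm (g x - g (X n))) \<longlonglongrightarrow> norm (g x - l)" by (intro tendsto_intros l)
    show "(\<lambda>n. norm (h x - W n)) \<longlonglongrightarrow> norm (h x - p)" by (intro tendsto_intros W)
    show "\<exists>N. \<forall>n\<ge>N. norm (g x - g (X n)) \<le> norm (h x - W n)" using contr'[OF that X(1)] by (auto simp: X(2))
  qed
  have "p + cnj l \<notin> (\<lambda>z. h z + cnj (g z)) ` unit_disc"
  proof
    assume "p + cnj l \<in> (\<lambda>z. h z + cnj (g z)) ` unit_disc"
    then obtain z where z: "norm z < 1" "p + cnj l = h z + cnj (g z)" by auto
    have "h z - p = cnj (l - g z)" using z(2) by (simp add: algebra_simps)
    hence e: "norm (h z - p) = norm (g z - l)" by (metis complex_mod_cnj norm_minus_commute)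
    have hz: "h z \<in> \<Omega>" "h z \<noteq> p" using z p by (auto simp: \<Omega>_def)
    have "midpoint (h z) p \<in> open_segment (h z) p" using hz(2) by simp
    moreover have "open_segment (h z) p \<subseteq> interior \<Omega>"
      by (rule in_interior_closure_convex_segment) (use h(3) hz op p in \<open>auto simp: \<Omega>_def interior_open\<close>)
    ultimately have "midpoint (h z) p \<in> \<Omega>" using interior_subset by blast
    then obtain m where m: "norm m < 1" "h m = midpoint (h z) p" by (auto simp: \<Omega>_def)
    have "z \<noteq> m" using m(2) hz(2) by (metis midpoint_eq_endpoint(1))
    have "norm (g z - l) \<le> norm (g z - g m) + norm (g m - l)" using norm_triangle_ineq[of "g z - g m" "g m - l"] by simp
    also have "\<dots> < norm (h z - h m) + norm (h m - p)" using contr[OF z(1) m(1) \<open>z \<noteq> m\<close>] lim[OF m(1)] by simp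
    also have "\<dots> = norm (h z - p)"
      unfolding m(2) using dist_midpoint(1,4)[of "h z" p] by (simp add: dist_norm norm_minus_commute)
    finally show False using e by simp
  qed
  thus ?thesis by blast
qed

text \<open>If \<open>\<bar>h'\<bar> - \<bar>g'\<bar> \<ge> l' (\<bar>z\<bar>)\<close>, then pulling back the segment from \<open>0\<close> to a boundary point \<open>p\<close> gives a
  curve \<open>\<gamma>\<close> with \<open>l (\<bar>\<gamma> s\<bar>) \<le> s * \<bar>p\<bar>\<close>. If \<open>\<bar>p\<bar> < l R\<close>, the curve would stay in the disc of radius \<open>R\<close>,
  and its end point would be mapped to a point outside the image.\<close>

lemma harmonic_distance_to_frontier:
  fixes h g :: "complex \<Rightarrow> complex"
  defines "f \<equiv> \<lambda>z. h z + cnj (g z)"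
  assumes h: "h holomorphic_on unit_disc" "h 0 = 0" and g: "g holomorphic_on unit_disc" "g 0 = 0"
    and inj: "inj_on f unit_disc"
    and sense: "\<And>z. norm z < 1 \<Longrightarrow> norm (deriv g z) < norm (deriv h z)"
    and l0: "l 0 = 0" and contl: "continuous_on {0..<1} l"
    and dl: "\<And>r. 0 < r \<Longrightarrow> r < 1 \<Longrightarrow> (l has_real_derivative l' r) (at r)"
    and l'pos: "\<And>r. 0 < r \<Longrightarrow> r < 1 \<Longrightarrow> 0 < l' r"
    and bound: "\<And>z. norm z < 1 \<Longrightarrow> l' (norm z) \<le> norm (deriv h z) - norm (deriv g z)"
    and p: "p \<in> frontier (f ` unit_disc)" and R: "0 \<le> R" "R < 1"
  shows "l R \<le> norm p"
proof (rule ccontr)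
  assume "\<not> ?thesis"
  hence less: "norm p < l R" by simp
  have contf: "continuous_on unit_disc f" unfolding f_def
    by (intro continuous_intros holomorphic_on_imp_continuous_on h g)
  define V where "V = f ` unit_disc"
  have opV: "open V" unfolding V_def by (rule invariance_of_domain[OF contf open_ball inj])
  have pV: "p \<notin> V" using p opV by (auto simp: frontier_def interior_open V_def)
  have f0: "f 0 = 0" by (simp add: f_def h g)
  have V0: "0 \<in> V" unfolding V_def using f0 by (intro image_eqI[of _ _ 0]) auto
  hence p0: "p \<noteq> 0" using pV by auto
  obtain \<psi> where \<psi>: "homeomorphism unit_disc V f \<psi>"
    using invariance_of_domain_homeomorphism[OF open_ball contf _ inj] unfolding V_def by auto
  have \<psi>V: "norm (\<psi> y) < 1" "f (\<psi> y) = y" if "y \<in> V" for y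
    using that \<psi> by (auto simp: homeomorphism_def)
  have cont\<psi>: "continuous_on V \<psi>" using \<psi> by (simp add: homeomorphism_def)
  have \<psi>0: "\<psi> 0 = 0" using \<psi> f0 by (auto simp: homeomorphism_def) (metis dist_self mem_ball zero_less_one)
  have lmono: "l a < l b" if "0 \<le> a" "a < b" "b < 1" for a b
  proof (rule DERIV_pos_imp_increasing_open[OF that(2)])
    fix t assume "a < t" "t < b"
    hence "0 < t" "t < 1" using that by auto
    thus "\<exists>y. (l has_real_derivative y) (at t) \<and> 0 < y" using dl l'pos by blast
  next
    show "continuous_on {a..b} l" by (rule continuous_on_subset[OF contl]) (use that in auto)
  qed
  \<comment> \<open>the first point of the segment from \<open>0\<close> to \<open>p\<close> outside the image\<close>
  define T where "T = {s \<in> {0..1}. of_real s * p \<notin> V}"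
  have "compact T"
  proof -
    have "continuous_on {0..1} (\<lambda>s. of_real s * p)" by (intro continuous_intros)
    from continuous_closed_preimage[OF this _ closed_Compl[OF opV]]
    have "closed ({0..1} \<inter> (\<lambda>s. of_real s * p) -` (- V))" by simp
    moreover have "T = {0..1} \<inter> (\<lambda>s. of_real s * p) -` (- V)" by (auto simp: T_def)
    ultimately have "closed T" by simp
    moreover have "T \<subseteq> {0..1}" by (auto simp: T_def)
    ultimately show ?thesis using compact_Int_closed[of "{0..1::real}" T] by (simp add: Int_absorb1)
  qed
  moreover have "1 \<in> T" using pV by (simp add: T_def)
  ultimately obtain t where t: "t \<in> T" "\<And>s. s \<in> T \<Longrightarrow> t \<le> s"
    using continuous_attains_inf[of T "\<lambda>x. x"] by auto
  have t01: "0 < t" "t \<le> 1" using t(1) V0 by (auto simp: T_def less_eq_real_def)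
  have inV: "of_real s * p \<in> V" if "0 \<le> s" "s < t" for s
    using t(2)[of s] that t01 by (force simp: T_def)
  define \<gamma> where "\<gamma> = (\<lambda>s. \<psi> (of_real s * p))"
  have \<gamma>1: "norm (\<gamma> s) < 1" if "0 \<le> s" "s < t" for s unfolding \<gamma>_def using \<psi>V(1)[OF inV[OF that]] .
  have f\<gamma>: "f (\<gamma> s) = of_real s * p" if "0 \<le> s" "s < t" for s unfolding \<gamma>_def using \<psi>V(2)[OF inV[OF that]] .
  have der: "\<exists>D. ((\<lambda>s. l (norm (\<gamma> s))) has_real_derivative D) (at s) \<and> D \<le> norm p" if s: "0 < s" "s < t" for s
  proof -
    define y where "y = of_real s * p"
    define z where "z = \<gamma> s"
    have yV: "y \<in> V" unfolding y_def using inV s by simp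
    have z1: "norm z < 1" "f z = y" unfolding z_def y_def using \<gamma>1 f\<gamma> s by simp_all
    have z0: "z \<noteq> 0" using z1(2) f0 p0 s by (auto simp: y_def)
    define A where "A = (\<lambda>v. deriv h z * v + cnj (deriv g z * v))"
    have "(h has_derivative (\<lambda>v. deriv h z * v)) (at z)" "(g has_derivative (\<lambda>v. deriv g z * v)) (at z)"
      using holomorphic_derivI[OF h(1) open_ball, of z] holomorphic_derivI[OF g(1) open_ball, of z] z1
      by (auto simp: has_field_derivative_def)
    hence fd: "(f has_derivative A) (at z)" unfolding f_def A_def
      by (intro has_derivative_add has_derivative_cnj)
    have linA: "linear A" using has_derivative_linear[OF fd] .
    have Aexp: "(norm (deriv h z) - norm (deriv g z)) * norm v \<le> norm (A v)" for v
    proof -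
      have "norm (deriv h z * v) - norm (cnj (deriv g z * v)) \<le> norm (A v)"
        unfolding A_def by (rule norm_diff_ineq)
      thus ?thesis by (simp only: complex_mod_cnj norm_mult left_diff_distrib)
    qed
    have "inj A"
    proof (rule linear_injective_0[OF linA, THEN iffD2], intro allI impI)
      fix v assume "A v = 0"
      thus "v = 0" using Aexp[of v] sense[OF z1(1)] by (simp add: mult_le_0_iff)
    qed
    then obtain B where B: "linear B" "B \<circ> A = id" using linear_injective_left_inverse[OF linA] by blast
    have AB: "A (B v) = v" for v using linear_inverse_left[OF linA B(1)] B(2) by (metis comp_apply id_apply)
    have "(\<psi> has_derivative B) (at y)"
    proof (rule has_derivative_inverse_basic[where f = f and T = V])
      show "(f has_derivative A) (at (\<psi> y))" using fd by (simp add: z_def \<gamma>_def y_def)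
      show "bounded_linear B" using B(1) linear_conv_bounded_linear by blast
      show "continuous (at y) \<psi>" using cont\<psi> opV yV continuous_on_eq_continuous_at by blast
    qed (use B opV yV \<psi>V in auto)
    hence \<psi>d: "(\<psi> has_derivative B) (at (of_real s * p))" by (simp add: y_def)
    have lin: "((\<lambda>s. of_real s * p) has_derivative (\<lambda>v. of_real v * p)) (at s)"
      by (auto intro!: derivative_eq_intros)
    have "(\<gamma> has_derivative (\<lambda>v. B (of_real v * p))) (at s)"
      unfolding \<gamma>_def by (rule has_derivative_compose[OF lin \<psi>d])
    moreover have "(norm has_derivative (\<lambda>v. v \<bullet> sgn (\<gamma> s))) (at (\<gamma> s))"
      by (rule has_derivative_norm) (use z0 in \<open>simp add: z_def\<close>)
    ultimately have nd: "((\<lambda>s. norm (\<gamma> s)) has_derivative (\<lambda>v. B (of_real v * p) \<bullet> sgn (\<gamma> s))) (at s)"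
      by (rule has_derivative_compose)
    have "B (of_real v * p) = v *\<^sub>R B p" for v
      using linear_scale[OF B(1), of v p] by (simp add: scaleR_conv_of_real)
    hence "((\<lambda>s. norm (\<gamma> s)) has_real_derivative (B p \<bullet> sgn z)) (at s)"
      using nd unfolding has_field_derivative_def
      by (elim has_derivative_eq_rhs) (simp add: z_def fun_eq_iff)
    moreover have "(l has_real_derivative l' (norm z)) (at (norm (\<gamma> s)))"
      using dl[of "norm z"] z0 z1 by (simp add: z_def)
    ultimately have "((\<lambda>s. l (norm (\<gamma> s))) has_real_derivative (l' (norm z) * (B p \<bullet> sgn z))) (at s)"
      by (intro DERIV_chain2)
    moreover have "l' (norm z) * (B p \<bullet> sgn z) \<le> norm p"
    proof -
      have lp: "0 < l' (norm z)" using l'pos z0 z1 by simp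
      have "B p \<bullet> sgn z \<le> norm (B p) * norm (sgn z)" by (rule norm_cauchy_schwarz)
      hence "B p \<bullet> sgn z \<le> norm (B p)" using z0 by (simp add: norm_sgn)
      hence "l' (norm z) * (B p \<bullet> sgn z) \<le> l' (norm z) * norm (B p)" using lp by (intro mult_left_mono) auto
      also have "\<dots> \<le> (norm (deriv h z) - norm (deriv g z)) * norm (B p)"
        by (intro mult_right_mono bound z1) auto
      also have "\<dots> \<le> norm p" using Aexp[of "B p"] by (simp add: AB)
      finally show ?thesis .
    qed
    ultimately show ?thesis by blast
  qed
  have small: "norm (\<gamma> s) < R" if s: "0 \<le> s" "s < t" for s
  proof -
    have "l (norm (\<gamma> s)) \<le> s * norm p"
    proof (cases "s = 0")
      case True
      thus ?thesis by (simp add: \<gamma>_def \<psi>0 l0)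
    next
      case False
      hence s0: "0 < s" using s by simp
      have "continuous_on {0..s} \<gamma>" unfolding \<gamma>_def
        by (intro continuous_on_compose2[OF cont\<psi>] continuous_intros) (use inV s in auto)
      hence c: "continuous_on {0..s} (\<lambda>s. l (norm (\<gamma> s)))"
        by (intro continuous_on_compose2[OF contl] continuous_intros) (use \<gamma>1 s in auto)
      have "\<exists>D x. 0 < x \<and> x < s \<and> ((\<lambda>s. l (norm (\<gamma> s))) has_real_derivative D) (at x) \<and>
              l (norm (\<gamma> s)) - l (norm (\<gamma> 0)) = (s - 0) * D"
      proof (rule MVT[OF s0 c])
        fix x assume "0 < x" "x < s"
        thus "(\<lambda>s. l (norm (\<gamma> s))) differentiable (at x)"
          using der[of x] s real_differentiable_def by fastforce
      qed
      then obtain D x where x: "0 < x" "x < s" "((\<lambda>s. l (norm (\<gamma> s))) has_real_derivative D) (at x)"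
        "l (norm (\<gamma> s)) - l (norm (\<gamma> 0)) = (s - 0) * D" by blast
      have "D \<le> norm p" using der[of x] x s by (metis DERIV_unique less_trans)
      hence "s * D \<le> s * norm p" using s0 by (intro mult_left_mono) auto
      thus ?thesis using x(4) by (simp add: \<gamma>_def \<psi>0 l0)
    qed
    also have "\<dots> \<le> norm p" using s t01 by (intro mult_left_le_one_le) auto
    also have "\<dots> < l R" by (rule less)
    finally have "l (norm (\<gamma> s)) < l R" .
    thus ?thesis using lmono[of R "norm (\<gamma> s)"] \<gamma>1[OF s] R by (smt (verit, ccfv_SIG))
  qed
  have "(\<lambda>s. of_real s * p) ` closure {0..<t} \<subseteq> f ` cball 0 R"
  proof (rule image_closure_subset)
    show "continuous_on (closure {0..<t}) (\<lambda>s. of_real s * p)" by (intro continuous_intros)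
    have "compact (f ` cball 0 R)"
      by (intro compact_continuous_image continuous_on_subset[OF contf]) (use R in auto)
    thus "closed (f ` cball 0 R)" by (rule compact_imp_closed)
    show "(\<lambda>s. of_real s * p) ` {0..<t} \<subseteq> f ` cball 0 R"
    proof (rule image_subsetI)
      fix s assume "s \<in> {0..<t}"
      thus "of_real s * p \<in> f ` cball 0 R" using f\<gamma>[of s] small[of s] by (intro image_eqI[of _ _ "\<gamma> s"]) auto
    qed
  qed
  moreover have "t \<in> closure {0..<t}" using t01 by (simp add: closure_atLeastLessThan)
  ultimately have "of_real t * p \<in> f ` cball 0 R" by blast
  moreover have "f ` cball 0 R \<subseteq> V" unfolding V_def using R by (intro image_mono) auto
  ultimately show False using t(1) by (auto simp: T_def)
qed

section \<open>Majorant series and Bohr's inequality\<close>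

text \<open>Taylor coefficients at \<open>0\<close>.\<close>

abbreviation taylor :: "(complex \<Rightarrow> complex) \<Rightarrow> nat \<Rightarrow> complex" where
  "taylor F k \<equiv> fps_nth (fps_expansion F 0) k"

lemma taylor_sums:
  assumes "F holomorphic_on unit_disc" "norm z < 1"
  shows "(\<lambda>k. taylor F k * z ^ k) sums F z"
  using holomorphic_power_series[OF assms(1), of z] assms(2) by (simp add: fps_expansion_def)

lemma taylor_unique:
  assumes "\<And>z. norm z < 1 \<Longrightarrow> (\<lambda>k. c k * z ^ k) sums F z"
  shows "taylor F k = c k"
proof -
  have "F has_fps_expansion Abs_fps c"
    by (rule has_fps_expansionI)
      (use assms in \<open>auto simp: eventually_nhds intro!: exI[of _ unit_disc]\<close>)
  thus ?thesis by (simp add: fps_expansion_eqI)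
qed

lemma taylor_0: "F holomorphic_on unit_disc \<Longrightarrow> taylor F 0 = F 0"
  by (simp add: fps_expansion_def)

lemma has_fps_expansion_disc:
  "F holomorphic_on unit_disc \<Longrightarrow> F has_fps_expansion fps_expansion F 0"
  by (rule has_fps_expansion_fps_expansion[OF open_ball]) auto

lemma summable_majorant:
  assumes "F holomorphic_on unit_disc" "\<bar>r\<bar> < 1"
  shows "summable (\<lambda>k. norm (taylor F k) * r ^ k)"
proof -
  obtain s where s: "\<bar>r\<bar> < s" "s < 1" using dense[OF assms(2)] by blast
  have "summable (\<lambda>k. taylor F k * of_real s ^ k)"
    using taylor_sums[OF assms(1), of "of_real s"] s by (auto simp: sums_iff)
  hence "summable (\<lambda>k. norm (taylor F k * of_real \<bar>r\<bar> ^ k))"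
    by (rule powser_insidea) (use s in simp)
  hence "summable (\<lambda>k. norm (norm (taylor F k) * r ^ k))"
    by (simp add: norm_mult norm_power abs_mult power_abs)
  thus ?thesis by (rule summable_norm_cancel)
qed

text \<open>Caratheodory's coefficient bound. On the circle of radius \<open>\<rho>\<close> the integrals of \<open>p / z^k\<close> and of
  \<open>cnj p / z^k\<close> are the \<open>k\<close>-th coefficient and \<open>0\<close>; their sum is the integral of \<open>2 * Re p / z^k\<close>.\<close>

lemma norm_taylor_le_of_Re_nonneg:
  assumes hol: "p holomorphic_on unit_disc" and nonneg: "\<And>z. norm z < 1 \<Longrightarrow> 0 \<le> Re (p z)"
    and k: "0 < k"
  shows "norm (taylor p k) \<le> 2 * Re (p 0)"
proof -
  have main: "norm (taylor p k) * \<rho> ^ k \<le> 2 * Re (p 0)" if \<rho>: "0 < \<rho>" "\<rho> < 1" for \<rho>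
  proof -
    define \<gamma> where "\<gamma> = circlepath 0 \<rho>"
    have \<gamma>: "\<gamma> x = of_real \<rho> * exp (2 * of_real pi * \<i> * of_real x)" for x by (simp add: \<gamma>_def circlepath)
    have n\<gamma>: "norm (\<gamma> x) = \<rho>" for x using \<rho> by (simp add: \<gamma> norm_mult)
    have \<gamma>0: "\<gamma> x \<noteq> 0" for x using n\<gamma>[of x] \<rho> by auto
    define c :: complex where "c = 2 * of_real pi * \<i>"
    have c: "c \<noteq> 0" by (simp add: c_def)
    have d\<gamma>: "vector_derivative \<gamma> (at x within {0..1}) = c * \<gamma> x" if "x \<in> {0..1}" for x
      using that vector_derivative_circlepath01[of x 0 \<rho>] by (simp add: \<gamma>_def circlepath c_def)
    have sub: "cball 0 \<rho> \<subseteq> unit_disc" using \<rho> by auto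
    have contp: "continuous_on (cball 0 \<rho>) p"
      by (rule holomorphic_on_imp_continuous_on[OF holomorphic_on_subset[OF hol sub]])
    have coeff: "((\<lambda>x. p (\<gamma> x) / \<gamma> x ^ j) has_integral taylor p j) {0..1}" for j
    proof -
      have "((\<lambda>u. p u / (u - 0) ^ Suc j) has_contour_integral ((2 * pi * \<i>) / fact j * (deriv ^^ j) p 0)) (circlepath 0 \<rho>)"
        by (rule Cauchy_has_contour_integral_higher_derivative_circlepath[OF contp])
          (use \<rho> in \<open>auto intro: holomorphic_on_subset[OF hol]\<close>)
      hence "((\<lambda>x. p (\<gamma> x) / \<gamma> x ^ Suc j * vector_derivative \<gamma> (at x within {0..1})) has_integral
           c * taylor p j) {0..1}"
        unfolding has_contour_integral_def \<gamma>_def c_def by (simp add: fps_expansion_def field_simps)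
      hence "((\<lambda>x. 1 / c * (p (\<gamma> x) / \<gamma> x ^ Suc j * vector_derivative \<gamma> (at x within {0..1}))) has_integral
           1 / c * (c * taylor p j)) {0..1}"
        by (rule has_integral_mult_right)
      hence "((\<lambda>x. p (\<gamma> x) / \<gamma> x ^ j) has_integral (1 / c * (c * taylor p j))) {0..1}"
        by (rule has_integral_eq[rotated]) (use \<gamma>0 c in \<open>simp add: d\<gamma>\<close>)
      thus ?thesis using c by simp
    qed
    have vanish: "((\<lambda>x. p (\<gamma> x) * \<gamma> x ^ k) has_integral 0) {0..1}"
    proof -
      have "((\<lambda>u. p u * u ^ (k - 1)) has_contour_integral 0) (circlepath 0 \<rho>)"
        by (rule Cauchy_theorem_disc_simple[of _ 0 1])
          (use \<rho> in \<open>auto intro!: holomorphic_intros hol simp: path_image_circlepath\<close>)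
      hence "((\<lambda>x. p (\<gamma> x) * \<gamma> x ^ (k - 1) * vector_derivative \<gamma> (at x within {0..1})) has_integral 0) {0..1}"
        unfolding has_contour_integral_def \<gamma>_def .
      hence "((\<lambda>x. 1 / c * (p (\<gamma> x) * \<gamma> x ^ (k - 1) * vector_derivative \<gamma> (at x within {0..1}))) has_integral
           1 / c * 0) {0..1}"
        by (rule has_integral_mult_right)
      hence "((\<lambda>x. p (\<gamma> x) * \<gamma> x ^ k) has_integral (1 / c * 0)) {0..1}"
        by (rule has_integral_eq[rotated]) (use k c in \<open>cases k; simp add: d\<gamma>\<close>)
      thus ?thesis by simp
    qed
    \<comment> \<open>on the circle, \<open>cnj z = \<rho>\<^sup>2 / z\<close>\<close>
    have cn: "cnj (\<gamma> x) ^ k = of_real (\<rho> ^ (2 * k)) / \<gamma> x ^ k" for x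
    proof -
      have "\<gamma> x * cnj (\<gamma> x) = of_real (\<rho>\<^sup>2)" using complex_norm_square[of "\<gamma> x"] by (simp only: n\<gamma>)
      hence "(\<gamma> x * cnj (\<gamma> x)) ^ k = of_real (\<rho> ^ (2 * k))" by (simp add: power_mult)
      thus ?thesis using \<gamma>0[of x] by (simp add: power_mult_distrib field_simps)
    qed
    have "((\<lambda>x. cnj (p (\<gamma> x) * \<gamma> x ^ k)) has_integral cnj 0) {0..1}"
      using has_integral_linear[OF vanish bounded_linear_cnj] by (simp add: o_def)
    hence "((\<lambda>x. 1 / of_real (\<rho> ^ (2 * k)) * cnj (p (\<gamma> x) * \<gamma> x ^ k)) has_integral 1 / of_real (\<rho> ^ (2 * k)) * cnj 0) {0..1}"
      by (rule has_integral_mult_right)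
    hence "((\<lambda>x. cnj (p (\<gamma> x)) / \<gamma> x ^ k) has_integral (1 / of_real (\<rho> ^ (2 * k)) * cnj 0)) {0..1}"
      by (rule has_integral_eq[rotated]) (use \<rho> in \<open>simp add: cn del: of_real_power\<close>)
    from has_integral_add[OF coeff[of k] this]
    have "((\<lambda>x. p (\<gamma> x) / \<gamma> x ^ k + cnj (p (\<gamma> x)) / \<gamma> x ^ k) has_integral (taylor p k + 0)) {0..1}"
      by simp
    hence I1: "((\<lambda>x. of_real (2 * Re (p (\<gamma> x))) / \<gamma> x ^ k) has_integral taylor p k) {0..1}"
      by (simp only: add_divide_distrib[symmetric] complex_add_cnj add_0_right)
    have "((\<lambda>x. Re (p (\<gamma> x) / \<gamma> x ^ 0)) has_integral Re (taylor p 0)) {0..1}"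
      using has_integral_linear[OF coeff[of 0] bounded_linear_Re] by (simp add: o_def)
    hence "((\<lambda>x. 2 / \<rho> ^ k * Re (p (\<gamma> x))) has_integral (2 / \<rho> ^ k * Re (p 0))) {0..1}"
      by (intro has_integral_mult_right) (simp add: taylor_0[OF hol])
    moreover have "norm (of_real (2 * Re (p (\<gamma> x))) / \<gamma> x ^ k) \<le> 2 / \<rho> ^ k * Re (p (\<gamma> x))" for x
      using nonneg[of "\<gamma> x"] \<rho> by (simp add: norm_divide norm_power n\<gamma> abs_mult)
    ultimately have "norm (integral {0..1} (\<lambda>x. of_real (2 * Re (p (\<gamma> x))) / \<gamma> x ^ k)) \<le> integral {0..1} (\<lambda>x. 2 / \<rho> ^ k * Re (p (\<gamma> x)))"
      using I1 by (intro integral_norm_bound_integral) (auto simp: has_integral_iff)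
    hence "norm (taylor p k) \<le> 2 / \<rho> ^ k * Re (p 0)"
      using I1 \<open>((\<lambda>x. 2 / \<rho> ^ k * Re (p (\<gamma> x))) has_integral (2 / \<rho> ^ k * Re (p 0))) {0..1}\<close>
      by (simp only: integral_unique)
    thus ?thesis using \<rho> by (simp add: field_simps)
  qed
  have "((\<lambda>\<rho>::real. norm (taylor p k) * \<rho> ^ k) \<longlongrightarrow> norm (taylor p k) * 1 ^ k) (at_left 1)"
    by (intro tendsto_intros)
  moreover have "\<forall>\<^sub>F \<rho> in at_left (1::real). norm (taylor p k) * \<rho> ^ k \<le> 2 * Re (p 0)"
    by (rule eventually_mono[OF eventually_at_left_real[OF zero_less_one]]) (use main in auto)
  ultimately have "norm (taylor p k) * 1 ^ k \<le> 2 * Re (p 0)"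
    by (intro tendsto_upperbound) auto
  thus ?thesis by simp
qed

text \<open>Caratheodory's bound applied to \<open>1 - s * \<psi>\<close>, where the unimodular \<open>s\<close> makes \<open>s * \<psi> 0\<close>
  non-negative. The sharp factor is \<open>1 - \<bar>\<psi> 0\<bar>\<^sup>2\<close>, but this weaker bound is all that Bohr's
  inequality needs.\<close>

lemma norm_taylor_le_of_bounded:
  assumes hol: "\<psi> holomorphic_on unit_disc" and bnd: "\<And>z. norm z < 1 \<Longrightarrow> norm (\<psi> z) \<le> 1"
    and k: "0 < k"
  shows "norm (taylor \<psi> k) \<le> 2 * (1 - norm (\<psi> 0))"
proof -
  define s where "s = (if \<psi> 0 = 0 then 1 else cnj (\<psi> 0) / of_real (norm (\<psi> 0)))"
  have s: "norm s = 1" "s * \<psi> 0 = of_real (norm (\<psi> 0))"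
    by (auto simp: s_def norm_divide complex_norm_square[symmetric] power2_eq_square mult.commute[of "cnj _"])
  define p where "p z = 1 - s * \<psi> z" for z
  have hp: "p holomorphic_on unit_disc" unfolding p_def by (intro holomorphic_intros hol)
  have "0 \<le> Re (p z)" if "norm z < 1" for z
  proof -
    have "Re (s * \<psi> z) \<le> norm (s * \<psi> z)" by (rule complex_Re_le_cmod)
    also have "\<dots> \<le> 1" using bnd[OF that] s by (simp add: norm_mult)
    finally show ?thesis by (simp add: p_def)
  qed
  from norm_taylor_le_of_Re_nonneg[OF hp this k]
  have "norm (taylor p k) \<le> 2 * Re (p 0)" .
  moreover have "taylor p k = - s * taylor \<psi> k"
  proof -
    have "p has_fps_expansion 1 - fps_const s * fps_expansion \<psi> 0"
      unfolding p_def by (intro fps_expansion_intros has_fps_expansion_disc hol)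
    thus ?thesis using k by (simp add: fps_expansion_eqI)
  qed
  moreover have "Re (p 0) = 1 - norm (\<psi> 0)" by (simp add: p_def s(2))
  ultimately show ?thesis using s(1) by (simp add: norm_mult)
qed

text \<open>Truncated majorant series of a formal power series.\<close>

definition fps_majorant :: "complex fps \<Rightarrow> nat \<Rightarrow> real \<Rightarrow> real" where
  "fps_majorant A N r = (\<Sum>m<N. norm (fps_nth A m) * r ^ m)"

lemma fps_majorant_nonneg: "0 \<le> r \<Longrightarrow> 0 \<le> fps_majorant A N r"
  unfolding fps_majorant_def by (intro sum_nonneg) auto

lemma fps_majorant_mult:
  assumes r: "0 \<le> r"
  shows "fps_majorant (A * B) N r \<le> fps_majorant A N r * fps_majorant B N r"
proof -
  let ?a = "\<lambda>i. norm (fps_nth A i) * r ^ i" and ?b = "\<lambda>i. norm (fps_nth B i) * r ^ i"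
  have "fps_majorant (A * B) N r \<le> (\<Sum>m<N. \<Sum>i\<le>m. ?a i * ?b (m - i))"
    unfolding fps_majorant_def
  proof (rule sum_mono)
    fix m
    have "norm (fps_nth (A * B) m) * r ^ m \<le> (\<Sum>i\<le>m. norm (fps_nth A i * fps_nth B (m - i))) * r ^ m"
      unfolding fps_mult_nth atLeast0AtMost by (intro mult_right_mono norm_sum) (use r in auto)
    also have "\<dots> = (\<Sum>i\<le>m. ?a i * ?b (m - i))"
      unfolding sum_distrib_right
      by (rule sum.cong) (auto simp: norm_mult algebra_simps simp flip: power_add)
    finally show "norm (fps_nth (A * B) m) * r ^ m \<le> (\<Sum>i\<le>m. ?a i * ?b (m - i))" .
  qed
  also have "\<dots> = (\<Sum>(i, j) | i + j < N. ?a i * ?b j)"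
    by (rule sum.triangle_reindex[symmetric])
  also have "\<dots> \<le> (\<Sum>(i, j) \<in> {..<N} \<times> {..<N}. ?a i * ?b j)"
    by (rule sum_mono2) (use r in auto)
  also have "\<dots> = fps_majorant A N r * fps_majorant B N r"
    unfolding fps_majorant_def sum_product sum.cartesian_product ..
  finally show ?thesis .
qed

lemma fps_majorant_power:
  assumes r: "0 \<le> r"
  shows "fps_majorant (A ^ i) N r \<le> fps_majorant A N r ^ i"
proof (induction i)
  case 0
  have "fps_majorant 1 N r = (\<Sum>m<N. if m = 0 then 1 else 0)"
    unfolding fps_majorant_def by (intro sum.cong) auto
  also have "\<dots> \<le> 1" by simp
  finally show ?case by simp
next
  case (Suc i)
  have "fps_majorant (A ^ Suc i) N r \<le> fps_majorant A N r * fps_majorant (A ^ i) N r"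
    by (simp add: fps_majorant_mult[OF r])
  also have "\<dots> \<le> fps_majorant A N r * fps_majorant A N r ^ i"
    by (intro mult_left_mono Suc.IH fps_majorant_nonneg r)
  finally show ?case by simp
qed

lemma fps_majorant_compose:
  assumes r: "0 \<le> r" and B: "fps_majorant B N r \<le> r"
  shows "fps_majorant (fps_compose A B) N r \<le> fps_majorant A N r"
proof -
  have "fps_majorant (fps_compose A B) N r \<le> (\<Sum>m<N. \<Sum>i<N. norm (fps_nth A i) * (norm (fps_nth (B ^ i) m) * r ^ m))"
    unfolding fps_majorant_def
  proof (rule sum_mono)
    fix m assume m: "m \<in> {..<N}"
    have "norm (fps_nth (fps_compose A B) m) * r ^ m \<le> (\<Sum>i\<in>{0..m}. norm (fps_nth A i * fps_nth (B ^ i) m)) * r ^ m"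
      unfolding fps_compose_nth by (intro mult_right_mono norm_sum) (use r in auto)
    also have "\<dots> \<le> (\<Sum>i<N. norm (fps_nth A i * fps_nth (B ^ i) m)) * r ^ m"
      by (intro mult_right_mono sum_mono2) (use m r in auto)
    also have "\<dots> = (\<Sum>i<N. norm (fps_nth A i) * (norm (fps_nth (B ^ i) m) * r ^ m))"
      by (simp add: sum_distrib_right norm_mult mult.assoc)
    finally show "norm (fps_nth (fps_compose A B) m) * r ^ m \<le> \<dots>" .
  qed
  also have "\<dots> = (\<Sum>i<N. norm (fps_nth A i) * fps_majorant (B ^ i) N r)"
    unfolding fps_majorant_def sum_distrib_left by (rule sum.swap)
  also have "\<dots> \<le> (\<Sum>i<N. norm (fps_nth A i) * r ^ i)"
  proof (intro sum_mono mult_left_mono norm_ge_zero)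
    fix i
    have "fps_majorant (B ^ i) N r \<le> fps_majorant B N r ^ i" by (rule fps_majorant_power[OF r])
    also have "\<dots> \<le> r ^ i" by (intro power_mono B fps_majorant_nonneg r)
    finally show "fps_majorant (B ^ i) N r \<le> r ^ i" .
  qed
  finally show ?thesis by (simp add: fps_majorant_def)
qed

text \<open>Bohr's inequality: \<open>a + 2 * (1 - a) * (r + r\<^sup>2 + \<dots>) \<le> a + (1 - a) = 1\<close> for \<open>r \<le> 1 / 3\<close>.\<close>

lemma bohr_inequality:
  assumes hol: "\<psi> holomorphic_on unit_disc" and bnd: "\<And>z. norm z < 1 \<Longrightarrow> norm (\<psi> z) \<le> 1"
    and r: "0 \<le> r" "r \<le> 1 / 3"
  shows "fps_majorant (fps_expansion \<psi> 0) N r \<le> 1"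
proof (cases N)
  case 0
  thus ?thesis by (simp add: fps_majorant_def)
next
  case (Suc M)
  define a where "a = norm (\<psi> 0)"
  have a: "a \<le> 1" using bnd[of 0] by (simp add: a_def)
  have geo: "(\<Sum>m<M. r ^ Suc m) \<le> 1 / 2"
  proof -
    have "(\<Sum>m<M. r ^ Suc m) \<le> (\<Sum>m. r ^ Suc m)"
      by (rule sum_le_suminf) (use r in \<open>auto intro!: summable_mult summable_geometric\<close>)
    also have "\<dots> = r / (1 - r)" using r by (simp add: suminf_mult suminf_geometric)
    also have "\<dots> \<le> 1 / 2" using r by (simp add: field_simps)
    finally show ?thesis .
  qed
  have "fps_majorant (fps_expansion \<psi> 0) N r = a + (\<Sum>m<M. norm (taylor \<psi> (Suc m)) * r ^ Suc m)"
    unfolding fps_majorant_def Suc sum.lessThan_Suc_shift using taylor_0[OF hol] by (simp add: a_def)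
  also have "\<dots> \<le> a + (\<Sum>m<M. 2 * (1 - a) * r ^ Suc m)"
    unfolding a_def by (intro add_left_mono sum_mono mult_right_mono norm_taylor_le_of_bounded hol bnd) (use r in auto)
  also have "\<dots> = a + 2 * (1 - a) * (\<Sum>m<M. r ^ Suc m)" by (simp only: sum_distrib_left)
  also have "\<dots> \<le> a + 2 * (1 - a) * (1 / 2)" using a geo by (intro add_left_mono mult_left_mono) auto
  finally show ?thesis by (simp add: diff_divide_distrib)
qed

text \<open>Majorant series respect subordination for \<open>r \<le> 1 / 3\<close>: write \<open>\<omega> = z * \<psi>\<close> with \<open>\<bar>\<psi>\<bar> \<le> 1\<close>; by
  Bohr's inequality the majorant series of \<open>\<omega>\<close> is at most \<open>r\<close>, and substitute it into that of \<open>g\<close>.\<close>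

lemma majorant_subordinate:
  assumes g: "g holomorphic_on unit_disc" and \<omega>: "\<omega> holomorphic_on unit_disc"
    and \<omega>le: "\<And>z. norm z < 1 \<Longrightarrow> norm (\<omega> z) \<le> norm z"
    and f: "f holomorphic_on unit_disc" "\<And>z. norm z < 1 \<Longrightarrow> f z = g (\<omega> z)" and r: "0 \<le> r" "r \<le> 1 / 3"
  shows "majorant f r \<le> majorant g r"
proof -
  have \<omega>0: "\<omega> 0 = 0" using \<omega>le[of 0] by simp
  obtain \<psi> where \<psi>: "\<psi> holomorphic_on unit_disc" "\<And>z. norm z < 1 \<Longrightarrow> \<omega> z = z * \<psi> z" "deriv \<omega> 0 = \<psi> 0"
    using Schwarz3[OF \<omega> \<omega>0] by auto
  have "norm (\<psi> z) \<le> 1" if z: "norm z < 1" for z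
  proof (cases "z = 0")
    case True
    have "norm (\<omega> z) < 1" if "norm z < 1" for z using \<omega>le[OF that] that by simp
    from Schwarz_Lemma(2)[OF \<omega> \<omega>0 this, of 0] show ?thesis using True \<psi>(3) by simp
  next
    case False
    thus ?thesis using \<omega>le[OF z] \<psi>(2)[OF z] by (simp add: norm_mult)
  qed
  note bohr = bohr_inequality[OF \<psi>(1) this r]
  have ev: "\<forall>\<^sub>F z in nhds 0. norm (z::complex) < 1"
    using eventually_nhds_in_open[of unit_disc "0::complex"] by simp
  have "\<omega> has_fps_expansion fps_X * fps_expansion \<psi> 0 \<longleftrightarrow> (\<lambda>z. z * \<psi> z) has_fps_expansion fps_X * fps_expansion \<psi> 0"
    by (rule has_fps_expansion_cong[OF eventually_mono[OF ev] refl]) (use \<psi>(2) in auto)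
  hence "\<omega> has_fps_expansion fps_X * fps_expansion \<psi> 0"
    by (auto intro!: fps_expansion_intros has_fps_expansion_disc \<psi>(1))
  hence W: "fps_expansion \<omega> 0 = fps_X * fps_expansion \<psi> 0" by (rule fps_expansion_eqI)
  have "(g \<circ> \<omega>) has_fps_expansion fps_compose (fps_expansion g 0) (fps_expansion \<omega> 0)"
    by (intro has_fps_expansion_compose has_fps_expansion_disc g \<omega>) (simp add: W)
  moreover have "f has_fps_expansion fps_compose (fps_expansion g 0) (fps_expansion \<omega> 0) \<longleftrightarrow> (g \<circ> \<omega>) has_fps_expansion fps_compose (fps_expansion g 0) (fps_expansion \<omega> 0)"
    by (rule has_fps_expansion_cong[OF eventually_mono[OF ev] refl]) (use f(2) in auto)
  ultimately have F: "fps_expansion f 0 = fps_compose (fps_expansion g 0) (fps_expansion \<omega> 0)"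
    by (auto intro: fps_expansion_eqI)
  have mX: "fps_majorant fps_X N r \<le> r" for N
  proof -
    have "fps_majorant fps_X N r = (\<Sum>m<N. if m = 1 then r else 0)"
      unfolding fps_majorant_def by (intro sum.cong) (auto simp: fps_X_def)
    thus ?thesis using r by simp
  qed
  have m\<omega>: "fps_majorant (fps_expansion \<omega> 0) N r \<le> r" for N
  proof -
    have "fps_majorant (fps_expansion \<omega> 0) N r \<le> fps_majorant fps_X N r * fps_majorant (fps_expansion \<psi> 0) N r"
      unfolding W by (rule fps_majorant_mult[OF r(1)])
    also have "\<dots> \<le> r * 1" by (intro mult_mono mX bohr fps_majorant_nonneg r)
    finally show ?thesis by simp
  qed
  have r1: "\<bar>r\<bar> < 1" using r by simp
  show ?thesis unfolding majorant_def
  proof (rule suminf_le_const[OF summable_majorant[OF f(1) r1]])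
    fix N
    have "(\<Sum>k<N. norm (taylor f k) * r ^ k) \<le> fps_majorant (fps_expansion g 0) N r"
      using fps_majorant_compose[OF r(1) m\<omega>] by (simp add: F fps_majorant_def[symmetric])
    also have "\<dots> \<le> (\<Sum>k. norm (taylor g k) * r ^ k)"
      unfolding fps_majorant_def by (rule sum_le_suminf[OF summable_majorant[OF g r1]]) (use r in auto)
    finally show "(\<Sum>k<N. norm (taylor f k) * r ^ k) \<le> \<dots>" .
  qed
qed

text \<open>Termwise integration of \<open>t ^ m * majorant F t\<close>.\<close>

lemma has_integral_power_majorant:
  assumes F: "F holomorphic_on unit_disc" and r: "0 \<le> r" "r < 1"
  shows "summable (\<lambda>k. norm (taylor F k) * r ^ (k + m + 1) / real (k + m + 1))"
    and "((\<lambda>t. t ^ m * majorant F t) has_integral (\<Sum>k. norm (taylor F k) * r ^ (k + m + 1) / real (k + m + 1))) {0..r}"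
proof -
  define a where "a j = (if j < m + 1 then 0 else norm (taylor F (j - (m + 1))) / real j)" for j
  have ashift: "a (k + (m + 1)) * t ^ (k + (m + 1)) = norm (taylor F k) * t ^ (k + m + 1) / real (k + m + 1)" for k t
    by (simp add: a_def add.assoc)
  have sum0: "summable (\<lambda>k. norm (taylor F k) * t ^ (k + m + 1) / real (k + m + 1))" if t: "norm t < 1" for t
  proof (rule summable_comparison_test')
    show "summable (\<lambda>k. norm (taylor F k) * \<bar>t\<bar> ^ k)" by (rule summable_majorant[OF F]) (use t in simp)
    fix k :: nat
    have "\<bar>t\<bar> ^ (k + m + 1) / real (k + m + 1) \<le> \<bar>t\<bar> ^ (k + m + 1) / 1" by (intro divide_left_mono) auto
    also have "\<dots> \<le> \<bar>t\<bar> ^ k" unfolding div_by_1 using t by (intro power_decreasing) auto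
    finally have "norm (taylor F k) * (\<bar>t\<bar> ^ (k + m + 1) / real (k + m + 1)) \<le> norm (taylor F k) * \<bar>t\<bar> ^ k"
      by (intro mult_left_mono) auto
    thus "norm (norm (taylor F k) * t ^ (k + m + 1) / real (k + m + 1)) \<le> norm (taylor F k) * \<bar>t\<bar> ^ k"
      by (simp add: abs_mult power_abs)
  qed
  show "summable (\<lambda>k. norm (taylor F k) * r ^ (k + m + 1) / real (k + m + 1))"
    using sum0[of r] r by simp
  have suma: "summable (\<lambda>j. a j * t ^ j)" if "norm t < 1" for t
    using sum0[OF that] unfolding ashift[symmetric] by (subst (asm) summable_iff_shift)
  define S where "S t = (\<Sum>j. a j * t ^ j)" for t
  have S: "S t = (\<Sum>k. norm (taylor F k) * t ^ (k + m + 1) / real (k + m + 1))" if "norm t < 1" for t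
  proof -
    have "S t = (\<Sum>k. a (k + (m + 1)) * t ^ (k + (m + 1))) + (\<Sum>j<m + 1. a j * t ^ j)"
      unfolding S_def by (rule suminf_split_initial_segment[OF suma[OF that]])
    also have "(\<Sum>j<m + 1. a j * t ^ j) = 0" by (rule sum.neutral) (simp add: a_def)
    finally show ?thesis by (simp only: ashift add_0_right)
  qed
  have dS: "(S has_real_derivative t ^ m * majorant F t) (at t)" if t: "norm t < 1" for t
  proof -
    have "(\<lambda>n. norm (taylor F n) * t ^ n) sums majorant F t"
      unfolding majorant_def using summable_majorant[OF F, of t] t by (auto intro: summable_sums)
    hence "(\<lambda>n. t ^ m * (norm (taylor F n) * t ^ n)) sums (t ^ m * majorant F t)" by (rule sums_mult)
    moreover have "t ^ m * (norm (taylor F n) * t ^ n) = diffs a (n + m) * t ^ (n + m)" for n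
      by (simp add: diffs_def a_def power_add)
    ultimately have "(\<lambda>n. diffs a (n + m) * t ^ (n + m)) sums (t ^ m * majorant F t)" by simp
    moreover have "(\<Sum>i<m. diffs a i * t ^ i) = 0" by (rule sum.neutral) (simp add: diffs_def a_def)
    ultimately have "(\<lambda>n. diffs a n * t ^ n) sums (t ^ m * majorant F t)"
      using sums_iff_shift[of "\<lambda>n. diffs a n * t ^ n" m "t ^ m * majorant F t"] by simp
    moreover have "(S has_real_derivative (\<Sum>n. diffs a n * t ^ n)) (at t)"
      unfolding S_def by (rule termdiffs_strong'[of 1]) (use suma t in auto)
    ultimately show ?thesis by (simp add: sums_iff)
  qed
  have "((\<lambda>t. t ^ m * majorant F t) has_integral (S r - S 0)) {0..r}"
  proof (rule fundamental_theorem_of_calculus[OF r(1)])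
    fix x assume "x \<in> {0..r}"
    hence "(S has_real_derivative x ^ m * majorant F x) (at x)" using r by (intro dS) auto
    thus "(S has_vector_derivative x ^ m * majorant F x) (at x within {0..r})"
      by (simp add: has_real_derivative_iff_has_vector_derivative has_vector_derivative_at_within)
  qed
  moreover have "S 0 = 0" by (simp add: S)
  ultimately show "((\<lambda>t. t ^ m * majorant F t) has_integral (\<Sum>k. norm (taylor F k) * r ^ (k + m + 1) / real (k + m + 1))) {0..r}"
    using S[of r] r by simp
qed

lemma continuous_on_majorant:
  assumes F: "F holomorphic_on unit_disc"
  shows "continuous_on {0..<1} (majorant F)"
proof -
  have "isCont (majorant F) t" if "t \<in> {0..<1}" for t
  proof -
    have "t < 1" using that by simp
    then obtain s where s: "t < s" "s < 1" using dense by blast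
    have "isCont (\<lambda>x. \<Sum>k. norm (taylor F k) * x ^ k) t"
      by (rule isCont_powser[of _ s]) (use s that summable_majorant[OF F] in auto)
    thus ?thesis by (simp add: majorant_def[abs_def])
  qed
  thus ?thesis by (auto intro: continuous_at_imp_continuous_on)
qed

section \<open>Integrals over the unit interval\<close>

lemma integrable_on_01_bounded:
  fixes u :: "real \<Rightarrow> real"
  assumes cont: "continuous_on {0..<1} u" and bnd: "\<And>t. 0 \<le> t \<Longrightarrow> t < 1 \<Longrightarrow> \<bar>u t\<bar> \<le> 1"
  shows "u integrable_on {0..1}"
proof -
  have "u integrable_on {0<..<1}"
  proof (rule measurable_bounded_by_integrable_imp_integrable[of _ _ "\<lambda>_. 1"])
    show "u \<in> borel_measurable (lebesgue_on {0<..<1})"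
      by (rule continuous_imp_measurable_on_sets_lebesgue[OF continuous_on_subset[OF cont]]) auto
    have "(\<lambda>_. 1::real) integrable_on {0..1::real}" by (intro integrable_continuous_interval continuous_on_const)
    thus "(\<lambda>_. 1::real) integrable_on {0<..<1::real}" by (simp only: integrable_on_Icc_iff_Ioo)
  qed (use bnd in auto)
  thus ?thesis by (simp only: integrable_on_Icc_iff_Ioo)
qed

lemma integral_from_0_has_derivative:
  fixes u :: "real \<Rightarrow> real"
  assumes cont: "continuous_on {0..<1} u" and r: "0 < r" "r < 1"
  shows "((\<lambda>x. integral {0..x} u) has_real_derivative u r) (at r)"
proof -
  obtain s where s: "r < s" "s < 1" using dense[OF r(2)] by blast
  have "((\<lambda>x. integral {0..x} u) has_real_derivative u r) (at r within {0..s})"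
    by (rule integral_has_real_derivative[OF continuous_on_subset[OF cont]]) (use r s in auto)
  moreover have "at r within {0..s} = at r" using r s by (intro at_within_interior) auto
  ultimately show ?thesis by simp
qed

lemma continuous_on_integral_from_0:
  fixes u :: "real \<Rightarrow> real"
  assumes cont: "continuous_on {0..<1} u" and s: "s < 1"
  shows "continuous_on {0..s} (\<lambda>x. integral {0..x} u)"
  by (intro indefinite_integral_continuous_1 integrable_continuous_interval continuous_on_subset[OF cont])
    (use s in auto)

lemma integral_from_0_strict_mono:
  fixes u :: "real \<Rightarrow> real"
  assumes cont: "continuous_on {0..<1} u" and pos: "\<And>t. 0 < t \<Longrightarrow> t < 1 \<Longrightarrow> 0 < u t"
    and ab: "0 \<le> a" "a < b" "b < 1"
  shows "integral {0..a} u < integral {0..b} u"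
proof (rule DERIV_pos_imp_increasing_open[OF ab(2)])
  fix t assume "a < t" "t < b"
  hence t: "0 < t" "t < 1" using ab by auto
  show "\<exists>y. ((\<lambda>x. integral {0..x} u) has_real_derivative y) (at t) \<and> 0 < y"
    using integral_from_0_has_derivative[OF cont t] pos[OF t] by blast
next
  show "continuous_on {a..b} (\<lambda>x. integral {0..x} u)"
    by (rule continuous_on_subset[OF continuous_on_integral_from_0[OF cont ab(3)]]) (use ab in auto)
qed

lemma integral_tendsto_at_left_1:
  fixes u :: "real \<Rightarrow> real"
  assumes "u integrable_on {0..1}"
  shows "((\<lambda>x. integral {0..x} u) \<longlongrightarrow> integral {0..1} u) (at_left 1)"
proof -
  have "((\<lambda>x. integral {0..x} u) \<longlongrightarrow> integral {0..1} u) (at 1 within {0..1})"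
    using indefinite_integral_continuous_1[OF assms] unfolding continuous_on_def by simp
  thus ?thesis by (simp add: at_within_Icc_at_left)
qed

section \<open>The extremal function on the negative real axis\<close>

text \<open>\<open>K'(-t)\<close> as a real function on \<open>[0, 1)\<close>.\<close>

definition dK_neg :: "(complex \<Rightarrow> complex) \<Rightarrow> real \<Rightarrow> real" where
  "dK_neg \<phi> t = exp (Re (log_dK \<phi> (- of_real t)))"

lemma dK_neg_pos: "0 < dK_neg \<phi> t"
  by (simp add: dK_neg_def)

lemma log_dK_neg_has_derivative:
  assumes mm: "ma_minda \<phi>" and t: "\<bar>t\<bar> < 1"
  shows "((\<lambda>s. log_dK \<phi> (- of_real s)) has_vector_derivative (- ma_quot \<phi> (- of_real t))) (at t)"
proof (rule has_vector_derivative_real_field)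
  have "(log_dK \<phi> has_field_derivative ma_quot \<phi> (- of_real t)) (at (- of_real t))"
    by (rule log_dK_has_derivative[OF mm]) (use t in auto)
  thus "((\<lambda>s. log_dK \<phi> (- s)) has_field_derivative (- ma_quot \<phi> (- of_real t))) (at (of_real t))"
    by (rule DERIV_chain2[THEN DERIV_cong]) (auto intro!: derivative_eq_intros)
qed

lemma ma_quot_neg:
  assumes mm: "ma_minda \<phi>" and t: "\<bar>t\<bar> < 1"
  shows "Im (ma_quot \<phi> (- of_real t)) = 0" "0 \<le> t \<Longrightarrow> 0 < Re (ma_quot \<phi> (- of_real t))"
proof -
  show "Im (ma_quot \<phi> (- of_real t)) = 0"
    using ma_minda_Im_of_real[OF mm, of "- t"] t ma_mindaD(5)[OF mm]
    by (auto simp: ma_quot_def complex_is_Real_iff)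
  assume t0: "0 \<le> t"
  show "0 < Re (ma_quot \<phi> (- of_real t))"
  proof (cases "t = 0")
    case True
    thus ?thesis using ma_mindaD(6)[OF mm] by (simp add: ma_quot_def)
  next
    case False
    have "Re (\<phi> (of_real (- t))) < Re (\<phi> (of_real 0))"
      by (rule ma_minda_strict_mono[OF mm]) (use False t0 t in auto)
    hence "Re (\<phi> (- of_real t)) < 1" using ma_mindaD(3)[OF mm] by simp
    moreover have "ma_quot \<phi> (- of_real t) = (1 - \<phi> (- of_real t)) / of_real t"
      using False by (simp add: ma_quot_def field_simps)
    ultimately show ?thesis using False t0 by simp
  qed
qed

lemma exp_log_dK_neg:
  assumes mm: "ma_minda \<phi>" and t: "\<bar>t\<bar> < 1"
  shows "exp (log_dK \<phi> (- of_real t)) = of_real (dK_neg \<phi> t)"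
proof -
  have "\<exists>c. \<forall>x\<in>{-1<..<1}. Im (log_dK \<phi> (- of_real x)) = c"
  proof (rule has_field_derivative_zero_constant)
    fix x :: real assume "x \<in> {-1<..<1}"
    hence x: "\<bar>x\<bar> < 1" by auto
    have "((\<lambda>s. Im (log_dK \<phi> (- of_real s))) has_real_derivative 0) (at x)"
      using bounded_linear.has_vector_derivative[OF bounded_linear_Im log_dK_neg_has_derivative[OF mm x]]
        ma_quot_neg(1)[OF mm x] by (simp add: has_real_derivative_iff_has_vector_derivative)
    thus "((\<lambda>s. Im (log_dK \<phi> (- of_real s))) has_real_derivative 0) (at x within {-1<..<1})"
      by (rule has_field_derivative_at_within)
  qed simp
  then obtain c where c: "\<And>x. \<bar>x\<bar> < 1 \<Longrightarrow> Im (log_dK \<phi> (- of_real x)) = c" by force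
  hence "Im (log_dK \<phi> (- of_real t)) = 0" using c[OF t] c[of 0] by simp
  hence "log_dK \<phi> (- of_real t) = of_real (Re (log_dK \<phi> (- of_real t)))" by (simp add: complex_eq_iff)
  thus ?thesis by (metis dK_neg_def exp_of_real)
qed

lemma continuous_on_dK_neg:
  assumes mm: "ma_minda \<phi>"
  shows "continuous_on {0..<1} (dK_neg \<phi>)"
  unfolding dK_neg_def
  by (intro continuous_intros continuous_on_Re
      continuous_on_compose2[OF holomorphic_on_imp_continuous_on[OF log_dK_holomorphic[OF mm]]]) auto

lemma dK_neg_le_1:
  assumes mm: "ma_minda \<phi>" and t: "0 \<le> t" "t < 1"
  shows "dK_neg \<phi> t \<le> 1"
proof -
  have "Re (log_dK \<phi> (- of_real t)) \<le> Re (log_dK \<phi> (- of_real 0))"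
  proof (rule DERIV_nonpos_imp_nonincreasing[OF t(1)])
    fix x assume "0 \<le> x" "x \<le> t"
    hence x: "\<bar>x\<bar> < 1" "0 \<le> x" using t by auto
    have "((\<lambda>s. Re (log_dK \<phi> (- of_real s))) has_real_derivative - Re (ma_quot \<phi> (- of_real x))) (at x)"
      using bounded_linear.has_vector_derivative[OF bounded_linear_Re log_dK_neg_has_derivative[OF mm x(1)]]
      by (simp add: has_real_derivative_iff_has_vector_derivative)
    thus "\<exists>y. ((\<lambda>s. Re (log_dK \<phi> (- of_real s))) has_real_derivative y) (at x) \<and> y \<le> 0"
      using ma_quot_neg(2)[OF mm x] by (intro exI conjI) auto
  qed
  thus ?thesis by (simp add: dK_neg_def)
qed

lemma deriv_K_fun:
  assumes mm: "ma_minda \<phi>" and z: "norm z < 1"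
  shows "deriv (K_fun \<phi>) z = exp (log_dK \<phi> z)"
  by (rule DERIV_imp_deriv[OF K_fun_has_derivative[OF mm z]])

lemma K_fun_holomorphic:
  assumes mm: "ma_minda \<phi>"
  shows "K_fun \<phi> holomorphic_on unit_disc"
  unfolding holomorphic_on_open[OF open_ball]
  by (rule ballI, rule exI, rule K_fun_has_derivative[OF mm]) simp

lemma K_fun_neg:
  assumes mm: "ma_minda \<phi>" and r: "0 \<le> r" "r < 1"
  shows "K_fun \<phi> (- of_real r) = - of_real (integral {0..r} (dK_neg \<phi>))"
proof -
  have "((\<lambda>t. - complex_of_real (dK_neg \<phi> t)) has_integral (K_fun \<phi> (- of_real r) - K_fun \<phi> (- of_real 0))) {0..r}"
  proof (rule fundamental_theorem_of_calculus[OF r(1)])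
    fix x assume "x \<in> {0..r}"
    hence x: "\<bar>x\<bar> < 1" using r by auto
    have "(K_fun \<phi> has_field_derivative of_real (dK_neg \<phi> x)) (at (- of_real x))"
      using K_fun_has_derivative[OF mm, of "- of_real x"] x exp_log_dK_neg[OF mm x] by simp
    hence "((\<lambda>s. K_fun \<phi> (- s)) has_field_derivative (- of_real (dK_neg \<phi> x))) (at (of_real x))"
      by (rule DERIV_chain2[THEN DERIV_cong]) (auto intro!: derivative_eq_intros)
    hence "((\<lambda>s. K_fun \<phi> (- of_real s)) has_vector_derivative (- of_real (dK_neg \<phi> x))) (at x)"
      by (rule has_vector_derivative_real_field)
    thus "((\<lambda>s. K_fun \<phi> (- of_real s)) has_vector_derivative (- of_real (dK_neg \<phi> x))) (at x within {0..r})"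
      by (rule has_vector_derivative_at_within)
  qed
  moreover have "dK_neg \<phi> integrable_on {0..r}"
    by (intro integrable_continuous_interval continuous_on_subset[OF continuous_on_dK_neg[OF mm]]) (use r in auto)
  hence "((\<lambda>t. - complex_of_real (dK_neg \<phi> t)) has_integral (- of_real (integral {0..r} (dK_neg \<phi>)))) {0..r}"
    by (intro has_integral_neg has_integral_of_real integrable_integral)
  ultimately show ?thesis by (metis K_fun_0 diff_zero has_integral_unique minus_zero of_real_0)
qed

lemma continuous_on_weighted_dK_neg:
  assumes mm: "ma_minda \<phi>"
  shows "continuous_on {0..<1} (\<lambda>t. (1 - c * t ^ n) * dK_neg \<phi> t)"
  by (intro continuous_intros continuous_on_dK_neg[OF mm])

lemma weighted_dK_neg_integrable:
  assumes mm: "ma_minda \<phi>" and c: "0 \<le> c" "c \<le> 1"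
  shows "dK_neg \<phi> integrable_on {0..1}" "(\<lambda>t. t ^ n * dK_neg \<phi> t) integrable_on {0..1}"
    "(\<lambda>t. (1 - c * t ^ n) * dK_neg \<phi> t) integrable_on {0..1}"
proof -
  show 1: "dK_neg \<phi> integrable_on {0..1}"
    by (rule integrable_on_01_bounded[OF continuous_on_dK_neg[OF mm]])
      (use dK_neg_le_1[OF mm] dK_neg_pos[of \<phi>] in \<open>simp add: less_imp_le\<close>)
  show 2: "(\<lambda>t. t ^ n * dK_neg \<phi> t) integrable_on {0..1}"
  proof (rule integrable_on_01_bounded)
    show "continuous_on {0..<1} (\<lambda>t. t ^ n * dK_neg \<phi> t)"
      by (intro continuous_intros continuous_on_dK_neg[OF mm])
    fix t :: real assume t: "0 \<le> t" "t < 1"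
    have "t ^ n * dK_neg \<phi> t \<le> 1 * 1"
      by (rule mult_mono) (use t dK_neg_le_1[OF mm t] dK_neg_pos[of \<phi> t] in \<open>auto simp: power_le_one\<close>)
    thus "\<bar>t ^ n * dK_neg \<phi> t\<bar> \<le> 1" using t dK_neg_pos[of \<phi> t] by (simp add: abs_mult)
  qed
  have "(\<lambda>t. dK_neg \<phi> t - c * (t ^ n * dK_neg \<phi> t)) integrable_on {0..1}"
    by (rule integrable_diff[OF 1 integrable_on_mult_right[OF 2]])
  thus "(\<lambda>t. (1 - c * t ^ n) * dK_neg \<phi> t) integrable_on {0..1}" by (simp add: algebra_simps)
qed

text \<open>Both parts of \<open>L_one\<close> combine to one real integral. The value of \<open>deriv (K_fun \<phi>)\<close> at \<open>-1\<close>
  is irrelevant, as a single point does not affect the integral.\<close>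

lemma L_one_eq:
  assumes mm: "ma_minda \<phi>" and z: "norm \<zeta> \<le> 1"
  shows "L_one \<phi> \<zeta> n = of_real (integral {0..1} (\<lambda>t. (1 - norm \<zeta> * t ^ n) * dK_neg \<phi> t))"
proof -
  note int = weighted_dK_neg_integrable[OF mm norm_ge_zero z]
  have "((\<lambda>r. - complex_of_real (integral {0..r} (dK_neg \<phi>))) \<longlongrightarrow> - of_real (integral {0..1} (dK_neg \<phi>))) (at_left 1)"
    by (intro tendsto_intros integral_tendsto_at_left_1 int)
  moreover have "\<forall>\<^sub>F r in at_left 1. - complex_of_real (integral {0..r} (dK_neg \<phi>)) = K_fun \<phi> (- of_real r)"
    by (rule eventually_mono[OF eventually_at_left_real[OF zero_less_one]]) (use K_fun_neg[OF mm] in auto)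
  ultimately have "((\<lambda>r. K_fun \<phi> (- of_real r)) \<longlongrightarrow> - of_real (integral {0..1} (dK_neg \<phi>))) (at_left 1)"
    by (rule Lim_transform_eventually)
  hence lim: "Lim (at_left 1) (\<lambda>r. K_fun \<phi> (- of_real r)) = - of_real (integral {0..1} (dK_neg \<phi>))"
    by (intro tendsto_Lim) auto
  have "integral {0..1::real} (\<lambda>t. complex_of_real t ^ n * deriv (K_fun \<phi>) (- of_real t))
      = integral {0..1} (\<lambda>t. complex_of_real (t ^ n * dK_neg \<phi> t))"
    by (rule integral_spike[of "{1}"]) (auto simp: deriv_K_fun[OF mm] exp_log_dK_neg[OF mm])
  also have "\<dots> = of_real (integral {0..1} (\<lambda>t. t ^ n * dK_neg \<phi> t))"
    by (intro integral_unique has_integral_of_real integrable_integral int)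
  finally have I: "integral {0..1::real} (\<lambda>t. complex_of_real t ^ n * deriv (K_fun \<phi>) (- of_real t))
      = of_real (integral {0..1} (\<lambda>t. t ^ n * dK_neg \<phi> t))" .
  have "integral {0..1} (\<lambda>t. (1 - norm \<zeta> * t ^ n) * dK_neg \<phi> t)
     = integral {0..1} (\<lambda>t. dK_neg \<phi> t - norm \<zeta> * (t ^ n * dK_neg \<phi> t))"
    by (simp add: algebra_simps)
  also have "\<dots> = integral {0..1} (dK_neg \<phi>) - norm \<zeta> * integral {0..1} (\<lambda>t. t ^ n * dK_neg \<phi> t)"
    by (subst integral_diff) (auto intro!: int integrable_on_mult_right)
  finally show ?thesis unfolding L_one_def lim I by simp
qed

section \<open>The radius equation\<close>

lemma taylor_deriv:
  "taylor (deriv F) k = of_nat (Suc k) * taylor F (Suc k)"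
  by (simp add: fps_expansion_def funpow_Suc_right del: funpow.simps of_nat_Suc)

lemma majorant_has_integral_deriv:
  assumes F: "F holomorphic_on unit_disc" and F0: "F 0 = 0" and r: "0 \<le> r" "r < 1"
  shows "(majorant (deriv F) has_integral majorant F r) {0..r}"
proof -
  have "summable (\<lambda>k. norm (taylor F k) * r ^ k)" by (rule summable_majorant[OF F]) (use r in simp)
  from suminf_split_head[OF this]
  have "majorant F r = (\<Sum>k. norm (taylor F (Suc k)) * r ^ Suc k)"
    using F0 taylor_0[OF F] by (simp add: majorant_def)
  also have "\<dots> = (\<Sum>k. norm (taylor (deriv F) k) * r ^ (k + 0 + 1) / real (k + 0 + 1))"
    by (rule suminf_cong) (simp add: taylor_deriv norm_mult del: of_nat_Suc)
  finally show ?thesis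
    using has_integral_power_majorant(2)[OF holomorphic_deriv[OF F open_ball] r, of 0] by simp
qed

text \<open>The second coefficient of \<open>K'\<close> is \<open>\<phi>'(0) > 0\<close>, so at \<open>-t\<close> the linear term enters \<open>K'\<close> with a
  negative sign but its majorant with a positive one. This gap is what lets the radius equation
  have a root inside \<open>(0, 1)\<close>.\<close>

lemma majorant_dK_lower_bound:
  assumes mm: "ma_minda \<phi>" and t: "0 \<le> t" "t < 1"
  shows "dK_neg \<phi> t + 2 * Re (deriv \<phi> 0) * t \<le> majorant (deriv (K_fun \<phi>)) t"
proof -
  let ?F = "deriv (K_fun \<phi>)"
  have hol: "?F holomorphic_on unit_disc" by (rule holomorphic_deriv[OF K_fun_holomorphic[OF mm] open_ball])
  have c1: "taylor ?F 1 = deriv \<phi> 0"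
  proof -
    have "(?F has_field_derivative deriv \<phi> 0) (at 0)"
    proof (rule has_field_derivative_transform_within_open[where S = unit_disc])
      show "((\<lambda>z. exp (log_dK \<phi> z)) has_field_derivative deriv \<phi> 0) (at 0)"
        using log_dK_has_derivative[OF mm, of 0] by (auto intro!: derivative_eq_intros simp: ma_quot_def)
    qed (use deriv_K_fun[OF mm] in auto)
    thus ?thesis by (simp add: fps_expansion_def DERIV_imp_deriv)
  qed
  have s1: "(\<lambda>k. Re (taylor ?F k * (- of_real t) ^ k)) sums dK_neg \<phi> t"
    using sums_Re[OF taylor_sums[OF hol, of "- of_real t"]] t exp_log_dK_neg[OF mm, of t] deriv_K_fun[OF mm, of "- of_real t"]
    by simp
  have s2: "(\<lambda>k. norm (taylor ?F k) * t ^ k) sums majorant ?F t"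
    unfolding majorant_def using summable_majorant[OF hol, of t] t by auto
  from sums_diff[OF s2 s1]
  have s3: "(\<lambda>k. norm (taylor ?F k) * t ^ k - Re (taylor ?F k * (- of_real t) ^ k)) sums (majorant ?F t - dK_neg \<phi> t)" .
  have nonneg: "0 \<le> norm (taylor ?F k) * t ^ k - Re (taylor ?F k * (- of_real t) ^ k)" for k
    using complex_Re_le_cmod[of "taylor ?F k * (- of_real t) ^ k"] t by (simp add: norm_mult norm_power)
  have "2 * Re (deriv \<phi> 0) * t \<le> norm (taylor ?F 1) * t ^ 1 - Re (taylor ?F 1 * (- of_real t) ^ 1)"
    unfolding c1 using mult_right_mono[OF complex_Re_le_cmod[of "deriv \<phi> 0"] t(1)] by (simp add: mult.commute)
  also have "\<dots> \<le> majorant ?F t - dK_neg \<phi> t"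
    using sum_le_suminf[OF sums_summable[OF s3], of "{1}"] nonneg sums_unique[OF s3] by simp
  finally show ?thesis by simp
qed

text \<open>The right-hand side of the equation that defines the radius, written as a single integral.\<close>

definition bohr_fun :: "(complex \<Rightarrow> complex) \<Rightarrow> real \<Rightarrow> nat \<Rightarrow> real \<Rightarrow> real" where
  "bohr_fun \<phi> c n r = integral {0..r} (\<lambda>t. (1 + c * t ^ n) * majorant (deriv (K_fun \<phi>)) t)"

lemma continuous_on_bohr_integrand:
  assumes mm: "ma_minda \<phi>"
  shows "continuous_on {0..<1} (\<lambda>t. (1 + c * t ^ n) * majorant (deriv (K_fun \<phi>)) t)"
  by (intro continuous_intros continuous_on_majorant holomorphic_deriv K_fun_holomorphic[OF mm]) auto

lemma bohr_fun_eq: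
  assumes mm: "ma_minda \<phi>" and r: "0 \<le> r" "r < 1"
  shows "majorant (K_fun \<phi>) r + c * integral {0..r} (\<lambda>t. t ^ n * majorant (deriv (K_fun \<phi>)) t) = bohr_fun \<phi> c n r"
proof -
  let ?M = "majorant (deriv (K_fun \<phi>))"
  have hol: "deriv (K_fun \<phi>) holomorphic_on unit_disc"
    by (rule holomorphic_deriv[OF K_fun_holomorphic[OF mm] open_ball])
  have 1: "(?M has_integral majorant (K_fun \<phi>) r) {0..r}"
    by (rule majorant_has_integral_deriv[OF K_fun_holomorphic[OF mm] K_fun_0 r])
  have "(\<lambda>t. t ^ n * ?M t) integrable_on {0..r}"
    using has_integral_power_majorant(2)[OF hol r, of n] by (rule has_integral_integrable)
  hence "((\<lambda>t. c * (t ^ n * ?M t)) has_integral c * integral {0..r} (\<lambda>t. t ^ n * ?M t)) {0..r}"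
    by (intro has_integral_mult_right integrable_integral)
  from has_integral_add[OF 1 this] show ?thesis
    unfolding bohr_fun_def by (intro integral_unique[symmetric]) (simp add: algebra_simps)
qed

lemma bohr_integrand_pos:
  assumes mm: "ma_minda \<phi>" and c: "0 \<le> c" and t: "0 < t" "t < 1"
  shows "0 < (1 + c * t ^ n) * majorant (deriv (K_fun \<phi>)) t"
proof -
  have "0 < dK_neg \<phi> t + 2 * Re (deriv \<phi> 0) * t"
    using dK_neg_pos[of \<phi> t] ma_mindaD(6)[OF mm] t by (intro add_pos_pos mult_pos_pos) auto
  hence "0 < majorant (deriv (K_fun \<phi>)) t" using majorant_dK_lower_bound[OF mm, of t] t by simp
  thus ?thesis using c t by (intro mult_pos_pos add_pos_nonneg) auto
qed

lemma bohr_fun_strict_mono: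
  assumes mm: "ma_minda \<phi>" and c: "0 \<le> c" and ab: "0 \<le> a" "a < b" "b < 1"
  shows "bohr_fun \<phi> c n a < bohr_fun \<phi> c n b"
  unfolding bohr_fun_def
  by (rule integral_from_0_strict_mono[OF continuous_on_bohr_integrand[OF mm] bohr_integrand_pos[OF mm c] ab])

text \<open>\<open>bohr_fun\<close> starts at \<open>0 < L\<close>. Since \<open>dK_neg \<phi> \<le> 1\<close>, it reaches at least \<open>L\<close> at every \<open>s\<close> with
  \<open>1 - s \<le> d * s\<^sup>2\<close>, where \<open>d\<close> is the derivative of \<open>\<phi>\<close> at \<open>0\<close>; take
  \<open>s = max (1 / 2) (1 - d / 4)\<close> and use the intermediate value theorem.\<close>

lemma bohr_fun_root:
  assumes mm: "ma_minda \<phi>" and c: "0 \<le> c" "c \<le> 1" and n: "1 \<le> n"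
  defines "L \<equiv> integral {0..1} (\<lambda>t. (1 - c * t ^ n) * dK_neg \<phi> t)"
  obtains r where "0 < r" "r < 1" "bohr_fun \<phi> c n r = L"
proof -
  define d where "d = Re (deriv \<phi> 0)"
  have d: "0 < d" using ma_mindaD(6)[OF mm] by (simp add: d_def)
  note int = weighted_dK_neg_integrable[OF mm c]
  have pos: "0 < (1 - c * t ^ n) * dK_neg \<phi> t" if t: "0 < t" "t < 1" for t
  proof -
    have "c * t ^ n \<le> 1 * t ^ n" using c t by (intro mult_right_mono) auto
    also have "\<dots> < 1" using t n by (simp add: power_less_one_iff)
    finally show ?thesis using dK_neg_pos[of \<phi> t] by simp
  qed
  have L0: "0 < L"
  proof -
    have "0 < integral {0..1/2} (\<lambda>t. (1 - c * t ^ n) * dK_neg \<phi> t)"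
      using integral_from_0_strict_mono[OF continuous_on_weighted_dK_neg[OF mm] pos, of 0 "1/2"] by simp
    also have "\<dots> \<le> L" unfolding L_def
    proof (rule integral_subset_le)
      show "\<forall>t\<in>{0..1}. 0 \<le> (1 - c * t ^ n) * dK_neg \<phi> t"
      proof
        fix t :: real assume t: "t \<in> {0..1}"
        have "c * t ^ n \<le> 1 * 1" using c t by (intro mult_mono) (auto simp: power_le_one)
        thus "0 \<le> (1 - c * t ^ n) * dK_neg \<phi> t" using dK_neg_pos[of \<phi> t] by simp
      qed
    qed (use int in \<open>auto intro!: integrable_continuous_interval continuous_on_subset[OF continuous_on_weighted_dK_neg[OF mm]]\<close>)
    finally show ?thesis .
  qed
  define s where "s = max (1 / 2) (1 - d / 4)"
  have s: "1 / 2 \<le> s" "s < 1" "1 - s \<le> d / 4" using d by (auto simp: s_def max_def field_simps)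
  have "L \<le> bohr_fun \<phi> c n s"
  proof -
    have int1: "dK_neg \<phi> integrable_on {a..b}" if "{a..b} \<subseteq> {0..1}" for a b
      using integrable_on_subinterval[OF int(1) that] .
    have "L \<le> integral {0..1} (dK_neg \<phi>)"
      unfolding L_def
    proof (rule integral_le[OF int(3) int(1)])
      fix t :: real assume t: "t \<in> {0..1}"
      have "(1 - c * t ^ n) * dK_neg \<phi> t \<le> 1 * dK_neg \<phi> t"
        by (rule mult_right_mono) (use c t dK_neg_pos[of \<phi> t] in auto)
      thus "(1 - c * t ^ n) * dK_neg \<phi> t \<le> dK_neg \<phi> t" by simp
    qed
    also have "\<dots> = integral {0..s} (dK_neg \<phi>) + integral {s..1} (dK_neg \<phi>)"
      using Henstock_Kurzweil_Integration.integral_combine[of 0 s 1 "dK_neg \<phi>"] s int(1) by simp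
    also have "integral {s..1} (dK_neg \<phi>) \<le> integral {s..1} (\<lambda>_. 1)"
    proof -
      have "integral {s..1} (dK_neg \<phi>) = integral {s<..<1} (dK_neg \<phi>)" by (rule integral_open_interval_real)
      also have "\<dots> \<le> integral {s<..<1} (\<lambda>_. 1)"
        by (rule integral_le) (use s int1[of s 1] dK_neg_le_1[OF mm] integrable_on_open_interval_real in \<open>auto simp: integrable_on_open_interval_real\<close>)
      also have "\<dots> = integral {s..1} (\<lambda>_. 1)" by (rule integral_open_interval_real[symmetric])
      finally show ?thesis .
    qed
    also have "integral {s..1} (\<lambda>_. 1::real) = 1 - s" using s by simp
    also have "1 - s \<le> d * s\<^sup>2"
    proof -
      have "d * (1/2)\<^sup>2 \<le> d * s\<^sup>2" using d s by (intro mult_left_mono power_mono) auto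
      thus ?thesis using s(3) by (simp add: power2_eq_square)
    qed
    also have "integral {0..s} (dK_neg \<phi>) + d * s\<^sup>2 = integral {0..s} (\<lambda>t. dK_neg \<phi> t + 2 * d * t)"
    proof -
      have "((\<lambda>t. 2 * d * t) has_integral (d * s\<^sup>2 - d * 0\<^sup>2)) {0..s}"
        by (rule fundamental_theorem_of_calculus)
          (use s in \<open>auto intro!: derivative_eq_intros simp flip: has_real_derivative_iff_has_vector_derivative\<close>)
      from has_integral_add[OF integrable_integral[OF int1[of 0 s]] this] s
      show ?thesis by (intro integral_unique[symmetric]) auto
    qed
    also have "\<dots> \<le> bohr_fun \<phi> c n s" unfolding bohr_fun_def
    proof (rule integral_le)
      show "(\<lambda>t. dK_neg \<phi> t + 2 * d * t) integrable_on {0..s}"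
        by (intro integrable_add int1 integrable_continuous_interval continuous_intros) (use s in auto)
      show "(\<lambda>t. (1 + c * t ^ n) * majorant (deriv (K_fun \<phi>)) t) integrable_on {0..s}"
        by (intro integrable_continuous_interval continuous_on_subset[OF continuous_on_bohr_integrand[OF mm]]) (use s in auto)
      fix t assume t: "t \<in> {0..s}"
      have le: "dK_neg \<phi> t + 2 * d * t \<le> majorant (deriv (K_fun \<phi>)) t"
        unfolding d_def by (rule majorant_dK_lower_bound[OF mm]) (use t s in auto)
      have "0 \<le> dK_neg \<phi> t + 2 * d * t" using d t dK_neg_pos[of \<phi> t] by simp
      hence "1 * majorant (deriv (K_fun \<phi>)) t \<le> (1 + c * t ^ n) * majorant (deriv (K_fun \<phi>)) t"
        using le c t by (intro mult_right_mono) auto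
      thus "dK_neg \<phi> t + 2 * d * t \<le> (1 + c * t ^ n) * majorant (deriv (K_fun \<phi>)) t" using le by simp
    qed
    finally show ?thesis by simp
  qed
  moreover have b0: "bohr_fun \<phi> c n 0 = 0" by (simp add: bohr_fun_def)
  moreover have "continuous_on {0..s} (bohr_fun \<phi> c n)"
    using continuous_on_integral_from_0[OF continuous_on_bohr_integrand[OF mm] s(2)]
    by (simp add: bohr_fun_def[abs_def])
  ultimately obtain r where r: "0 \<le> r" "r \<le> s" "bohr_fun \<phi> c n r = L"
    using IVT'[of "bohr_fun \<phi> c n" 0 L s] L0 s by auto
  moreover have "r \<noteq> 0" using r b0 L0 by auto
  ultimately show ?thesis using that[of r] s by auto
qed

lemma bohr_root_iff:
  assumes mm: "ma_minda \<phi>" and z: "norm \<zeta> \<le> 1"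
  shows "bohr_root \<phi> \<zeta> n r \<longleftrightarrow> 0 < r \<and> r < 1 \<and>
    bohr_fun \<phi> (norm \<zeta>) n r = integral {0..1} (\<lambda>t. (1 - norm \<zeta> * t ^ n) * dK_neg \<phi> t)"
  unfolding bohr_root_def L_one_eq[OF mm z] of_real_eq_iff
  using bohr_fun_eq[OF mm, of r "norm \<zeta>" n] by auto

section \<open>The harmonic mapping\<close>

text \<open>The difference of the analytic parts is both holomorphic and antiholomorphic, hence constant.\<close>

lemma harmonic_decomposition_unique:
  assumes hol: "h1 holomorphic_on unit_disc" "g1 holomorphic_on unit_disc"
      "h2 holomorphic_on unit_disc" "g2 holomorphic_on unit_disc"
    and 0: "h1 0 = h2 0"
    and eq: "\<And>z. norm z < 1 \<Longrightarrow> h1 z + cnj (g1 z) = h2 z + cnj (g2 z)"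
    and z: "norm z < 1"
  shows "h1 z = h2 z"
proof -
  define D where "D = (\<lambda>z. h1 z - h2 z)"
  define E where "E = (\<lambda>z. g2 z - g1 z)"
  have hD: "D holomorphic_on unit_disc" and hE: "E holomorphic_on unit_disc"
    unfolding D_def E_def by (intro holomorphic_intros hol)+
  have DE: "D x = cnj (E x)" if "norm x < 1" for x
    using eq[OF that] by (simp add: D_def E_def algebra_simps)
  have "(D has_field_derivative 0) (at x within unit_disc)" if x: "x \<in> unit_disc" for x
  proof -
    have dD: "(D has_derivative (\<lambda>v. deriv D x * v)) (at x)" and dE: "(E has_derivative (\<lambda>v. deriv E x * v)) (at x)"
      using holomorphic_derivI[OF hD open_ball x] holomorphic_derivI[OF hE open_ball x]
      by (auto simp: has_field_derivative_def)
    have "(D has_derivative (\<lambda>v. cnj (deriv E x * v))) (at x)"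
      by (rule has_derivative_transform_within_open[OF has_derivative_cnj[OF dE] open_ball x]) (use DE in auto)
    hence "(\<lambda>v. deriv D x * v) = (\<lambda>v. cnj (deriv E x * v))" by (rule has_derivative_unique[OF dD])
    from fun_cong[OF this, of 1] fun_cong[OF this, of \<i>]
    have "deriv D x = cnj (deriv E x)" "deriv D x * \<i> = - (cnj (deriv E x) * \<i>)" by simp_all
    hence "deriv D x = 0" by simp
    thus ?thesis using holomorphic_derivI[OF hD open_ball x] by (simp add: has_field_derivative_at_within)
  qed
  then obtain c where "\<And>x. x \<in> unit_disc \<Longrightarrow> D x = c"
    using has_field_derivative_zero_constant[OF convex_ball, of 0 1 D] by blast
  hence "D z = D 0" using z by simp
  thus ?thesis using 0 by (simp add: D_def)
qed

text \<open>Membership in \<open>class_C\<close> concerns functions on all of \<open>\<complex>\<close>, but only their values in the disc matter.\<close>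

lemma class_C_cong:
  assumes h2: "h2 \<in> class_C \<phi>" and h: "h holomorphic_on unit_disc"
    and eq: "\<And>z. norm z < 1 \<Longrightarrow> h z = h2 z"
  shows "inj_on h unit_disc"
    and "\<exists>w. w holomorphic_on unit_disc \<and> w 0 = 0 \<and> w ` unit_disc \<subseteq> unit_disc \<and>
      (\<forall>z\<in>unit_disc. 1 + z * deriv (deriv h) z / deriv h z = \<phi> (w z))"
proof -
  have h2': "h2 holomorphic_on unit_disc" "inj_on h2 unit_disc"
    using h2 by (auto simp: class_C_def class_S_def)
  have "inj_on h unit_disc \<longleftrightarrow> inj_on h2 unit_disc" by (rule inj_on_cong) (use eq in auto)
  thus "inj_on h unit_disc" using h2'(2) by simp
  have d1: "deriv h z = deriv h2 z" if "z \<in> unit_disc" for z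
    by (rule complex_derivative_transform_within_open[OF h h2'(1) open_ball that]) (use eq in auto)
  have d2: "deriv (deriv h) z = deriv (deriv h2) z" if "z \<in> unit_disc" for z
    by (rule complex_derivative_transform_within_open[OF _ _ open_ball that d1])
      (auto intro!: holomorphic_deriv h h2')
  have "subordinate (\<lambda>z. 1 + z * deriv (deriv h2) z / deriv h2 z) \<phi>" using h2 by (simp add: class_C_def)
  then obtain w where "w holomorphic_on unit_disc" "w 0 = 0" "w ` unit_disc \<subseteq> unit_disc"
    "\<forall>z\<in>unit_disc. 1 + z * deriv (deriv h2) z / deriv h2 z = \<phi> (w z)"
    unfolding subordinate_def by blast
  thus "\<exists>w. w holomorphic_on unit_disc \<and> w 0 = 0 \<and> w ` unit_disc \<subseteq> unit_disc \<and>
      (\<forall>z\<in>unit_disc. 1 + z * deriv (deriv h) z / deriv h z = \<phi> (w z))"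
    using d1 d2 by (intro exI[of _ w]) simp
qed

lemma convex_function_log_deriv:
  assumes mm: "ma_minda \<phi>" and h: "h holomorphic_on unit_disc" "inj_on h unit_disc" "deriv h 0 = 1"
    and eq: "\<And>z. norm z < 1 \<Longrightarrow> 1 + z * deriv (deriv h) z / deriv h z = \<phi> (w z)"
  obtains P where "P holomorphic_on unit_disc" "P 0 = 0" "\<And>z. norm z < 1 \<Longrightarrow> deriv h z = exp (P z)"
    "\<And>z. norm z < 1 \<Longrightarrow> z * deriv P z = \<phi> (w z) - 1"
proof -
  have h': "deriv h holomorphic_on unit_disc" by (rule holomorphic_deriv[OF h(1) open_ball])
  have nz: "deriv h z \<noteq> 0" if "z \<in> unit_disc" for z
    by (rule holomorphic_injective_imp_regular[OF h(1) open_ball h(2) that])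
  obtain G where G: "G holomorphic_on unit_disc" "\<And>z. z \<in> unit_disc \<Longrightarrow> deriv h z = exp (G z)"
    using contractible_imp_holomorphic_log[OF h' convex_imp_contractible[OF convex_ball] nz] by auto
  define P where "P = (\<lambda>z. G z - G 0)"
  have hP: "P holomorphic_on unit_disc" unfolding P_def by (intro holomorphic_intros G)
  have eP: "deriv h z = exp (P z)" if "norm z < 1" for z
    using G(2)[of z] G(2)[of 0] h(3) that by (simp add: P_def exp_diff)
  have "z * deriv P z = \<phi> (w z) - 1" if z: "norm z < 1" for z
  proof -
    have "(P has_field_derivative deriv P z) (at z)" using holomorphic_derivI[OF hP open_ball, of z] z by simp
    hence "((\<lambda>z. exp (P z)) has_field_derivative (exp (P z) * deriv P z)) (at z)"
      by (auto intro!: derivative_eq_intros)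
    hence "(deriv h has_field_derivative (exp (P z) * deriv P z)) (at z)"
      by (rule has_field_derivative_transform_within_open[of _ _ _ unit_disc]) (use z eP in auto)
    hence "deriv (deriv h) z = deriv h z * deriv P z" using eP[OF z] by (simp add: DERIV_imp_deriv)
    thus ?thesis using eq[OF z] nz[of z] z by (simp add: field_simps)
  qed
  thus ?thesis using that[of P] hP eP by (auto simp: P_def)
qed

lemma majorant_deriv_le_majorant_dK:
  assumes mm: "ma_minda \<phi>"
    and P: "P holomorphic_on unit_disc" "P 0 = 0"
    and w: "w holomorphic_on unit_disc" "w 0 = 0" "\<And>z. norm z < 1 \<Longrightarrow> norm (w z) < 1"
    and ode: "\<And>z. norm z < 1 \<Longrightarrow> z * deriv P z = \<phi> (w z) - 1"
    and F: "F holomorphic_on unit_disc" "\<And>z. norm z < 1 \<Longrightarrow> F z = exp (P z)" and t: "0 \<le> t" "t \<le> 1 / 3"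
  shows "majorant F t \<le> majorant (deriv (K_fun \<phi>)) t"
proof -
  obtain \<omega> where \<omega>: "\<omega> holomorphic_on unit_disc" "\<And>z. norm z < 1 \<Longrightarrow> norm (\<omega> z) \<le> norm z"
    "\<And>z. norm z < 1 \<Longrightarrow> P z = log_dK \<phi> (\<omega> z)"
    using subordinate_log_dK[OF mm P w ode] by blast
  show ?thesis
  proof (rule majorant_subordinate[OF _ \<omega>(1,2) F(1) _ t])
    show "deriv (K_fun \<phi>) holomorphic_on unit_disc" by (rule holomorphic_deriv[OF K_fun_holomorphic[OF mm] open_ball])
    fix z :: complex assume z: "norm z < 1"
    hence "norm (\<omega> z) < 1" using \<omega>(2)[OF z] by simp
    thus "F z = deriv (K_fun \<phi>) (\<omega> z)" using F(2)[OF z] \<omega>(3)[OF z] deriv_K_fun[OF mm] by simp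
  qed
qed

lemma majorant_monomial_mult:
  assumes F: "F holomorphic_on unit_disc" and G: "G holomorphic_on unit_disc"
    and eq: "\<And>z. norm z < 1 \<Longrightarrow> G z = \<zeta> * z ^ n * F z" and t: "0 \<le> t" "t < 1"
  shows "majorant G t = norm \<zeta> * (t ^ n * majorant F t)"
proof -
  have ev: "\<forall>\<^sub>F z in nhds 0. norm (z::complex) < 1"
    using eventually_nhds_in_open[of unit_disc "0::complex"] by simp
  have "(\<lambda>z. \<zeta> * (z ^ n * F z)) has_fps_expansion fps_const \<zeta> * (fps_X ^ n * fps_expansion F 0)"
    by (intro fps_expansion_intros has_fps_expansion_disc F)
  moreover have "G has_fps_expansion fps_const \<zeta> * (fps_X ^ n * fps_expansion F 0) \<longleftrightarrow>
      (\<lambda>z. \<zeta> * (z ^ n * F z)) has_fps_expansion fps_const \<zeta> * (fps_X ^ n * fps_expansion F 0)"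
    by (rule has_fps_expansion_cong[OF eventually_mono[OF ev] refl]) (use eq in auto)
  ultimately have E: "fps_expansion G 0 = fps_const \<zeta> * (fps_X ^ n * fps_expansion F 0)"
    by (intro fps_expansion_eqI) simp
  have c: "taylor G k = (if k < n then 0 else \<zeta> * taylor F (k - n))" for k
    unfolding E by (simp add: fps_X_power_mult_nth)
  have t1: "\<bar>t\<bar> < 1" using t by simp
  have "majorant G t = (\<Sum>k. norm (taylor G (k + n)) * t ^ (k + n)) + (\<Sum>k<n. norm (taylor G k) * t ^ k)"
    unfolding majorant_def by (rule suminf_split_initial_segment[OF summable_majorant[OF G t1]])
  also have "(\<Sum>k<n. norm (taylor G k) * t ^ k) = 0" by (rule sum.neutral) (simp add: c)
  also have "(\<Sum>k. norm (taylor G (k + n)) * t ^ (k + n)) = (\<Sum>k. (norm \<zeta> * t ^ n) * (norm (taylor F k) * t ^ k))"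
    by (rule suminf_cong) (simp add: c norm_mult power_add)
  also have "\<dots> = (norm \<zeta> * t ^ n) * majorant F t"
    unfolding majorant_def by (rule suminf_mult[OF summable_majorant[OF F t1]])
  finally show ?thesis by simp
qed

lemma harmonic_majorant_le_bohr_fun:
  assumes mm: "ma_minda \<phi>" and h: "h holomorphic_on unit_disc" "h 0 = 0"
    and g: "g holomorphic_on unit_disc" "g 0 = 0"
    and dil: "\<And>z. norm z < 1 \<Longrightarrow> deriv g z = \<zeta> * z ^ n * deriv h z"
    and le: "\<And>t. 0 \<le> t \<Longrightarrow> t \<le> 1 / 3 \<Longrightarrow> majorant (deriv h) t \<le> majorant (deriv (K_fun \<phi>)) t"
    and r: "0 \<le> r" "r \<le> 1 / 3"
  shows "majorant h r + majorant g r \<le> bohr_fun \<phi> (norm \<zeta>) n r"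
proof -
  have r1: "r < 1" using r by simp
  have h': "deriv h holomorphic_on unit_disc" and g': "deriv g holomorphic_on unit_disc"
    by (intro holomorphic_deriv h g open_ball)+
  have "((\<lambda>t. majorant (deriv h) t + majorant (deriv g) t) has_integral (majorant h r + majorant g r)) {0..r}"
    by (intro has_integral_add majorant_has_integral_deriv h g r r1)
  moreover have "((\<lambda>t. (1 + norm \<zeta> * t ^ n) * majorant (deriv (K_fun \<phi>)) t) has_integral bohr_fun \<phi> (norm \<zeta>) n r) {0..r}"
    unfolding bohr_fun_def
    by (intro integrable_integral integrable_continuous_interval
        continuous_on_subset[OF continuous_on_bohr_integrand[OF mm]]) (use r in auto)
  ultimately show ?thesis
  proof (rule has_integral_le)
    fix t assume t: "t \<in> {0..r}"
    have "majorant (deriv g) t = norm \<zeta> * (t ^ n * majorant (deriv h) t)"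
      by (rule majorant_monomial_mult[OF h' g' dil]) (use t r in auto)
    hence "majorant (deriv h) t + majorant (deriv g) t = (1 + norm \<zeta> * t ^ n) * majorant (deriv h) t"
      by (simp add: algebra_simps)
    also have "\<dots> \<le> (1 + norm \<zeta> * t ^ n) * majorant (deriv (K_fun \<phi>)) t"
      by (intro mult_left_mono le) (use t r in auto)
    finally show "majorant (deriv h) t + majorant (deriv g) t \<le> (1 + norm \<zeta> * t ^ n) * majorant (deriv (K_fun \<phi>)) t" .
  qed
qed

text \<open>The first coefficient of \<open>g\<close> is simply dropped, which is why this is an inequality.\<close>

lemma harmonic_majorant_series:
  assumes h: "h holomorphic_on unit_disc" and g: "g holomorphic_on unit_disc" "g 0 = 0"
    and a: "\<And>z. z \<in> unit_disc \<Longrightarrow> (\<lambda>k. a (k + 2) * z ^ (k + 2)) sums (h z - z)"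
    and b: "\<And>z. z \<in> unit_disc \<Longrightarrow> (\<lambda>k. b (k + 1) * z ^ (k + 1)) sums g z"
    and r: "0 \<le> r" "r < 1"
  shows "r + (\<Sum>k. (norm (a (k + 2)) + norm (b (k + 2))) * r ^ (k + 2)) \<le> majorant h r + majorant g r"
proof -
  have r1: "\<bar>r\<bar> < 1" using r by simp
  have split: "majorant F r = (\<Sum>k. norm (taylor F (k + 2)) * r ^ (k + 2)) + (norm (taylor F 0) + norm (taylor F 1) * r)"
    and smb: "summable (\<lambda>k. norm (taylor F (k + 2)) * r ^ (k + 2))" if F: "F holomorphic_on unit_disc" for F
  proof -
    note s = summable_majorant[OF F r1]
    show "majorant F r = (\<Sum>k. norm (taylor F (k + 2)) * r ^ (k + 2)) + (norm (taylor F 0) + norm (taylor F 1) * r)"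
      unfolding majorant_def by (subst suminf_split_initial_segment[OF s, of 2]) (simp add: numeral_2_eq_2)
    show "summable (\<lambda>k. norm (taylor F (k + 2)) * r ^ (k + 2))"
      using s by (rule summable_ignore_initial_segment)
  qed
  have ca: "taylor h k = (if k = 0 then 0 else if k = 1 then 1 else a k)" for k
  proof (rule taylor_unique)
    fix z :: complex assume z: "norm z < 1"
    let ?c = "\<lambda>k. (if k = 0 then 0 else if k = 1 then 1 else a k) * z ^ k"
    have "(\<lambda>k. ?c (k + 2)) sums (h z - (\<Sum>k<2. ?c k))"
      using a[of z] z by (simp add: numeral_2_eq_2)
    thus "?c sums h z" by (subst (asm) sums_iff_shift) simp
  qed
  have cb: "taylor g k = (if k = 0 then 0 else b k)" for k
  proof (rule taylor_unique)
    fix z :: complex assume z: "norm z < 1"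
    let ?c = "\<lambda>k. (if k = 0 then 0 else b k) * z ^ k"
    have "(\<lambda>k. ?c (k + 1)) sums (g z - (\<Sum>k<1. ?c k))" using b[of z] z by simp
    thus "?c sums g z" by (subst (asm) sums_iff_shift) simp
  qed
  have "(\<Sum>k. (norm (a (k + 2)) + norm (b (k + 2))) * r ^ (k + 2))
     = (\<Sum>k. norm (taylor h (k + 2)) * r ^ (k + 2)) + (\<Sum>k. norm (taylor g (k + 2)) * r ^ (k + 2))"
    by (subst suminf_add[OF smb[OF h] smb[OF g(1)]]) (simp add: ca cb algebra_simps)
  thus ?thesis unfolding split[OF h] split[OF g(1)] using r by (simp add: ca cb)
qed

lemma harmonic_distance_lower_bound:
  assumes mm: "ma_minda \<phi>" and n: "1 \<le> n" and z: "norm \<zeta> \<le> 1"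
    and h: "h holomorphic_on unit_disc" "inj_on h unit_disc" "h 0 = 0"
    and g: "g holomorphic_on unit_disc" "g 0 = 0"
    and sense: "\<And>z. norm z < 1 \<Longrightarrow> norm (deriv g z) < norm (deriv h z)"
    and dil: "\<And>z. norm z < 1 \<Longrightarrow> deriv g z = \<zeta> * z ^ n * deriv h z"
    and pos: "\<And>z. norm z < 1 \<Longrightarrow> 0 < Re (1 + z * deriv (deriv h) z / deriv h z)"
    and growth: "\<And>z. norm z < 1 \<Longrightarrow> dK_neg \<phi> (norm z) \<le> norm (deriv h z)"
  shows "integral {0..1} (\<lambda>t. (1 - norm \<zeta> * t ^ n) * dK_neg \<phi> t)
    \<le> infdist 0 (frontier ((\<lambda>z. h z + cnj (g z)) ` unit_disc))"
proof -
  define f where "f = (\<lambda>z. h z + cnj (g z))"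
  define u where "u = (\<lambda>t. (1 - norm \<zeta> * t ^ n) * dK_neg \<phi> t)"
  have contu: "continuous_on {0..<1} u" unfolding u_def by (rule continuous_on_weighted_dK_neg[OF mm])
  have zn: "norm \<zeta> * t ^ n \<le> t" if t: "0 \<le> t" "t < 1" for t :: real
  proof -
    have "norm \<zeta> * t ^ n \<le> 1 * t ^ 1" using z t n by (intro mult_mono power_decreasing) auto
    thus ?thesis by simp
  qed
  have dil': "norm (deriv g x) = norm \<zeta> * norm x ^ n * norm (deriv h x)" if "norm x < 1" for x
    using dil[OF that] by (simp add: norm_mult norm_power)
  have contr: "norm (g z1 - g z2) < norm (h z1 - h z2)" if "norm z1 < 1" "norm z2 < 1" "z1 \<noteq> z2" for z1 z2
  proof (rule harmonic_contraction[OF h(1,2) pos g(1) _ that])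
    fix x :: complex assume x: "norm x < 1"
    show "norm (deriv g x) \<le> norm x * norm (deriv h x)"
      unfolding dil'[OF x] by (rule mult_right_mono[OF zn]) (use x in auto)
  qed
  have inj: "inj_on f unit_disc"
  proof (rule inj_onI, rule ccontr)
    fix x y assume xy: "x \<in> unit_disc" "y \<in> unit_disc" "f x = f y" "x \<noteq> y"
    have "h x - h y = - cnj (g x - g y)" using xy(3) by (simp add: f_def algebra_simps)
    hence "norm (h x - h y) = norm (g x - g y)" by (simp only: norm_minus_cancel complex_mod_cnj)
    thus False using contr[of x y] xy by simp
  qed
  have ne: "frontier (f ` unit_disc) \<noteq> {}"
    unfolding frontier_eq_empty f_def
    using harmonic_image_neq_UNIV[OF h(1,2) convexity_imp_convex_image[OF h(1,2) pos] contr] by auto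
  have "integral {0..1} u \<le> norm p" if p: "p \<in> frontier (f ` unit_disc)" for p
  proof -
    have "integral {0..R} u \<le> norm p" if R: "0 \<le> R" "R < 1" for R
    proof (rule harmonic_distance_to_frontier[where h = h and g = g and l = "\<lambda>x. integral {0..x} u" and l' = u])
      show "inj_on (\<lambda>z. h z + cnj (g z)) unit_disc" using inj by (simp add: f_def)
      show "p \<in> frontier ((\<lambda>z. h z + cnj (g z)) ` unit_disc)" using p by (simp add: f_def)
      show "continuous_on {0..<1} (\<lambda>x. integral {0..x} u)"
        by (rule continuous_on_subset[OF indefinite_integral_continuous_1[of u 0 1]])
          (use weighted_dK_neg_integrable(3)[OF mm norm_ge_zero z] in \<open>auto simp: u_def\<close>)
      show "0 < u r" if "0 < r" "r < 1" for r
        using zn[of r] that dK_neg_pos[of \<phi> r] by (simp add: u_def)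
      show "u (norm x) \<le> norm (deriv h x) - norm (deriv g x)" if x: "norm x < 1" for x
      proof -
        have "u (norm x) \<le> (1 - norm \<zeta> * norm x ^ n) * norm (deriv h x)"
          unfolding u_def by (rule mult_left_mono[OF growth[OF x]]) (use zn[of "norm x"] x in simp)
        thus ?thesis by (simp add: dil'[OF x] algebra_simps)
      qed
    qed (use h g sense R integral_from_0_has_derivative[OF contu] in auto)
    hence "\<forall>\<^sub>F R in at_left 1. integral {0..R} u \<le> norm p"
      by (intro eventually_mono[OF eventually_at_left_real[OF zero_less_one]]) auto
    moreover have "((\<lambda>x. integral {0..x} u) \<longlongrightarrow> integral {0..1} u) (at_left 1)"
      unfolding u_def by (rule integral_tendsto_at_left_1[OF weighted_dK_neg_integrable(3)[OF mm norm_ge_zero z]])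
    ultimately show ?thesis by (intro tendsto_upperbound) auto
  qed
  hence "integral {0..1} u \<le> infdist 0 (frontier (f ` unit_disc))"
    unfolding infdist_notempty[OF ne] by (intro cINF_greatest ne) simp
  thus ?thesis by (simp add: u_def f_def)
qed

theorem theorem4p1:
  fixes \<phi> f h g :: "complex \<Rightarrow> complex" and \<zeta> :: complex and n :: nat
    and a b :: "nat \<Rightarrow> complex"
  assumes "ma_minda \<phi>"
    and "n \<ge> 1"
    and "f \<in> class_HC n \<phi>"
    and "class_H_parts f h g"
    and "\<And>z. z \<in> unit_disc \<Longrightarrow> (\<lambda>k. a (k + 2) * z ^ (k + 2)) sums (h z - z)"
    and "\<And>z. z \<in> unit_disc \<Longrightarrow> (\<lambda>k. b (k + 1) * z ^ (k + 1)) sums g z"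
    and "\<And>z. z \<in> unit_disc \<Longrightarrow> deriv g z = \<zeta> * z ^ n * deriv h z"
    and "norm \<zeta> \<le> 1 / (2 * real n - 1)"
  shows "\<exists>r\<^sub>f. bohr_root \<phi> \<zeta> n r\<^sub>f \<and> (\<forall>r. bohr_root \<phi> \<zeta> n r \<longrightarrow> r\<^sub>f \<le> r) \<and>
    (\<forall>z::complex. norm z \<le> min (1 / 3) r\<^sub>f \<longrightarrow>
      norm z + (\<Sum>k. (norm (a (k + 2)) + norm (b (k + 2))) * norm z ^ (k + 2))
        \<le> infdist (f 0) (frontier (f ` unit_disc)))"
proof -
  note mm = assms(1)
  have "1 / (2 * real n - 1) \<le> 1" using assms(2) by simp
  hence \<zeta>: "norm \<zeta> \<le> 1" using assms(8) by linarith
  have h: "h holomorphic_on unit_disc" "h 0 = 0" "deriv h 0 = 1"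
    and g: "g holomorphic_on unit_disc" "g 0 = 0"
    and f: "\<And>z. norm z < 1 \<Longrightarrow> f z = h z + cnj (g z)"
    and sense: "\<And>z. norm z < 1 \<Longrightarrow> norm (deriv g z) < norm (deriv h z)"
    using assms(4) by (auto simp: class_H_parts_def)
  have dil: "\<And>z. norm z < 1 \<Longrightarrow> deriv g z = \<zeta> * z ^ n * deriv h z" using assms(7) by simp
  \<comment> \<open>the analytic part of \<open>f\<close> is unique, so \<open>h\<close> agrees with the one that witnesses membership\<close>
  obtain h2 g2 where h2: "class_H_parts f h2 g2" "h2 \<in> class_C \<phi>"
    using assms(3) by (auto simp: class_HC_def)
  have eq: "h z = h2 z" if "norm z < 1" for z
    by (rule harmonic_decomposition_unique[OF h(1) g(1) _ _ _ _ that, of h2 g2])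
      (use h2(1) h(2) f in \<open>auto simp: class_H_parts_def\<close>)
  have inj: "inj_on h unit_disc" by (rule class_C_cong(1)[OF h2(2) h(1) eq])
  obtain w where w: "w holomorphic_on unit_disc" "w 0 = 0" "w ` unit_disc \<subseteq> unit_disc"
    "\<forall>z\<in>unit_disc. 1 + z * deriv (deriv h) z / deriv h z = \<phi> (w z)"
    using class_C_cong(2)[OF h2(2) h(1) eq] by blast
  have w1: "norm (w z) < 1" if "norm z < 1" for z using w(3) that by (auto simp: image_subset_iff)
  have weq: "1 + z * deriv (deriv h) z / deriv h z = \<phi> (w z)" if "norm z < 1" for z using w(4) that by simp
  have pos: "0 < Re (1 + z * deriv (deriv h) z / deriv h z)" if "norm z < 1" for z
    unfolding weq[OF that] by (rule ma_mindaD(4)[OF mm w1[OF that]])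
  obtain P where P: "P holomorphic_on unit_disc" "P 0 = 0" "\<And>z. norm z < 1 \<Longrightarrow> deriv h z = exp (P z)"
    "\<And>z. norm z < 1 \<Longrightarrow> z * deriv P z = \<phi> (w z) - 1"
    using convex_function_log_deriv[OF mm h(1) inj h(3) weq] by blast
  have growth: "dK_neg \<phi> (norm z) \<le> norm (deriv h z)" if z: "norm z < 1" for z
    using Re_log_dK_lower_bound[OF mm P(1,2) w(1,2) w1 P(4) z] P(3)[OF z] by (simp add: dK_neg_def)
  have h': "deriv h holomorphic_on unit_disc" by (rule holomorphic_deriv[OF h(1) open_ball])
  have maj: "majorant (deriv h) t \<le> majorant (deriv (K_fun \<phi>)) t" if "0 \<le> t" "t \<le> 1 / 3" for t
    by (rule majorant_deriv_le_majorant_dK[OF mm P(1,2) w(1,2) w1 P(4) h' P(3) that])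
  define L where "L = integral {0..1} (\<lambda>t. (1 - norm \<zeta> * t ^ n) * dK_neg \<phi> t)"
  obtain rf where rf: "0 < rf" "rf < 1" "bohr_fun \<phi> (norm \<zeta>) n rf = L"
    using bohr_fun_root[OF mm norm_ge_zero \<zeta> assms(2)] unfolding L_def by blast
  have root: "bohr_root \<phi> \<zeta> n r \<longleftrightarrow> 0 < r \<and> r < 1 \<and> bohr_fun \<phi> (norm \<zeta>) n r = L" for r
    unfolding L_def by (rule bohr_root_iff[OF mm \<zeta>])
  have im: "f ` unit_disc = (\<lambda>z. h z + cnj (g z)) ` unit_disc" by (rule image_cong) (use f in auto)
  have f0: "f 0 = 0" using f[of 0] h(2) g(2) by simp
  have dist: "L \<le> infdist (f 0) (frontier (f ` unit_disc))"
    unfolding im f0 L_def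
    by (rule harmonic_distance_lower_bound[OF mm assms(2) \<zeta> h(1) inj h(2) g sense dil pos growth])
  show ?thesis
  proof (intro exI[of _ rf] conjI allI impI)
    show "bohr_root \<phi> \<zeta> n rf" using root rf by simp
  next
    fix r assume "bohr_root \<phi> \<zeta> n r"
    hence r: "0 < r" "r < 1" "bohr_fun \<phi> (norm \<zeta>) n r = L" using root by auto
    show "rf \<le> r"
    proof (rule ccontr)
      assume "\<not> rf \<le> r"
      hence "bohr_fun \<phi> (norm \<zeta>) n r < bohr_fun \<phi> (norm \<zeta>) n rf"
        by (intro bohr_fun_strict_mono mm) (use r rf in auto)
      thus False using r rf by simp
    qed
  next
    fix z :: complex assume z: "norm z \<le> min (1 / 3) rf"
    hence z': "norm z \<le> 1 / 3" "norm z \<le> rf" by auto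
    have "norm z + (\<Sum>k. (norm (a (k + 2)) + norm (b (k + 2))) * norm z ^ (k + 2)) \<le> majorant h (norm z) + majorant g (norm z)"
      by (rule harmonic_majorant_series[OF h(1) g assms(5,6)]) (use z' in auto)
    also have "\<dots> \<le> bohr_fun \<phi> (norm \<zeta>) n (norm z)"
      by (rule harmonic_majorant_le_bohr_fun[OF mm h(1,2) g dil maj norm_ge_zero z'(1)])
    also have "\<dots> \<le> bohr_fun \<phi> (norm \<zeta>) n rf"
    proof (cases "norm z = rf")
      case False
      thus ?thesis using bohr_fun_strict_mono[OF mm norm_ge_zero norm_ge_zero _ rf(2), of z \<zeta> n] z'(2) by simp
    qed simp
    also have "\<dots> = L" by (rule rf(3))
    also note dist
    finally show "norm z + (\<Sum>k. (norm (a (k + 2)) + norm (b (k + 2))) * norm z ^ (k + 2))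
        \<le> infdist (f 0) (frontier (f ` unit_disc))" .
  qed
qed

end
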